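(* Let $M^4_r$ be a nondegenerate hypersurface of a pseudo-Riemannian space form $N^5_s(c)$ with proper mean curvature vector field, satisfying $\Delta\vec H=\lambda\vec H$ with $\lambda$ a real constant, and let $\vec\xi$ be a unit normal vector field to $M^4_r$ with $\varepsilon=\langle\vec\xi,\vec\xi\rangle=\pm1$. Suppose that $M^4_r$ has exactly two distinct principal curvatures and that both are imaginary (non-real). Then: (i) if $c\varepsilon\ge0$, then $H=0$; (ii) if $c\varepsilon<0$ and $|\varepsilon\lambda|\ge-4c\varepsilon$, then $H=0$; (iii) if $c\varepsilon<0$ and $|\varepsilon\lambda|<-4c\varepsilon$, then $H=0$ or $H^2=\frac{\varepsilon\lambda-4c\varepsilon}{8}$.
   Context: Manifolds are smooth. $N^5_s(c)$ denotes a $5$-dimensional pseudo-Riemannian space form of index $s$ and constant sectional curvature $c\in\mathbb{R}$. A nondegenerate hypersurface $M^4_r$ is a $4$-dimensional manifold isometrically immersed in $N^5_s(c)$ whose induced metric is nondegenerate, of index $r$. $\nabla$ and $\widetilde\nabla$ are the Levi-Civita connections of $M^4_r$ and $N^5_s(c)$; $A$ is the shape operator, $\widetilde\nabla_X\vec\xi=-AX$. The mean curvature is $H=\frac14\varepsilon\,\mathrm{tr}A$ and $\vec H=H\vec\xi$. The Laplacian is $\Delta\vec H=-\sum_{i=1}^4\varepsilon_i(\widetilde\nabla_{e_i}\widetilde\nabla_{e_i}\vec H-\widetilde\nabla_{\nabla_{e_i}e_i}\vec H)$ for a local orthonormal frame $\{e_i\}$ of $M^4_r$ with $\langle e_i,e_i\rangle=\varepsilon_i=\pm1$.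 Principal curvatures are the eigenvalues of $A$ over $\mathbb{C}$; "imaginary" means non-real. *)

theory Defs
  imports "HOL-Analysis.Analysis"
begin

section \<open>Smooth maps between open subsets of Euclidean spaces\<close>

primrec Ck_on :: "nat \<Rightarrow> 'a::real_normed_vector set \<Rightarrow> ('a \<Rightarrow> 'b::real_normed_vector) \<Rightarrow> bool" where
  "Ck_on 0 S f \<longleftrightarrow> continuous_on S f"
| "Ck_on (Suc k) S f \<longleftrightarrow>
     (\<forall>x\<in>S. f differentiable (at x)) \<and> (\<forall>v. Ck_on k S (\<lambda>x. frechet_derivative f (at x) v))"

text \<open>Only used for open \<open>S\<close>.\<close>
definition smooth_on :: "'a::real_normed_vector set \<Rightarrow> ('a \<Rightarrow> 'b::real_normed_vector) \<Rightarrow> bool" where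
  "smooth_on S f \<longleftrightarrow> (\<forall>k. Ck_on k S f)"


section \<open>Metrics and connections in coordinates\<close>

text \<open>A metric on a coordinate domain is given by its matrix of components \<open>G z = (g\<^sub>i\<^sub>j(z))\<close>.\<close>

definition form :: "real^'n^'n \<Rightarrow> real^'n \<Rightarrow> real^'n \<Rightarrow> real" where
  "form B u v = u \<bullet> (B *v v)"

definition form_index :: "real^'n^'n \<Rightarrow> nat" where
  "form_index B = Max {dim S |S. subspace S \<and> (\<forall>v\<in>S. v \<noteq> 0 \<longrightarrow> form B v v < 0)}"

definition pdiff :: "'n \<Rightarrow> (real^'n \<Rightarrow> real) \<Rightarrow> real^'n \<Rightarrow> real" where
  "pdiff i f z = frechet_derivative f (at z) (axis i 1)"

definition christoffel :: "(real^'n \<Rightarrow> real^'n^'n) \<Rightarrow> real^'n \<Rightarrow> 'n \<Rightarrow> 'n \<Rightarrow> 'n \<Rightarrow> real" where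
  "christoffel G z k i j = (1/2) * (\<Sum>l\<in>UNIV. matrix_inv (G z) $ k $ l *
     (pdiff i (\<lambda>y. G y $ j $ l) z + pdiff j (\<lambda>y. G y $ i $ l) z - pdiff l (\<lambda>y. G y $ i $ j) z))"

definition christoffel_vec :: "(real^'n \<Rightarrow> real^'n^'n) \<Rightarrow> real^'n \<Rightarrow> real^'n \<Rightarrow> real^'n \<Rightarrow> real^'n" where
  "christoffel_vec G z u v =
     (\<chi> k. \<Sum>i\<in>UNIV. \<Sum>j\<in>UNIV. christoffel G z k i j * u $ i * v $ j)"

text \<open>
  The Levi-Civita connection of \<open>G\<close> acting on a vector field \<open>V\<close> along a map \<open>F\<close>, at \<open>z\<close>, in the
  direction \<open>u\<close> tangent to the source of \<open>F\<close>. For \<open>F = (\<lambda>z. z)\<close> this is the Levi-Civita connection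
  of \<open>G\<close> itself.
\<close>
definition cov_along ::
  "(real^'n \<Rightarrow> real^'n^'n) \<Rightarrow> (real^'m \<Rightarrow> real^'n) \<Rightarrow> (real^'m \<Rightarrow> real^'n) \<Rightarrow> real^'m \<Rightarrow> real^'m \<Rightarrow> real^'n"
  where
  "cov_along G F V z u = frechet_derivative V (at z) u
     + christoffel_vec G (F z) (frechet_derivative F (at z) u) (V z)"

abbreviation cov ::
  "(real^'n \<Rightarrow> real^'n^'n) \<Rightarrow> (real^'n \<Rightarrow> real^'n) \<Rightarrow> real^'n \<Rightarrow> real^'n \<Rightarrow> real^'n" where
  "cov G \<equiv> cov_along G (\<lambda>z. z)"

text \<open>
  \<open>R(u,v)w = \<nabla>\<^sub>u\<nabla>\<^sub>vw - \<nabla>\<^sub>v\<nabla>\<^sub>uw - \<nabla>\<^bsub>[u,v]\<^esub>w\<close> with \<open>u, v, w\<close> extended by constant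
  coefficients, so that \<open>[u,v] = 0\<close>.
\<close>
definition curvature ::
  "(real^'n \<Rightarrow> real^'n^'n) \<Rightarrow> real^'n \<Rightarrow> real^'n \<Rightarrow> real^'n \<Rightarrow> real^'n \<Rightarrow> real^'n" where
  "curvature G z u v w =
     cov G (\<lambda>y. cov G (\<lambda>_. w) y v) z u - cov G (\<lambda>y. cov G (\<lambda>_. w) y u) z v"

definition area_form :: "real^'n^'n \<Rightarrow> real^'n \<Rightarrow> real^'n \<Rightarrow> real" where
  "area_form B u v = form B u u * form B v v - (form B u v)\<^sup>2"

text \<open>Sectional curvature of the nondegenerate plane spanned by \<open>u, v\<close>, i.e. \<open>area_form (G z) u v \<noteq> 0\<close>.\<close>
definition sectional_curvature ::
  "(real^'n \<Rightarrow> real^'n^'n) \<Rightarrow> real^'n \<Rightarrow> real^'n \<Rightarrow> real^'n \<Rightarrow> real" where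
  "sectional_curvature G z u v = form (G z) (curvature G z u v v) u / area_form (G z) u v"

definition induced_metric ::
  "(real^'n \<Rightarrow> real^'n^'n) \<Rightarrow> (real^'m \<Rightarrow> real^'n) \<Rightarrow> real^'m \<Rightarrow> real^'m^'m" where
  "induced_metric G F z = (\<chi> i j. form (G (F z))
     (frechet_derivative F (at z) (axis i 1)) (frechet_derivative F (at z) (axis j 1)))"

definition orthonormal_frame_on ::
  "(real^'m \<Rightarrow> real^'m^'m) \<Rightarrow> (real^'m) set \<Rightarrow> ('m \<Rightarrow> real^'m \<Rightarrow> real^'m) \<Rightarrow> bool" where
  "orthonormal_frame_on g W e \<longleftrightarrow> (\<forall>i. smooth_on W (e i)) \<and>
     (\<forall>z\<in>W. (\<forall>i. form (g z) (e i z) (e i z) \<in> {1, -1}) \<and>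
            (\<forall>i j. i \<noteq> j \<longrightarrow> form (g z) (e i z) (e j z) = 0))"

text \<open>
  \<open>has_laplacian G F V z w\<close>: the Laplacian at \<open>z\<close> of the vector field \<open>V\<close> along the immersion \<open>F\<close>
  is \<open>w\<close>, where the source of \<open>F\<close> carries the induced metric. The sign is that of
  \<open>- trace \<nabla>\<^sup>2\<close>. The expression does not depend on the local orthonormal frame \<open>e\<close>
  around \<open>z\<close>.
\<close>
definition has_laplacian ::
  "(real^'n \<Rightarrow> real^'n^'n) \<Rightarrow> (real^'m \<Rightarrow> real^'n) \<Rightarrow> (real^'m \<Rightarrow> real^'n) \<Rightarrow> real^'m \<Rightarrow> real^'n \<Rightarrow> bool"
  where
  "has_laplacian G F V z w \<longleftrightarrow>
     (\<exists>W e. open W \<and> z \<in> W \<and> orthonormal_frame_on (induced_metric G F) W e \<and>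
        w = - (\<Sum>i\<in>UNIV. form (induced_metric G F z) (e i z) (e i z) *\<^sub>R
               (cov_along G F (\<lambda>y. cov_along G F V y (e i y)) z (e i z)
                - cov_along G F V z (cov (induced_metric G F) (e i) z (e i z)))))"


section \<open>Smooth manifolds\<close>

type_synonym ('a, 'n) chart = "'a set \<times> ('a \<Rightarrow> real^'n)"

abbreviation chart_dom :: "('a, 'n) chart \<Rightarrow> 'a set" where
  "chart_dom \<equiv> fst"

abbreviation chart_map :: "('a, 'n) chart \<Rightarrow> 'a \<Rightarrow> real^'n" where
  "chart_map \<equiv> snd"

definition chart_inv :: "('a, 'n) chart \<Rightarrow> real^'n \<Rightarrow> 'a" where
  "chart_inv x = inv_into (chart_dom x) (chart_map x)"

definition is_chart :: "('a::topological_space, 'n::finite) chart \<Rightarrow> bool" where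
  "is_chart x \<longleftrightarrow> open (chart_dom x) \<and> open (chart_map x ` chart_dom x) \<and>
     homeomorphism (chart_dom x) (chart_map x ` chart_dom x) (chart_map x) (chart_inv x)"

text \<open>The underlying set of the manifold is the whole type; the atlas need not be maximal.\<close>
definition smooth_manifold ::
  "('a::{t2_space,second_countable_topology}, 'n::finite) chart set \<Rightarrow> bool" where
  "smooth_manifold \<A> \<longleftrightarrow> (\<forall>x\<in>\<A>. is_chart x) \<and> (\<Union>x\<in>\<A>. chart_dom x) = UNIV \<and>
     (\<forall>x\<in>\<A>. \<forall>x'\<in>\<A>. smooth_on (chart_map x ` (chart_dom x \<inter> chart_dom x')) (chart_map x' \<circ> chart_inv x))"

definition chart_at :: "('a, 'n) chart set \<Rightarrow> 'a \<Rightarrow> ('a, 'n) chart" where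
  "chart_at \<A> p = (SOME x. x \<in> \<A> \<and> p \<in> chart_dom x)"

text \<open>Jacobian at \<open>p\<close> of the change of coordinates from \<open>x\<close> to \<open>x'\<close>.\<close>
definition jacobian :: "('a, 'n) chart \<Rightarrow> ('a, 'n::finite) chart \<Rightarrow> 'a \<Rightarrow> real^'n^'n" where
  "jacobian x x' p = matrix (frechet_derivative (chart_map x' \<circ> chart_inv x) (at (chart_map x p)))"

text \<open>
  A tensor field is given by its components in every chart of the atlas: \<open>T x p\<close> are the
  components at the point \<open>p\<close> in the chart \<open>x\<close>, and are only meaningful when \<open>p \<in> chart_dom x\<close>.
  Components in different charts are related by the usual transformation law.
\<close>

definition metric_rep :: "(('a, 'n) chart \<Rightarrow> 'a \<Rightarrow> real^'n^'n) \<Rightarrow> ('a, 'n) chart \<Rightarrow> real^'n \<Rightarrow> real^'n^'n" where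
  "metric_rep G y = G y \<circ> chart_inv y"

definition pseudo_riemannian_metric ::
  "('a::{t2_space,second_countable_topology}, 'n::finite) chart set
   \<Rightarrow> (('a, 'n) chart \<Rightarrow> 'a \<Rightarrow> real^'n^'n) \<Rightarrow> nat \<Rightarrow> bool" where
  "pseudo_riemannian_metric \<B> G s \<longleftrightarrow>
     (\<forall>y\<in>\<B>. smooth_on (chart_map y ` chart_dom y) (metric_rep G y)) \<and>
     (\<forall>y\<in>\<B>. \<forall>q\<in>chart_dom y.
        transpose (G y q) = G y q \<and> invertible (G y q) \<and> form_index (G y q) = s) \<and>
     (\<forall>y\<in>\<B>. \<forall>y'\<in>\<B>. \<forall>q\<in>chart_dom y \<inter> chart_dom y'. \<forall>u v.
        form (G y q) u v = form (G y' q) (jacobian y y' q *v u) (jacobian y y' q *v v))"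

definition space_form ::
  "('a::{t2_space,second_countable_topology}, 'n::finite) chart set
   \<Rightarrow> (('a, 'n) chart \<Rightarrow> 'a \<Rightarrow> real^'n^'n) \<Rightarrow> nat \<Rightarrow> real \<Rightarrow> bool" where
  "space_form \<B> G s c \<longleftrightarrow> smooth_manifold \<B> \<and> pseudo_riemannian_metric \<B> G s \<and>
     (\<forall>y\<in>\<B>. \<forall>q\<in>chart_dom y. \<forall>u v. area_form (G y q) u v \<noteq> 0 \<longrightarrow>
        sectional_curvature (metric_rep G y) (chart_map y q) u v = c)"


section \<open>Nondegenerate hypersurfaces\<close>

text \<open>Points of the source lying in the chart \<open>x\<close> whose image under \<open>f\<close> lies in the chart \<open>y\<close>.\<close>
definition overlap :: "('a \<Rightarrow> 'b) \<Rightarrow> ('a, 'm) chart \<Rightarrow> ('b, 'n) chart \<Rightarrow> 'a set" where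
  "overlap f x y = chart_dom x \<inter> f -` chart_dom y"

definition map_rep ::
  "('a \<Rightarrow> 'b) \<Rightarrow> ('a, 'm) chart \<Rightarrow> ('b, 'n) chart \<Rightarrow> real^'m \<Rightarrow> real^'n" where
  "map_rep f x y = chart_map y \<circ> f \<circ> chart_inv x"

text \<open>
  A vector field along \<open>f\<close> assigns to \<open>p\<close> a tangent vector at \<open>f p\<close>, so its components are
  indexed by charts \<open>y\<close> of the target and points \<open>p\<close> of the source.
\<close>
definition field_rep ::
  "(('b, 'n) chart \<Rightarrow> 'a \<Rightarrow> real^'n) \<Rightarrow> ('a, 'm) chart \<Rightarrow> ('b, 'n) chart \<Rightarrow> real^'m \<Rightarrow> real^'n" where
  "field_rep V x y = V y \<circ> chart_inv x"

definition smooth_map ::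
  "('a::topological_space, 'm::finite) chart set \<Rightarrow> ('b::topological_space, 'n::finite) chart set
   \<Rightarrow> ('a \<Rightarrow> 'b) \<Rightarrow> bool" where
  "smooth_map \<A> \<B> f \<longleftrightarrow> continuous_on UNIV f \<and>
     (\<forall>x\<in>\<A>. \<forall>y\<in>\<B>. smooth_on (chart_map x ` overlap f x y) (map_rep f x y))"

definition smooth_field_along ::
  "('a, 'm::finite) chart set \<Rightarrow> ('b, 'n::finite) chart set \<Rightarrow> ('a \<Rightarrow> 'b)
   \<Rightarrow> (('b, 'n) chart \<Rightarrow> 'a \<Rightarrow> real^'n) \<Rightarrow> bool" where
  "smooth_field_along \<A> \<B> f V \<longleftrightarrow>
     (\<forall>x\<in>\<A>. \<forall>y\<in>\<B>. smooth_on (chart_map x ` overlap f x y) (field_rep V x y)) \<and>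
     (\<forall>y\<in>\<B>. \<forall>y'\<in>\<B>. \<forall>p\<in>f -` (chart_dom y \<inter> chart_dom y').
        V y' p = jacobian y y' (f p) *v V y p)"

text \<open>Immersion with nondegenerate induced metric of index \<open>r\<close>; the source carries the induced metric.\<close>
definition nondegenerate_immersion ::
  "('a::{t2_space,second_countable_topology}, 'm::finite) chart set
   \<Rightarrow> ('b::{t2_space,second_countable_topology}, 'n::finite) chart set
   \<Rightarrow> (('b, 'n) chart \<Rightarrow> 'b \<Rightarrow> real^'n^'n) \<Rightarrow> ('a \<Rightarrow> 'b) \<Rightarrow> nat \<Rightarrow> bool" where
  "nondegenerate_immersion \<A> \<B> G f r \<longleftrightarrow> smooth_manifold \<A> \<and> smooth_map \<A> \<B> f \<and>
     (\<forall>x\<in>\<A>. \<forall>y\<in>\<B>. \<forall>p\<in>overlap f x y.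
        inj (frechet_derivative (map_rep f x y) (at (chart_map x p))) \<and>
        invertible (induced_metric (metric_rep G y) (map_rep f x y) (chart_map x p)) \<and>
        form_index (induced_metric (metric_rep G y) (map_rep f x y) (chart_map x p)) = r)"

definition unit_normal_field ::
  "('a, 'm::finite) chart set \<Rightarrow> ('b, 'n::finite) chart set
   \<Rightarrow> (('b, 'n) chart \<Rightarrow> 'b \<Rightarrow> real^'n^'n) \<Rightarrow> ('a \<Rightarrow> 'b)
   \<Rightarrow> (('b, 'n) chart \<Rightarrow> 'a \<Rightarrow> real^'n) \<Rightarrow> real \<Rightarrow> bool" where
  "unit_normal_field \<A> \<B> G f \<xi> \<epsilon> \<longleftrightarrow> \<epsilon> \<in> {1, -1} \<and> smooth_field_along \<A> \<B> f \<xi> \<and>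
     (\<forall>x\<in>\<A>. \<forall>y\<in>\<B>. \<forall>p\<in>overlap f x y.
        form (G y (f p)) (\<xi> y p) (\<xi> y p) = \<epsilon> \<and>
        (\<forall>u. form (G y (f p)) (\<xi> y p)
               (frechet_derivative (map_rep f x y) (at (chart_map x p)) u) = 0))"

text \<open>
  \<open>A\<close> is the endomorphism field of the tangent bundle of the hypersurface determined by the
  Weingarten formula for the unit normal \<open>\<xi>\<close>.
\<close>
definition shape_operator ::
  "('a, 'm::finite) chart set \<Rightarrow> ('b, 'n::finite) chart set
   \<Rightarrow> (('b, 'n) chart \<Rightarrow> 'b \<Rightarrow> real^'n^'n) \<Rightarrow> ('a \<Rightarrow> 'b)
   \<Rightarrow> (('b, 'n) chart \<Rightarrow> 'a \<Rightarrow> real^'n) \<Rightarrow> (('a, 'm) chart \<Rightarrow> 'a \<Rightarrow> real^'m^'m) \<Rightarrow> bool" where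
  "shape_operator \<A> \<B> G f \<xi> A \<longleftrightarrow>
     (\<forall>x\<in>\<A>. \<forall>x'\<in>\<A>. \<forall>p\<in>chart_dom x \<inter> chart_dom x'.
        jacobian x x' p ** A x p = A x' p ** jacobian x x' p) \<and>
     (\<forall>x\<in>\<A>. \<forall>y\<in>\<B>. \<forall>p\<in>overlap f x y. \<forall>u.
        cov_along (metric_rep G y) (map_rep f x y) (field_rep \<xi> x y) (chart_map x p) u
        = - frechet_derivative (map_rep f x y) (at (chart_map x p)) (A x p *v u))"

text \<open>The next two notions do not depend on the chart used, by the transformation law of \<open>A\<close>.\<close>

definition mean_curvature ::
  "('a, 'm::finite) chart set \<Rightarrow> real \<Rightarrow> (('a, 'm) chart \<Rightarrow> 'a \<Rightarrow> real^'m^'m) \<Rightarrow> 'a \<Rightarrow> real" where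
  "mean_curvature \<A> \<epsilon> A p = (1 / real CARD('m)) * \<epsilon> * trace (A (chart_at \<A> p) p)"

definition principal_curvatures ::
  "('a, 'm::finite) chart set \<Rightarrow> (('a, 'm) chart \<Rightarrow> 'a \<Rightarrow> real^'m^'m) \<Rightarrow> 'a \<Rightarrow> complex set" where
  "principal_curvatures \<A> A p =
     {\<kappa>. \<exists>v::complex^'m. v \<noteq> 0 \<and> map_matrix complex_of_real (A (chart_at \<A> p) p) *v v = \<kappa> *s v}"

definition mean_curvature_vector ::
  "('a, 'm::finite) chart set \<Rightarrow> (('b, 'n::finite) chart \<Rightarrow> 'a \<Rightarrow> real^'n) \<Rightarrow> real
   \<Rightarrow> (('a, 'm) chart \<Rightarrow> 'a \<Rightarrow> real^'m^'m) \<Rightarrow> ('b, 'n) chart \<Rightarrow> 'a \<Rightarrow> real^'n" where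
  "mean_curvature_vector \<A> \<xi> \<epsilon> A y p = mean_curvature \<A> \<epsilon> A p *\<^sub>R \<xi> y p"

definition proper_mean_curvature_vector ::
  "('a, 'm::finite) chart set \<Rightarrow> ('b, 'n::finite) chart set
   \<Rightarrow> (('b, 'n) chart \<Rightarrow> 'b \<Rightarrow> real^'n^'n) \<Rightarrow> ('a \<Rightarrow> 'b)
   \<Rightarrow> (('b, 'n) chart \<Rightarrow> 'a \<Rightarrow> real^'n) \<Rightarrow> real
   \<Rightarrow> (('a, 'm) chart \<Rightarrow> 'a \<Rightarrow> real^'m^'m) \<Rightarrow> real \<Rightarrow> bool" where
  "proper_mean_curvature_vector \<A> \<B> G f \<xi> \<epsilon> A lam \<longleftrightarrow>
     (\<forall>x\<in>\<A>. \<forall>y\<in>\<B>. \<forall>p\<in>overlap f x y.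
        has_laplacian (metric_rep G y) (map_rep f x y)
          (field_rep (mean_curvature_vector \<A> \<xi> \<epsilon> A) x y) (chart_map x p)
          (lam *\<^sub>R mean_curvature_vector \<A> \<xi> \<epsilon> A y p))"

end

theory Submission
  imports Defs
begin

text \<open>
  The shape operator \<open>A\<close> has no real eigenvalue, its spectrum is \<open>{a + ib, a - ib}\<close> with
  \<open>b > 0\<close>, and both eigenvalues have algebraic multiplicity two. Hence
  \<open>tr A = 4a\<close>, \<open>tr A\<^sup>2 = 4(a\<^sup>2 - b\<^sup>2)\<close> and \<open>((A - a)\<^sup>2 + b\<^sup>2)\<^sup>2 = 0\<close>
  (lemma \<open>conjugate_eigenvalues_structure\<close>); \<open>A\<close> need not be diagonalizable over the complex
  numbers.

  The Codazzi equation turns the tangential part of \<open>\<Delta>(H\<xi>) = \<lambda>H\<xi>\<close> into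
  \<open>A(grad H) = -2\<epsilon>H grad H\<close> (lemma \<open>laplacian_normal_field\<close>). Since \<open>A\<close> has no real eigenvalue,
  \<open>grad H = 0\<close>, and \<open>H\<close> is locally constant. Where \<open>H \<noteq> 0\<close> the normal part then reads
  \<open>tr A\<^sup>2 = \<epsilon>\<lambda>\<close>, so that \<open>a = \<epsilon>H\<close> and \<open>b\<close> are both locally constant.

  The remaining relation \<open>a\<^sup>2 + b\<^sup>2 = -c\<epsilon>\<close> is a Cartan identity for constant principal
  curvatures. Put \<open>B = (A - a)/b\<close> and \<open>Q = B\<^sup>2 + 1\<close>, so that \<open>Q\<^sup>2 = 0\<close>. The polynomial
  \<open>J = (3B + B\<^sup>3)/2\<close> in \<open>B\<close> is a self-adjoint field with \<open>J\<^sup>2 = -1\<close>, the semisimple part of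
  \<open>B\<close>. The Codazzi equation makes \<open>\<tau>(x,y,z) = \<langle>(\<nabla>\<^sub>xB)y,z\<rangle>\<close> totally symmetric, and
  differentiating \<open>Q\<^sup>2 = 0\<close> gives further linear relations. If \<open>Q = 0\<close> on an open set, they force
  \<open>\<tau> = 0\<close>. Where \<open>Q \<noteq> 0\<close>, they show that \<open>J\<close> is parallel in the directions of the image of
  \<open>Q\<close> and that this two-dimensional distribution is involutive. In both cases there is a vector
  \<open>y \<noteq> 0\<close> with \<open>By = Jy\<close> for which the curvature operator \<open>R(y,Jy)\<close> commutes with \<open>J\<close>
  (lemma \<open>curvature_commutes_on_plane\<close>). By the Gauss equation
  \<open>R(y,Jy)w = (c + \<epsilon>(a\<^sup>2 + b\<^sup>2))(\<langle>Jy,w\<rangle>y - \<langle>y,w\<rangle>Jy)\<close>, and the map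
  \<open>w \<mapsto> \<langle>Jy,w\<rangle>y - \<langle>y,w\<rangle>Jy\<close> anticommutes with \<open>J\<close> and is not zero. So the factor vanishes
  (lemma \<open>principal_curvature_identities\<close>).

  From \<open>4(a\<^sup>2 - b\<^sup>2) = \<epsilon>\<lambda>\<close> and \<open>a\<^sup>2 + b\<^sup>2 = -c\<epsilon>\<close> one reads off
  \<open>H\<^sup>2 = a\<^sup>2 = (\<epsilon>\<lambda> - 4c\<epsilon>)/8\<close>, and \<open>a, b \<noteq> 0\<close> gives \<open>c\<epsilon> < 0\<close> and \<open>\<bar>\<epsilon>\<lambda>\<bar> < -4c\<epsilon>\<close>.

  The differential geometry is carried out in coordinates: a connection along a map is a directional
  derivative plus a Christoffel term, and the Koszul formula is what links the Christoffel symbols to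
  the metric.
\<close>

section \<open>Calculus of smooth maps\<close>

abbreviation ddir :: "('a::real_normed_vector \<Rightarrow> 'b::real_normed_vector) \<Rightarrow> 'a \<Rightarrow> 'a \<Rightarrow> 'b" where
  "ddir f z u \<equiv> frechet_derivative f (at z) u"

lemma ddir_eqI: "(f has_derivative f') (at z) \<Longrightarrow> ddir f z u = f' u"
  using frechet_derivative_at by metis

lemma ddir_cong:
  assumes "open S" "z \<in> S" "\<And>x. x \<in> S \<Longrightarrow> f x = g x"
  shows "ddir f z u = ddir g z u"
proof -
  have "(f has_derivative f') (at z) = (g has_derivative f') (at z)" for f'
    using assms by (metis has_derivative_transform_within_open)
  then show ?thesis unfolding frechet_derivative_def by presburger
qed

lemma differentiable_cong_open:
  assumes "open S" "z \<in> S" "\<And>x. x \<in> S \<Longrightarrow> f x = g x" "f differentiable (at z)"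
  shows "g differentiable (at z)"
  using assms by (metis differentiable_def has_derivative_transform_within_open)

lemma Ck_on_cong:
  assumes "open S" "\<And>x. x \<in> S \<Longrightarrow> f x = g x" "Ck_on k S f"
  shows "Ck_on k S g"
  using assms(2,3)
proof (induction k arbitrary: f g)
  case 0
  then show ?case by (simp cong: continuous_on_cong)
next
  case (Suc k)
  have "Ck_on k S (\<lambda>x. ddir g x v)" for v
  proof (rule Suc.IH)
    show "Ck_on k S (\<lambda>x. ddir f x v)" using Suc.prems by simp
    show "ddir f x v = ddir g x v" if "x \<in> S" for x
      using ddir_cong[OF assms(1) that] Suc.prems(1) by blast
  qed
  moreover have "g differentiable (at x)" if "x \<in> S" for x
    using differentiable_cong_open[OF assms(1) that Suc.prems(1)] Suc.prems(2) that by simp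
  ultimately show ?case by simp
qed

lemma Ck_on_subset: "Ck_on k S f \<Longrightarrow> T \<subseteq> S \<Longrightarrow> Ck_on k T f"
  by (induction k arbitrary: f) (auto intro: continuous_on_subset)

lemma Ck_on_SucD: "Ck_on (Suc k) S f \<Longrightarrow> Ck_on k S f"
proof (induction k arbitrary: f)
  case 0
  then have "f differentiable_on S"
    unfolding differentiable_on_def using differentiable_at_withinI[of f _ S] by simp
  then show ?case by (simp add: differentiable_imp_continuous_on)
next
  case (Suc k)
  then show ?case by (metis Ck_on.simps(2))
qed

lemma Ck_on_const: "Ck_on k S (\<lambda>x. a)"
  by (induction k arbitrary: a) auto

lemma Ck_on_linear: "bounded_linear f \<Longrightarrow> Ck_on k S f"
proof (cases k)
  case (Suc m)
  assume f: "bounded_linear f"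
  have "ddir f x v = f v" for x v
    using ddir_eqI bounded_linear_imp_has_derivative[OF f] by blast
  then show ?thesis using Suc f by (simp add: Ck_on_const bounded_linear_imp_differentiable)
qed (auto intro: linear_continuous_on)

lemma Ck_on_add:
  assumes "open S" "Ck_on k S f" "Ck_on k S g"
  shows "Ck_on k S (\<lambda>x. f x + g x)"
  using assms(2,3)
proof (induction k arbitrary: f g)
  case (Suc k)
  have d: "ddir (\<lambda>x. f x + g x) x v = ddir f x v + ddir g x v" if "x \<in> S" for x v
    using Suc.prems that
    by (intro ddir_eqI) (auto intro!: derivative_intros simp: frechet_derivative_works[symmetric])
  have "Ck_on k S (\<lambda>x. ddir f x v + ddir g x v)" for v
    using Suc by simp
  then have "Ck_on k S (\<lambda>x. ddir (\<lambda>x. f x + g x) x v)" for v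
    by (rule Ck_on_cong[OF assms(1), rotated]) (simp add: d)
  then show ?case using Suc.prems by simp
qed (auto intro: continuous_intros)

text \<open>The product rule expresses the derivative by products of one order less. Products of scalars,
  inner products and the products of matrices are all instances.\<close>
lemma Ck_on_bilinear:
  assumes "open S" "bounded_bilinear B" "Ck_on k S f" "Ck_on k S g"
  shows "Ck_on k S (\<lambda>x. B (f x) (g x))"
  using assms(3,4)
proof (induction k arbitrary: f g)
  case 0
  then show ?case using bounded_bilinear.continuous_on[OF assms(2)] by auto
next
  case (Suc k)
  have h: "((\<lambda>x. B (f x) (g x)) has_derivative (\<lambda>h. B (f x) (ddir g x h) + B (ddir f x h) (g x))) (at x)"
    if "x \<in> S" for x
    using Suc.prems that
    by (intro bounded_bilinear.FDERIV[OF assms(2)]) (auto simp: frechet_derivative_works[symmetric])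
  have "Ck_on k S (\<lambda>x. B (f x) (ddir g x v) + B (ddir f x v) (g x))" for v
    using Suc.prems by (intro Ck_on_add[OF assms(1)] Suc.IH Ck_on_SucD[of k S f] Ck_on_SucD[of k S g]) simp_all
  then have "Ck_on k S (\<lambda>x. ddir (\<lambda>x. B (f x) (g x)) x v)" for v
    by (rule Ck_on_cong[OF assms(1), rotated]) (simp add: ddir_eqI[OF h])
  then show ?case using h by (auto simp: differentiable_def)
qed

lemma Ck_on_sum:
  assumes "open S" "\<And>i. i \<in> I \<Longrightarrow> Ck_on k S (f i)"
  shows "Ck_on k S (\<lambda>x. \<Sum>i\<in>I. f i x)"
  using assms(2)
  by (induction I rule: infinite_finite_induct) (auto intro: Ck_on_const Ck_on_add[OF assms(1)])

text \<open>The chain rule; expanding the inner derivative in a basis turns the directional derivative of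
  \<open>f\<close> in a varying direction into a finite sum of products, to which the induction applies.\<close>
lemma Ck_on_compose:
  fixes g :: "'a::real_normed_vector \<Rightarrow> 'b::euclidean_space"
  assumes "open S" "g ` S \<subseteq> T" "Ck_on k T f" "Ck_on k S g"
  shows "Ck_on k S (\<lambda>x. f (g x))"
  using assms(3,4)
proof (induction k arbitrary: f)
  case 0
  then show ?case using assms(2) by (auto intro: continuous_on_compose2)
next
  case (Suc k)
  have fd: "f differentiable (at (g x))" if "x \<in> S" for x
    using Suc.prems(1) assms(2) that by auto
  have h: "((\<lambda>x. f (g x)) has_derivative (\<lambda>h. ddir f (g x) (ddir g x h))) (at x)" if "x \<in> S" for x
    using Suc.prems(2) fd[OF that] that
    by (intro has_derivative_compose[of g _ x UNIV f]) (auto simp: frechet_derivative_works[symmetric])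
  have e: "ddir (\<lambda>x. f (g x)) x v = (\<Sum>b\<in>Basis. (ddir g x v \<bullet> b) *\<^sub>R ddir f (g x) b)" if "x \<in> S" for x v
  proof -
    have "ddir f (g x) (ddir g x v) = ddir f (g x) (\<Sum>b\<in>Basis. (ddir g x v \<bullet> b) *\<^sub>R b)"
      by (simp add: euclidean_representation)
    also have "\<dots> = (\<Sum>b\<in>Basis. (ddir g x v \<bullet> b) *\<^sub>R ddir f (g x) b)"
      by (simp add: linear_sum[OF linear_frechet_derivative[OF fd[OF that]]]
          linear_scale[OF linear_frechet_derivative[OF fd[OF that]]])
    finally show ?thesis using ddir_eqI[OF h[OF that]] by simp
  qed
  have "Ck_on k S (\<lambda>x. \<Sum>b\<in>Basis. (ddir g x v \<bullet> b) *\<^sub>R ddir f (g x) b)" for v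
  proof (intro Ck_on_sum[OF assms(1)] Ck_on_bilinear[OF assms(1) bounded_bilinear_scaleR]
      Ck_on_bilinear[OF assms(1) bounded_bilinear_inner] Ck_on_const)
    show "Ck_on k S (\<lambda>x. ddir g x v)" using Suc.prems(2) by simp
    show "Ck_on k S (\<lambda>x. ddir f (g x) b)" for b
      using Suc.IH[of "\<lambda>y. ddir f y b"] Suc.prems Ck_on_SucD[OF Suc.prems(2)] by simp
  qed
  then have "Ck_on k S (\<lambda>x. ddir (\<lambda>x. f (g x)) x v)" for v
    by (rule Ck_on_cong[OF assms(1), rotated]) (simp add: e)
  then show ?case using h by (auto simp: differentiable_def)
qed

lemma Ck_on_inverse:
  fixes f :: "'a::real_normed_vector \<Rightarrow> real"
  assumes "open S" "\<And>x. x \<in> S \<Longrightarrow> f x \<noteq> 0" "Ck_on k S f"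
  shows "Ck_on k S (\<lambda>x. inverse (f x))"
  using assms(3)
proof (induction k)
  case 0
  then show ?case using assms(2) by (auto intro: continuous_on_inverse)
next
  case (Suc k)
  have h: "((\<lambda>x. inverse (f x)) has_derivative (\<lambda>v. - (inverse (f x) * ddir f x v * inverse (f x)))) (at x)"
    if "x \<in> S" for x
    using Suc.prems that assms(2)
    by (intro Deriv.has_derivative_inverse) (auto simp: frechet_derivative_works[symmetric])
  have "Ck_on k S (\<lambda>x. (-1) * (inverse (f x) * ddir f x v * inverse (f x)))" for v
    using Suc.prems
    by (intro Ck_on_bilinear[OF assms(1) bounded_bilinear_mult] Ck_on_const Suc.IH Ck_on_SucD[of k S f]) simp_all
  note C = this
  have "Ck_on k S (\<lambda>x. ddir (\<lambda>x. inverse (f x)) x v)" for v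
    by (rule Ck_on_cong[OF assms(1) _ C[of v]]) (simp add: ddir_eqI[OF h])
  then show ?case using h by (auto simp: differentiable_def)
qed

lemma smooth_on_cong:
  "open S \<Longrightarrow> (\<And>x. x \<in> S \<Longrightarrow> f x = g x) \<Longrightarrow> smooth_on S f \<Longrightarrow> smooth_on S g"
  unfolding smooth_on_def using Ck_on_cong by blast

lemma smooth_on_subset: "smooth_on S f \<Longrightarrow> T \<subseteq> S \<Longrightarrow> smooth_on T f"
  unfolding smooth_on_def using Ck_on_subset by blast

lemma smooth_on_differentiable: "smooth_on S f \<Longrightarrow> x \<in> S \<Longrightarrow> f differentiable (at x)"
  unfolding smooth_on_def by (metis Ck_on.simps(2))

lemma smooth_on_has_derivative: "smooth_on S f \<Longrightarrow> x \<in> S \<Longrightarrow> (f has_derivative ddir f x) (at x)"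
  using smooth_on_differentiable frechet_derivative_works by blast

lemma smooth_on_continuous: "smooth_on S f \<Longrightarrow> continuous_on S f"
  unfolding smooth_on_def by (metis Ck_on.simps(1))

lemma smooth_on_ddir: "smooth_on S f \<Longrightarrow> smooth_on S (\<lambda>x. ddir f x v)"
  unfolding smooth_on_def by (metis Ck_on.simps(2))

lemma smooth_on_const: "smooth_on S (\<lambda>x. a)"
  unfolding smooth_on_def by (simp add: Ck_on_const)

lemma smooth_on_linear: "bounded_linear f \<Longrightarrow> smooth_on S f"
  unfolding smooth_on_def by (simp add: Ck_on_linear)

lemma smooth_on_add: "open S \<Longrightarrow> smooth_on S f \<Longrightarrow> smooth_on S g \<Longrightarrow> smooth_on S (\<lambda>x. f x + g x)"
  unfolding smooth_on_def by (simp add: Ck_on_add)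

lemma smooth_on_bilinear:
  "bounded_bilinear B \<Longrightarrow> open S \<Longrightarrow> smooth_on S f \<Longrightarrow> smooth_on S g \<Longrightarrow> smooth_on S (\<lambda>x. B (f x) (g x))"
  unfolding smooth_on_def by (simp add: Ck_on_bilinear)

lemmas smooth_on_mult = smooth_on_bilinear[OF bounded_bilinear_mult]
lemmas smooth_on_scaleR = smooth_on_bilinear[OF bounded_bilinear_scaleR]
lemmas smooth_on_inner = smooth_on_bilinear[OF bounded_bilinear_inner]

lemma smooth_on_cmult: "open S \<Longrightarrow> smooth_on S f \<Longrightarrow> smooth_on S (\<lambda>x. r *\<^sub>R f x)"
  by (intro smooth_on_scaleR smooth_on_const)

lemma smooth_on_minus: "open S \<Longrightarrow> smooth_on S f \<Longrightarrow> smooth_on S (\<lambda>x. - f x)"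
  using smooth_on_cmult[of S f "-1"] by simp

lemma smooth_on_diff: "open S \<Longrightarrow> smooth_on S f \<Longrightarrow> smooth_on S g \<Longrightarrow> smooth_on S (\<lambda>x. f x - g x)"
  using smooth_on_add[OF _ _ smooth_on_minus, of S f g] by simp

lemma smooth_on_sum:
  "open S \<Longrightarrow> (\<And>i. i \<in> I \<Longrightarrow> smooth_on S (f i)) \<Longrightarrow> smooth_on S (\<lambda>x. \<Sum>i\<in>I. f i x)"
  unfolding smooth_on_def by (simp add: Ck_on_sum)

lemma smooth_on_prod:
  fixes f :: "'i \<Rightarrow> 'a::real_normed_vector \<Rightarrow> real"
  assumes "open S" "\<And>i. i \<in> I \<Longrightarrow> smooth_on S (f i)"
  shows "smooth_on S (\<lambda>x. \<Prod>i\<in>I. f i x)"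
  using assms(2)
  by (induction I rule: infinite_finite_induct) (auto intro: smooth_on_const smooth_on_mult[OF assms(1)])

lemma smooth_on_compose:
  fixes g :: "'a::real_normed_vector \<Rightarrow> 'b::euclidean_space"
  shows "open S \<Longrightarrow> g ` S \<subseteq> T \<Longrightarrow> smooth_on T f \<Longrightarrow> smooth_on S g \<Longrightarrow> smooth_on S (\<lambda>x. f (g x))"
  unfolding smooth_on_def using Ck_on_compose[of S g T _ f] by blast

lemma smooth_on_bounded_linear:
  fixes g :: "'a::real_normed_vector \<Rightarrow> 'b::euclidean_space"
  shows "bounded_linear L \<Longrightarrow> open S \<Longrightarrow> smooth_on S g \<Longrightarrow> smooth_on S (\<lambda>x. L (g x))"
  by (rule smooth_on_compose[of S g UNIV L]) (auto intro: smooth_on_linear)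

lemma smooth_on_inverse:
  fixes f :: "'a::real_normed_vector \<Rightarrow> real"
  shows "open S \<Longrightarrow> (\<And>x. x \<in> S \<Longrightarrow> f x \<noteq> 0) \<Longrightarrow> smooth_on S f \<Longrightarrow> smooth_on S (\<lambda>x. inverse (f x))"
  unfolding smooth_on_def by (simp add: Ck_on_inverse)

lemma smooth_on_nth:
  fixes f :: "'a::real_normed_vector \<Rightarrow> 'b::euclidean_space^'n"
  shows "open S \<Longrightarrow> smooth_on S f \<Longrightarrow> smooth_on S (\<lambda>x. f x $ i)"
  by (rule smooth_on_bounded_linear[OF bounded_linear_vec_nth])

lemma bounded_linear_vec_insert: "bounded_linear (\<lambda>x::'b::real_normed_vector. (\<chi> j. if j = i then x else 0)::'b^'n)"
proof (rule bounded_linear_intro[where K=1])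
  fix x :: 'b
  show "norm ((\<chi> j. if j = i then x else 0)::'b^'n) \<le> norm x * 1"
    unfolding norm_vec_def L2_set_def
    by (simp add: if_distrib[where f="\<lambda>x. x^2"] if_distrib[where f=norm] cong: if_cong)
qed (auto simp: vec_eq_iff)

lemma smooth_on_vec_lambda:
  fixes f :: "'n::finite \<Rightarrow> 'a::real_normed_vector \<Rightarrow> 'b::euclidean_space"
  assumes "open S" "\<And>i. smooth_on S (f i)"
  shows "smooth_on S (\<lambda>x. (\<chi> i. f i x)::'b^'n)"
proof -
  have "smooth_on S (\<lambda>x. \<Sum>i\<in>UNIV. (\<chi> j. if j = i then f i x else 0)::'b^'n)"
    by (intro smooth_on_sum assms smooth_on_bounded_linear[OF bounded_linear_vec_insert])
  moreover have "(\<Sum>i\<in>UNIV. (\<chi> j. if j = i then f i x else 0)::'b^'n) = (\<chi> i. f i x)" for x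
    by (simp add: vec_eq_iff)
  ultimately show ?thesis by simp
qed

lemma smooth_on_det:
  fixes M :: "'a::real_normed_vector \<Rightarrow> real^'n^'n"
  assumes "open S" "smooth_on S M"
  shows "smooth_on S (\<lambda>x. det (M x))"
  unfolding det_def
  by (intro smooth_on_sum smooth_on_mult smooth_on_prod smooth_on_const smooth_on_nth assms)

lemma bounded_bilinear_mv: "bounded_bilinear ((*v) :: real^'n^'m \<Rightarrow> real^'n \<Rightarrow> real^'m)"
  unfolding bilinear_conv_bounded_bilinear[symmetric] bilinear_def
  by (auto intro!: linearI simp: matrix_vector_mult_def vec_eq_iff algebra_simps sum.distrib sum_distrib_left)

lemma bounded_bilinear_mm: "bounded_bilinear ((**) :: real^'n^'m \<Rightarrow> real^'k^'n \<Rightarrow> real^'k^'m)"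
  unfolding bilinear_conv_bounded_bilinear[symmetric] bilinear_def
  by (auto intro!: linearI simp: matrix_matrix_mult_def vec_eq_iff algebra_simps sum.distrib sum_distrib_left)

lemmas smooth_on_mv = smooth_on_bilinear[OF bounded_bilinear_mv]
lemmas smooth_on_mm = smooth_on_bilinear[OF bounded_bilinear_mm]

lemma matrix_inv_mult:
  fixes M :: "real^'n^'n"
  assumes "invertible M"
  shows matrix_inv_right_mult: "M ** matrix_inv M = mat 1"
    and matrix_inv_left_mult: "matrix_inv M ** M = mat 1"
  using someI_ex[OF assms[unfolded invertible_def]] unfolding matrix_inv_def by auto

text \<open>By Cramer's rule the entries of the inverse matrix are rational functions of the entries of the
  matrix.\<close>
lemma smooth_on_matrix_inv:
  fixes M :: "'a::real_normed_vector \<Rightarrow> real^'n^'n"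
  assumes S: "open S" and M: "smooth_on S M" and inv: "\<And>x. x \<in> S \<Longrightarrow> invertible (M x)"
  shows "smooth_on S (\<lambda>x. matrix_inv (M x))"
proof -
  define C where "C x = (\<chi> k l. det (\<chi> i j. if j = k then axis l 1 $ i else M x $ i $ j) * inverse (det (M x)))"
    for x
  have d: "det (M x) \<noteq> 0" if "x \<in> S" for x using inv[OF that] invertible_det_nz by blast
  have "smooth_on S C"
    unfolding C_def
  proof (intro smooth_on_vec_lambda S smooth_on_mult smooth_on_inverse smooth_on_det M d)
    show "smooth_on S (\<lambda>x. if j = k then axis l 1 $ i else M x $ i $ j)" for i j k l
      by (cases "j = k") (auto intro!: smooth_on_const smooth_on_nth[OF S smooth_on_nth[OF S M]])
  qed
  moreover have "C x = matrix_inv (M x)" if "x \<in> S" for x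
  proof -
    have "matrix_inv (M x) $ k $ l = C x $ k $ l" for k l
    proof -
      have "M x *v (matrix_inv (M x) *v axis l 1) = axis l 1"
        by (simp add: matrix_vector_mul_assoc matrix_inv_right_mult[OF inv[OF that]])
      from cramer[OF d[OF that], THEN iffD1, OF this]
      have "(matrix_inv (M x) *v axis l 1) $ k = C x $ k $ l"
        unfolding C_def by (simp only: vec_lambda_beta divide_inverse)
      then show ?thesis by (simp add: matrix_vector_mul_component inner_axis)
    qed
    then show ?thesis by (simp add: vec_eq_iff)
  qed
  ultimately show ?thesis using smooth_on_cong[OF S, of C "\<lambda>x. matrix_inv (M x)"] by simp
qed

lemma ddir_bounded_linear:
  assumes "bounded_linear L" "f differentiable (at z)"
  shows "ddir (\<lambda>x. L (f x)) z u = L (ddir f z u)"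
  by (intro ddir_eqI bounded_linear.has_derivative[OF assms(1)])
    (use assms(2) in \<open>simp add: frechet_derivative_works[symmetric]\<close>)

lemma ddir_bilinear:
  assumes "bounded_bilinear B" "f differentiable (at z)" "g differentiable (at z)"
  shows "ddir (\<lambda>x. B (f x) (g x)) z u = B (f z) (ddir g z u) + B (ddir f z u) (g z)"
  by (rule ddir_eqI[OF bounded_bilinear.FDERIV[OF assms(1)]])
    (use assms in \<open>simp_all add: frechet_derivative_works[symmetric]\<close>)

lemma ddir_linear: "f differentiable (at z) \<Longrightarrow> linear (ddir f z)"
  by (rule linear_frechet_derivative)

text \<open>Differentiation of a field of linear maps evaluated on a vector field. Second derivatives,
  Christoffel terms and covariant derivatives along variable directions all have this shape.\<close>
lemma has_derivative_linear_apply: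
  fixes S :: "'a::real_normed_vector \<Rightarrow> 'b::euclidean_space \<Rightarrow> 'c::real_normed_vector"
  assumes U: "open U" "z \<in> U" and lin: "\<And>x. x \<in> U \<Longrightarrow> linear (S x)"
    and S: "\<And>b. (\<lambda>x. S x b) differentiable (at z)" and q: "(q has_derivative q') (at z)"
  shows "((\<lambda>x. S x (q x)) has_derivative (\<lambda>u. ddir (\<lambda>x. S x (q z)) z u + S z (q' u))) (at z)"
proof -
  have rep: "S x w = (\<Sum>b\<in>Basis. (w \<bullet> b) *\<^sub>R S x b)" if "x \<in> U" for x w
  proof -
    have "S x w = S x (\<Sum>b\<in>Basis. (w \<bullet> b) *\<^sub>R b)" by (simp add: euclidean_representation)
    then show ?thesis by (simp add: linear_sum[OF lin[OF that]] linear_scale[OF lin[OF that]])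
  qed
  have Sb: "((\<lambda>x. S x b) has_derivative ddir (\<lambda>x. S x b) z) (at z)" for b
    using S frechet_derivative_works by blast
  have 1: "((\<lambda>x. \<Sum>b\<in>Basis. (q z \<bullet> b) *\<^sub>R S x b) has_derivative
      (\<lambda>u. \<Sum>b\<in>Basis. (q z \<bullet> b) *\<^sub>R ddir (\<lambda>x. S x b) z u)) (at z)"
    by (intro has_derivative_sum has_derivative_scaleR_right Sb)
  have "((\<lambda>x. S x (q z)) has_derivative (\<lambda>u. \<Sum>b\<in>Basis. (q z \<bullet> b) *\<^sub>R ddir (\<lambda>x. S x b) z u)) (at z)"
    by (rule has_derivative_transform_within_open[OF 1 U]) (simp add: rep)
  then have 2: "ddir (\<lambda>x. S x (q z)) z u = (\<Sum>b\<in>Basis. (q z \<bullet> b) *\<^sub>R ddir (\<lambda>x. S x b) z u)" for u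
    by (rule ddir_eqI)
  have "((\<lambda>x. (q x \<bullet> b) *\<^sub>R S x b) has_derivative
      (\<lambda>u. (q z \<bullet> b) *\<^sub>R ddir (\<lambda>x. S x b) z u + (q' u \<bullet> b) *\<^sub>R S z b)) (at z)" for b
    by (intro has_derivative_scaleR Sb has_derivative_inner_left q)
  then have 3: "((\<lambda>x. \<Sum>b\<in>Basis. (q x \<bullet> b) *\<^sub>R S x b) has_derivative
      (\<lambda>u. \<Sum>b\<in>Basis. (q z \<bullet> b) *\<^sub>R ddir (\<lambda>x. S x b) z u + (q' u \<bullet> b) *\<^sub>R S z b)) (at z)"
    by (intro has_derivative_sum)
  have "((\<lambda>x. S x (q x)) has_derivative
      (\<lambda>u. \<Sum>b\<in>Basis. (q z \<bullet> b) *\<^sub>R ddir (\<lambda>x. S x b) z u + (q' u \<bullet> b) *\<^sub>R S z b)) (at z)"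
    by (rule has_derivative_transform_within_open[OF 3 U]) (simp add: rep[symmetric])
  moreover have "(\<Sum>b\<in>Basis. (q z \<bullet> b) *\<^sub>R ddir (\<lambda>x. S x b) z u + (q' u \<bullet> b) *\<^sub>R S z b)
      = ddir (\<lambda>x. S x (q z)) z u + S z (q' u)" for u
    unfolding sum.distrib 2 rep[OF U(2), of "q' u"] by (rule refl)
  ultimately show ?thesis by simp
qed

lemma ddir_linear_apply:
  fixes S :: "'a::real_normed_vector \<Rightarrow> 'b::euclidean_space \<Rightarrow> 'c::real_normed_vector"
  assumes "open U" "z \<in> U" "\<And>x. x \<in> U \<Longrightarrow> linear (S x)"
    and "\<And>b. (\<lambda>x. S x b) differentiable (at z)" "q differentiable (at z)"
  shows "ddir (\<lambda>x. S x (q x)) z u = ddir (\<lambda>x. S x (q z)) z u + S z (ddir q z u)"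
    and "(\<lambda>x. S x (q x)) differentiable (at z)"
proof -
  have "(q has_derivative ddir q z) (at z)" using assms(5) frechet_derivative_works by blast
  note h = has_derivative_linear_apply[OF assms(1-4) this]
  show "ddir (\<lambda>x. S x (q x)) z u = ddir (\<lambda>x. S x (q z)) z u + S z (ddir q z u)"
    using ddir_eqI[OF h] .
  show "(\<lambda>x. S x (q x)) differentiable (at z)" using h differentiable_def by blast
qed

lemma has_derivative_along_line:
  fixes f :: "'a::real_normed_vector \<Rightarrow> real"
  assumes "f differentiable (at (p + s *\<^sub>R u))"
  shows "((\<lambda>s. f (p + s *\<^sub>R u)) has_real_derivative ddir f (p + s *\<^sub>R u) u) (at s)"
proof -
  have "((\<lambda>s. f (p + s *\<^sub>R u)) has_derivative (\<lambda>h. ddir f (p + s *\<^sub>R u) (h *\<^sub>R u))) (at s)"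
    by (rule has_derivative_compose[of "\<lambda>s. p + s *\<^sub>R u" _ s UNIV f])
      (use assms in \<open>auto intro!: derivative_eq_intros simp: frechet_derivative_works[symmetric]\<close>)
  then show ?thesis
    unfolding has_field_derivative_def
    by (rule has_derivative_eq_rhs)
      (simp add: fun_eq_iff linear_scale[OF ddir_linear[OF assms]] mult.commute)
qed

text \<open>By the mean value theorem applied twice, a second difference quotient is a value of the
  mixed second derivative at a nearby point.\<close>
lemma second_difference_mean_value:
  fixes f :: "'a::real_normed_vector \<Rightarrow> real"
  assumes f: "smooth_on S f" and h: "0 < h"
    and sub: "\<And>s t. 0 \<le> s \<Longrightarrow> s \<le> h \<Longrightarrow> 0 \<le> t \<Longrightarrow> t \<le> h \<Longrightarrow> x + s *\<^sub>R u + t *\<^sub>R v \<in> S"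
  shows "\<exists>s t. 0 < s \<and> s < h \<and> 0 < t \<and> t < h \<and>
    f (x + h *\<^sub>R u + h *\<^sub>R v) - f (x + h *\<^sub>R u) - f (x + h *\<^sub>R v) + f x
     = h\<^sup>2 * ddir (\<lambda>y. ddir f y u) (x + s *\<^sub>R u + t *\<^sub>R v) v"
proof -
  have der: "((\<lambda>s. f (x + s *\<^sub>R u + t *\<^sub>R v)) has_real_derivative ddir f (x + s *\<^sub>R u + t *\<^sub>R v) u) (at s)"
    if "0 \<le> s" "s \<le> h" "0 \<le> t" "t \<le> h" for s t
  proof -
    have "f differentiable (at ((x + t *\<^sub>R v) + s *\<^sub>R u))"
      using smooth_on_differentiable[OF f] sub[OF that] by (simp add: add_ac)
    from has_derivative_along_line[OF this] show ?thesis by (simp add: add_ac)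
  qed
  define \<phi> where "\<phi> s = f (x + s *\<^sub>R u + h *\<^sub>R v) - f (x + s *\<^sub>R u)" for s
  have d\<phi>: "(\<phi> has_real_derivative (ddir f (x + s *\<^sub>R u + h *\<^sub>R v) u - ddir f (x + s *\<^sub>R u) u)) (at s)"
    if "0 \<le> s" "s \<le> h" for s
    unfolding \<phi>_def using der[OF that, of h] der[OF that, of 0] h
    by (auto intro!: derivative_eq_intros)
  obtain s where s: "0 < s" "s < h"
    "\<phi> h - \<phi> 0 = (h - 0) * (ddir f (x + s *\<^sub>R u + h *\<^sub>R v) u - ddir f (x + s *\<^sub>R u) u)"
    using MVT2[OF h, of \<phi> "\<lambda>s. ddir f (x + s *\<^sub>R u + h *\<^sub>R v) u - ddir f (x + s *\<^sub>R u) u", OF d\<phi>] by metis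
  have d2: "((\<lambda>t. ddir f (x + s *\<^sub>R u + t *\<^sub>R v) u) has_real_derivative
      ddir (\<lambda>y. ddir f y u) (x + s *\<^sub>R u + t *\<^sub>R v) v) (at t)" if "0 \<le> t" "t \<le> h" for t
  proof -
    have "(\<lambda>y. ddir f y u) differentiable (at (x + s *\<^sub>R u + t *\<^sub>R v))"
      using smooth_on_differentiable[OF smooth_on_ddir[OF f]] sub[of s t] s that by simp
    from has_derivative_along_line[OF this] show ?thesis .
  qed
  obtain t where t: "0 < t" "t < h" "ddir f (x + s *\<^sub>R u + h *\<^sub>R v) u - ddir f (x + s *\<^sub>R u + 0 *\<^sub>R v) u
      = (h - 0) * ddir (\<lambda>y. ddir f y u) (x + s *\<^sub>R u + t *\<^sub>R v) v"
    using MVT2[OF h, of "\<lambda>t. ddir f (x + s *\<^sub>R u + t *\<^sub>R v) u"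
        "\<lambda>t. ddir (\<lambda>y. ddir f y u) (x + s *\<^sub>R u + t *\<^sub>R v) v", OF d2] by metis
  have "\<phi> h - \<phi> 0 = h\<^sup>2 * ddir (\<lambda>y. ddir f y u) (x + s *\<^sub>R u + t *\<^sub>R v) v"
    using s(3) t(3) by (simp add: power2_eq_square)
  then show ?thesis
    using s(1,2) t(1,2) by (rule_tac x=s in exI, rule_tac x=t in exI) (simp add: \<phi>_def)
qed

text \<open>The second difference in \<open>u\<close> and \<open>v\<close> is symmetric, so the two mixed derivatives agree at
  points arbitrarily close to \<open>x\<close>, and continuity carries this over to \<open>x\<close>.\<close>
lemma ddir_commute_real:
  fixes f :: "'a::real_normed_vector \<Rightarrow> real"
  assumes S: "open S" "x \<in> S" and f: "smooth_on S f"
  shows "ddir (\<lambda>y. ddir f y u) x v = ddir (\<lambda>y. ddir f y v) x u"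
proof -
  define F where "F y = ddir (\<lambda>y. ddir f y u) y v" for y
  define G where "G y = ddir (\<lambda>y. ddir f y v) y u" for y
  have cont: "isCont F x" "isCont G x"
    unfolding F_def G_def
    using smooth_on_continuous[OF smooth_on_ddir[OF smooth_on_ddir[OF f]]] S
    by (auto simp: continuous_on_eq_continuous_at)
  have "F x = G x"
  proof (rule ccontr)
    assume ne: "F x \<noteq> G x"
    define e where "e = dist (F x) (G x) / 2"
    have "e > 0" using ne by (simp add: e_def)
    obtain d1 where d1: "d1 > 0" "\<And>y. dist y x < d1 \<Longrightarrow> dist (F y) (F x) < e"
      using cont(1) \<open>e > 0\<close> unfolding continuous_at_eps_delta by blast
    obtain d2 where d2: "d2 > 0" "\<And>y. dist y x < d2 \<Longrightarrow> dist (G y) (G x) < e"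
      using cont(2) \<open>e > 0\<close> unfolding continuous_at_eps_delta by blast
    obtain d3 where d3: "d3 > 0" "ball x d3 \<subseteq> S" using S openE by blast
    define d where "d = min d1 (min d2 d3)"
    have "d > 0" using d1 d2 d3 by (simp add: d_def)
    define h where "h = d / (2 * (norm u + norm v + 1))"
    have h: "h > 0" using \<open>d > 0\<close> by (simp add: h_def add_nonneg_pos)
    have near: "dist (x + s *\<^sub>R u + t *\<^sub>R v) x < d" if "0 \<le> s" "s \<le> h" "0 \<le> t" "t \<le> h" for s t
    proof -
      have "dist (x + s *\<^sub>R u + t *\<^sub>R v) x = norm (s *\<^sub>R u + t *\<^sub>R v)" by (simp add: dist_norm)
      also have "\<dots> \<le> s * norm u + t * norm v" using that norm_triangle_ineq[of "s *\<^sub>R u" "t *\<^sub>R v"] by simp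
      also have "\<dots> \<le> h * norm u + h * norm v"
        using that by (intro add_mono mult_right_mono) auto
      also have "\<dots> < h * (2 * (norm u + norm v + 1))"
        using h norm_ge_zero[of u] norm_ge_zero[of v] by (simp add: algebra_simps add_pos_nonneg add_nonneg_pos)
      also have "\<dots> = d"
      proof -
        have "2 * (norm u + norm v + 1) > 0" by (simp add: add_nonneg_pos)
        then show ?thesis by (simp add: h_def)
      qed
      finally show ?thesis .
    qed
    have sub: "x + s *\<^sub>R u + t *\<^sub>R v \<in> S" "x + t *\<^sub>R v + s *\<^sub>R u \<in> S"
      if "0 \<le> s" "s \<le> h" "0 \<le> t" "t \<le> h" for s t
      using near[OF that] d3 by (auto simp: d_def dist_commute subset_iff add_ac)
    obtain s t where st: "0 < s" "s < h" "0 < t" "t < h"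
      "f (x + h *\<^sub>R u + h *\<^sub>R v) - f (x + h *\<^sub>R u) - f (x + h *\<^sub>R v) + f x = h\<^sup>2 * F (x + s *\<^sub>R u + t *\<^sub>R v)"
      unfolding F_def using second_difference_mean_value[OF f h sub(1)] by blast
    obtain s' t' where st': "0 < s'" "s' < h" "0 < t'" "t' < h"
      "f (x + h *\<^sub>R v + h *\<^sub>R u) - f (x + h *\<^sub>R v) - f (x + h *\<^sub>R u) + f x = h\<^sup>2 * G (x + s' *\<^sub>R v + t' *\<^sub>R u)"
      unfolding G_def using second_difference_mean_value[OF f h sub(2)] by blast
    have sw: "x + h *\<^sub>R v + h *\<^sub>R u = x + h *\<^sub>R u + h *\<^sub>R v" "x + s' *\<^sub>R v + t' *\<^sub>R u = x + t' *\<^sub>R u + s' *\<^sub>R v"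
      by (simp_all add: add_ac)
    have "h\<^sup>2 * F (x + s *\<^sub>R u + t *\<^sub>R v) = h\<^sup>2 * G (x + t' *\<^sub>R u + s' *\<^sub>R v)"
      using st(5) st'(5) unfolding sw by linarith
    then have eq: "F (x + s *\<^sub>R u + t *\<^sub>R v) = G (x + t' *\<^sub>R u + s' *\<^sub>R v)" using h by simp
    have "dist (F (x + s *\<^sub>R u + t *\<^sub>R v)) (F x) < e"
      using near[of s t] st by (intro d1) (simp add: d_def)
    moreover have "dist (G (x + t' *\<^sub>R u + s' *\<^sub>R v)) (G x) < e"
      using near[of t' s'] st' by (intro d2) (simp add: d_def)
    ultimately have "dist (F x) (G x) < 2 * e"
      unfolding eq using dist_triangle_half_l[of "F x" "G (x + t' *\<^sub>R u + s' *\<^sub>R v)" "2 * e" "G x"]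
      by (simp add: dist_commute eq)
    then show False by (simp add: e_def)
  qed
  then show ?thesis by (simp add: F_def G_def)
qed

lemma ddir_commute:
  fixes f :: "'a::real_normed_vector \<Rightarrow> 'b::euclidean_space"
  assumes S: "open S" "x \<in> S" and f: "smooth_on S f"
  shows "ddir (\<lambda>y. ddir f y u) x v = ddir (\<lambda>y. ddir f y v) x u"
proof (rule euclidean_eqI)
  fix b :: 'b
  have bl: "bounded_linear (\<lambda>w::'b. w \<bullet> b)" by (rule bounded_linear_inner_left)
  have *: "ddir (\<lambda>y. ddir f y u) x v \<bullet> b = ddir (\<lambda>y. ddir (\<lambda>y. f y \<bullet> b) y u) x v" for u v
  proof -
    have "ddir (\<lambda>y. ddir f y u) x v \<bullet> b = ddir (\<lambda>y. ddir f y u \<bullet> b) x v"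
      using ddir_bounded_linear[OF bl smooth_on_differentiable[OF smooth_on_ddir[OF f] S(2)]] by simp
    also have "\<dots> = ddir (\<lambda>y. ddir (\<lambda>y. f y \<bullet> b) y u) x v"
      by (rule ddir_cong[OF S]) (simp add: ddir_bounded_linear[OF bl smooth_on_differentiable[OF f]])
    finally show ?thesis .
  qed
  have "smooth_on S (\<lambda>y. f y \<bullet> b)" by (rule smooth_on_bounded_linear[OF bl S(1) f])
  from ddir_commute_real[OF S this]
  show "ddir (\<lambda>y. ddir f y u) x v \<bullet> b = ddir (\<lambda>y. ddir f y v) x u \<bullet> b" by (simp only: *)
qed

section \<open>The Levi-Civita connection along a map\<close>

lemma form_add_left: "form B (u + v) w = form B u w + form B v w"
  and form_add_right: "form B u (v + w) = form B u v + form B u w"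
  and form_scale_left: "form B (r *\<^sub>R u) w = r * form B u w"
  and form_scale_right: "form B u (r *\<^sub>R w) = r * form B u w"
  and form_minus_left: "form B (- u) w = - form B u w"
  and form_minus_right: "form B u (- w) = - form B u w"
  and form_diff_left: "form B (u - v) w = form B u w - form B v w"
  and form_diff_right: "form B u (v - w) = form B u v - form B u w"
  and form_zero_left: "form B 0 w = 0"
  and form_zero_right: "form B u 0 = 0"
  by (simp_all add: form_def inner_add_left inner_add_right matrix_vector_right_distrib
      matrix_vector_mult_scaleR matrix_vector_mult_diff_distrib inner_diff_left inner_diff_right
      linear_neg[OF matrix_vector_mul_linear])

lemmas form_simps = form_add_left form_add_right form_scale_left form_scale_right
  form_minus_left form_minus_right form_diff_left form_diff_right form_zero_left form_zero_right

lemma form_sym: "transpose B = B \<Longrightarrow> form B u v = form B v u"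
  unfolding form_def by (metis dot_lmul_matrix inner_commute transpose_matrix_vector)

lemma form_nondegenerate:
  assumes "invertible B" "transpose B = B" "\<And>w. form B u w = form B v w"
  shows "u = v"
proof -
  have "w \<bullet> (B *v (u - v)) = 0" for w
    using assms(3)[of w] form_sym[OF assms(2)]
    by (simp add: form_def[symmetric] form_diff_right)
  then have "B *v (u - v) = 0" by (metis inner_eq_zero_iff)
  then have "u - v = 0"
    using inj_matrix_vector_mult[OF assms(1)] by (metis injD matrix_vector_mult_0_right)
  then show ?thesis by simp
qed

lemma form_component: "form B u v = (\<Sum>i\<in>UNIV. \<Sum>j\<in>UNIV. B $ i $ j * u $ i * v $ j)"
  by (simp add: form_def inner_vec_def matrix_vector_mult_def sum_distrib_left mult_ac)

lemma smooth_on_form: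
  fixes B :: "'a::real_normed_vector \<Rightarrow> real^'n^'n"
  shows "open S \<Longrightarrow> smooth_on S B \<Longrightarrow> smooth_on S V \<Longrightarrow> smooth_on S W \<Longrightarrow> smooth_on S (\<lambda>x. form (B x) (V x) (W x))"
  unfolding form_def by (intro smooth_on_inner smooth_on_mv)

lemma ddir_form:
  fixes B :: "'a::real_normed_vector \<Rightarrow> real^'n^'n"
  assumes "B differentiable (at z)" "V differentiable (at z)" "W differentiable (at z)"
  shows "ddir (\<lambda>x. form (B x) (V x) (W x)) z u
     = form (ddir B z u) (V z) (W z) + form (B z) (ddir V z u) (W z) + form (B z) (V z) (ddir W z u)"
proof -
  have m: "(\<lambda>x. B x *v W x) differentiable (at z)"
    using assms(1,3) bounded_bilinear.FDERIV[OF bounded_bilinear_mv] unfolding differentiable_def by blast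
  show ?thesis
    unfolding form_def ddir_bilinear[OF bounded_bilinear_inner assms(2) m]
      ddir_bilinear[OF bounded_bilinear_mv assms(1,3)]
    by (simp add: inner_add_right)
qed

locale metric_patch =
  fixes S :: "(real^'n) set" and g :: "real^'n \<Rightarrow> real^'n^'n"
  assumes open_S: "open S" and smooth_g: "smooth_on S g"
    and g_sym: "z \<in> S \<Longrightarrow> transpose (g z) = g z"
    and g_inv: "z \<in> S \<Longrightarrow> invertible (g z)"
begin

abbreviation "\<Gamma> \<equiv> christoffel_vec g"

lemma form_g_sym: "z \<in> S \<Longrightarrow> form (g z) u v = form (g z) v u"
  by (rule form_sym[OF g_sym])

lemma g_nondegenerate: "z \<in> S \<Longrightarrow> (\<And>w. form (g z) u w = form (g z) v w) \<Longrightarrow> u = v"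
  by (rule form_nondegenerate[OF g_inv g_sym])

lemma ddir_g_const: "z \<in> S \<Longrightarrow> ddir (\<lambda>x. form (g x) v w) z u = form (ddir g z u) v w"
  using ddir_form[OF smooth_on_differentiable[OF smooth_g], of z "\<lambda>_. v" "\<lambda>_. w" u]
  by (simp add: form_simps)

lemma ddir_g_sym: "z \<in> S \<Longrightarrow> form (ddir g z u) v w = form (ddir g z u) w v"
  unfolding ddir_g_const[symmetric]
  by (rule ddir_cong[OF open_S]) (auto intro: form_g_sym)

lemma linear_ddir_g: "z \<in> S \<Longrightarrow> linear (ddir g z)"
  by (intro ddir_linear smooth_on_differentiable[OF smooth_g])

lemma pdiff_g: "z \<in> S \<Longrightarrow> pdiff i (\<lambda>y. g y $ j $ l) z = ddir g z (axis i 1) $ j $ l"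
  unfolding pdiff_def
  by (rule ddir_bounded_linear[OF _ smooth_on_differentiable[OF smooth_g], where L="\<lambda>M. M $ j $ l"])
    (auto intro: bounded_linear_compose[OF bounded_linear_vec_nth bounded_linear_vec_nth])

lemma ddir_g_component:
  assumes "z \<in> S"
  shows "form (ddir g z u) v w
    = (\<Sum>i\<in>UNIV. \<Sum>j\<in>UNIV. \<Sum>l\<in>UNIV. ddir g z (axis i 1) $ j $ l * u $ i * v $ j * w $ l)"
proof -
  have "ddir g z u = ddir g z (\<Sum>i\<in>UNIV. u $ i *\<^sub>R axis i 1)"
    by (simp add: basis_expansion[of u, unfolded scalar_mult_eq_scaleR])
  also have "\<dots> = (\<Sum>i\<in>UNIV. u $ i *\<^sub>R ddir g z (axis i 1))"
    by (simp add: linear_sum[OF linear_ddir_g[OF assms]] linear_scale[OF linear_ddir_g[OF assms]])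
  finally have u: "ddir g z u = (\<Sum>i\<in>UNIV. u $ i *\<^sub>R ddir g z (axis i 1))" .
  have "form (ddir g z u) v w
    = (\<Sum>j\<in>UNIV. \<Sum>l\<in>UNIV. \<Sum>i\<in>UNIV. ddir g z (axis i 1) $ j $ l * u $ i * v $ j * w $ l)"
    unfolding form_component u by (simp add: sum_distrib_right sum_distrib_left mult_ac)
  also have "\<dots> = (\<Sum>j\<in>UNIV. \<Sum>i\<in>UNIV. \<Sum>l\<in>UNIV. ddir g z (axis i 1) $ j $ l * u $ i * v $ j * w $ l)"
    by (intro sum.cong refl sum.swap)
  also have "\<dots> = (\<Sum>i\<in>UNIV. \<Sum>j\<in>UNIV. \<Sum>l\<in>UNIV. ddir g z (axis i 1) $ j $ l * u $ i * v $ j * w $ l)"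
    by (rule sum.swap)
  finally show ?thesis .
qed

text \<open>By nondegeneracy the Koszul formula characterises the Christoffel symbols. Their symmetry, their
  linearity and the compatibility with the metric all follow from it.\<close>
lemma koszul:
  assumes z: "z \<in> S"
  shows "form (g z) (\<Gamma> z u v) w
    = (form (ddir g z u) v w + form (ddir g z v) u w - form (ddir g z w) u v) / 2"
proof -
  define r where "r i j l = ddir g z (axis i 1) $ j $ l" for i j l
  define K where "K = (\<chi> l. \<Sum>i\<in>UNIV. \<Sum>j\<in>UNIV. (r i j l + r j i l - r l i j) / 2 * u $ i * v $ j)"
  have "\<Gamma> z u v = matrix_inv (g z) *v K"
  proof (rule vec_eq_iff[THEN iffD2], rule allI)
    fix k
    have "\<Gamma> z u v $ k = (\<Sum>i\<in>UNIV. \<Sum>j\<in>UNIV. \<Sum>l\<in>UNIV.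
        matrix_inv (g z) $ k $ l * ((r i j l + r j i l - r l i j) / 2 * u $ i * v $ j))"
      by (simp add: christoffel_vec_def christoffel_def pdiff_g[OF z] r_def sum_distrib_left
          sum_distrib_right mult_ac)
    also have "\<dots> = (\<Sum>i\<in>UNIV. \<Sum>l\<in>UNIV. \<Sum>j\<in>UNIV.
        matrix_inv (g z) $ k $ l * ((r i j l + r j i l - r l i j) / 2 * u $ i * v $ j))"
      by (intro sum.cong refl sum.swap)
    also have "\<dots> = (\<Sum>l\<in>UNIV. \<Sum>i\<in>UNIV. \<Sum>j\<in>UNIV.
        matrix_inv (g z) $ k $ l * ((r i j l + r j i l - r l i j) / 2 * u $ i * v $ j))"
      by (rule sum.swap)
    also have "\<dots> = (matrix_inv (g z) *v K) $ k"
      by (simp add: K_def matrix_vector_mult_def sum_distrib_left)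
    finally show "\<Gamma> z u v $ k = (matrix_inv (g z) *v K) $ k" .
  qed
  then have "form (g z) w (\<Gamma> z u v) = w \<bullet> K"
    by (simp add: form_def matrix_vector_mul_assoc matrix_inv_right_mult[OF g_inv[OF z]])
  then have 1: "form (g z) (\<Gamma> z u v) w = w \<bullet> K" using form_g_sym[OF z] by simp
  have "w \<bullet> K = (\<Sum>l\<in>UNIV. \<Sum>i\<in>UNIV. \<Sum>j\<in>UNIV. (r i j l * u $ i * v $ j * w $ l
      + r j i l * v $ j * u $ i * w $ l - r l i j * w $ l * u $ i * v $ j) / 2)"
    by (simp add: K_def inner_vec_def sum_distrib_left algebra_simps add_divide_distrib diff_divide_distrib)
  also have "\<dots> = ((\<Sum>l\<in>UNIV. \<Sum>i\<in>UNIV. \<Sum>j\<in>UNIV. r i j l * u $ i * v $ j * w $ l)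
      + (\<Sum>l\<in>UNIV. \<Sum>i\<in>UNIV. \<Sum>j\<in>UNIV. r j i l * v $ j * u $ i * w $ l)
      - (\<Sum>l\<in>UNIV. \<Sum>i\<in>UNIV. \<Sum>j\<in>UNIV. r l i j * w $ l * u $ i * v $ j)) / 2"
    by (simp add: sum.distrib sum_subtractf sum_divide_distrib[symmetric] add_divide_distrib diff_divide_distrib)
  also have "(\<Sum>l\<in>UNIV. \<Sum>i\<in>UNIV. \<Sum>j\<in>UNIV. r i j l * u $ i * v $ j * w $ l) = form (ddir g z u) v w"
    unfolding ddir_g_component[OF z] r_def
    by (subst sum.swap, intro sum.cong refl sum.swap)
  also have "(\<Sum>l\<in>UNIV. \<Sum>i\<in>UNIV. \<Sum>j\<in>UNIV. r j i l * v $ j * u $ i * w $ l) = form (ddir g z v) u w"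
  proof -
    have "(\<Sum>l\<in>UNIV. \<Sum>i\<in>UNIV. \<Sum>j\<in>UNIV. r j i l * v $ j * u $ i * w $ l)
      = (\<Sum>l\<in>UNIV. \<Sum>j\<in>UNIV. \<Sum>i\<in>UNIV. r j i l * v $ j * u $ i * w $ l)"
      by (intro sum.cong refl sum.swap)
    also have "\<dots> = (\<Sum>j\<in>UNIV. \<Sum>l\<in>UNIV. \<Sum>i\<in>UNIV. r j i l * v $ j * u $ i * w $ l)"
      by (rule sum.swap)
    also have "\<dots> = (\<Sum>j\<in>UNIV. \<Sum>i\<in>UNIV. \<Sum>l\<in>UNIV. r j i l * v $ j * u $ i * w $ l)"
      by (intro sum.cong refl sum.swap)
    finally show ?thesis unfolding ddir_g_component[OF z] r_def .
  qed
  also have "(\<Sum>l\<in>UNIV. \<Sum>i\<in>UNIV. \<Sum>j\<in>UNIV. r l i j * w $ l * u $ i * v $ j) = form (ddir g z w) u v"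
    unfolding ddir_g_component[OF z] r_def ..
  finally show ?thesis using 1 by simp
qed

lemma \<Gamma>_sym: "z \<in> S \<Longrightarrow> \<Gamma> z u v = \<Gamma> z v u"
  by (rule g_nondegenerate[of z]) (simp_all add: koszul ddir_g_sym[of z _ v u])

lemma form_matrix_add: "form (A + B) u v = form A u v + form B u v"
  and form_matrix_scale: "form (r *\<^sub>R A) u v = r * form A u v"
  by (simp_all add: form_component sum.distrib algebra_simps sum_distrib_left)

lemma linear_\<Gamma>_right: "z \<in> S \<Longrightarrow> linear (\<Gamma> z u)"
proof (rule linearI)
  fix v w r assume z: "z \<in> S"
  note l = linear_add[OF linear_ddir_g[OF z]] linear_scale[OF linear_ddir_g[OF z]]
  show "\<Gamma> z u (v + w) = \<Gamma> z u v + \<Gamma> z u w"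
    by (rule g_nondegenerate[OF z]) (simp add: koszul[OF z] form_simps l form_matrix_add field_simps)
  show "\<Gamma> z u (r *\<^sub>R v) = r *\<^sub>R \<Gamma> z u v"
    by (rule g_nondegenerate[OF z]) (simp add: koszul[OF z] form_simps l form_matrix_scale field_simps)
qed

lemma linear_\<Gamma>_left: "z \<in> S \<Longrightarrow> linear (\<lambda>u. \<Gamma> z u v)"
  using linear_\<Gamma>_right[of z v] by (simp add: \<Gamma>_sym[of z _ v])

lemmas \<Gamma>_linear = linear_add[OF linear_\<Gamma>_right] linear_scale[OF linear_\<Gamma>_right]
  linear_add[OF linear_\<Gamma>_left] linear_scale[OF linear_\<Gamma>_left]

lemma \<Gamma>_metric: "z \<in> S \<Longrightarrow> form (ddir g z w) u v = form (g z) (\<Gamma> z w u) v + form (g z) u (\<Gamma> z w v)"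
  using form_g_sym[of z u "\<Gamma> z w v"] koszul[of z w u v] koszul[of z w v u]
    ddir_g_sym[of z w v u] ddir_g_sym[of z v w u] ddir_g_sym[of z u w v] by (simp add: field_simps)

lemma smooth_\<Gamma>: "smooth_on S (\<lambda>z. \<Gamma> z u v)"
proof -
  have "smooth_on S (\<lambda>z. pdiff i (\<lambda>y. g y $ j $ l) z)" for i j l
    unfolding pdiff_def by (intro smooth_on_ddir smooth_on_nth open_S smooth_g)
  moreover have "smooth_on S (\<lambda>z. matrix_inv (g z) $ k $ l)" for k l
    by (intro smooth_on_nth open_S smooth_on_matrix_inv smooth_g g_inv)
  ultimately show ?thesis
    unfolding christoffel_vec_def christoffel_def
    by (intro smooth_on_vec_lambda smooth_on_sum smooth_on_mult smooth_on_add smooth_on_diff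
        smooth_on_const open_S)
qed

end

locale metric_map = metric_patch S g for S :: "(real^'n) set" and g +
  fixes U :: "(real^'m) set" and F :: "real^'m \<Rightarrow> real^'n"
  assumes open_U: "open U" and smooth_F: "smooth_on U F" and F_in: "z \<in> U \<Longrightarrow> F z \<in> S"
begin

abbreviation "D \<equiv> cov_along g F"

lemma diff_F: "z \<in> U \<Longrightarrow> F differentiable (at z)"
  by (rule smooth_on_differentiable[OF smooth_F])

lemma linear_dF: "z \<in> U \<Longrightarrow> linear (ddir F z)"
  by (rule ddir_linear[OF diff_F])

lemma smooth_on_F: "smooth_on S \<phi> \<Longrightarrow> smooth_on U (\<lambda>x. \<phi> (F x))"
  by (rule smooth_on_compose[OF open_U _ _ smooth_F]) (auto intro: F_in)

lemma ddir_F: "\<phi> differentiable (at (F z)) \<Longrightarrow> z \<in> U \<Longrightarrow> ddir (\<lambda>x. \<phi> (F x)) z u = ddir \<phi> (F z) (ddir F z u)"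
  using frechet_derivative_compose[OF diff_F, of z \<phi>] by (simp add: o_def fun_eq_iff)

lemma cov_cong: "z \<in> U \<Longrightarrow> (\<And>x. x \<in> U \<Longrightarrow> V x = W x) \<Longrightarrow> D V z u = D W z u"
  unfolding cov_along_def using ddir_cong[OF open_U, of z V W] by simp

lemma ddir_add:
  "V differentiable (at z) \<Longrightarrow> W differentiable (at z) \<Longrightarrow> ddir (\<lambda>x. V x + W x) z u = ddir V z u + ddir W z u"
  by (rule ddir_eqI) (auto intro!: derivative_intros simp: frechet_derivative_works[symmetric])

lemma cov_add:
  "z \<in> U \<Longrightarrow> V differentiable (at z) \<Longrightarrow> W differentiable (at z) \<Longrightarrow> D (\<lambda>x. V x + W x) z u = D V z u + D W z u"
  unfolding cov_along_def by (simp add: ddir_add \<Gamma>_linear F_in)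

lemma cov_scale:
  "z \<in> U \<Longrightarrow> V differentiable (at z) \<Longrightarrow> \<phi> differentiable (at z) \<Longrightarrow>
    D (\<lambda>x. \<phi> x *\<^sub>R V x) z u = \<phi> z *\<^sub>R D V z u + ddir \<phi> z u *\<^sub>R V z"
  unfolding cov_along_def
  by (simp add: ddir_bilinear[OF bounded_bilinear_scaleR] \<Gamma>_linear F_in algebra_simps)

lemma cov_minus:
  "z \<in> U \<Longrightarrow> V differentiable (at z) \<Longrightarrow> D (\<lambda>x. - V x) z u = - D V z u"
  using cov_scale[of z V "\<lambda>_. -1" u] by simp

lemma cov_metric:
  assumes z: "z \<in> U" and V: "V differentiable (at z)" and W: "W differentiable (at z)"
  shows "ddir (\<lambda>x. form (g (F x)) (V x) (W x)) z u
     = form (g (F z)) (D V z u) (W z) + form (g (F z)) (V z) (D W z u)"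
proof -
  note gF = smooth_on_differentiable[OF smooth_on_F[OF smooth_g] z]
  have "ddir (\<lambda>x. g (F x)) z u = ddir g (F z) (ddir F z u)"
    by (rule ddir_F[OF smooth_on_differentiable[OF smooth_g F_in[OF z]] z])
  then show ?thesis
    unfolding ddir_form[OF gF V W] cov_along_def by (simp add: \<Gamma>_metric[OF F_in[OF z]] form_simps)
qed

lemma cov_torsion_free: "z \<in> U \<Longrightarrow> D (\<lambda>x. ddir F x v) z u = D (\<lambda>x. ddir F x u) z v"
  unfolding cov_along_def
  using ddir_commute[OF open_U _ smooth_F, of z u v] \<Gamma>_sym[OF F_in, of z "ddir F z u" "ddir F z v"] by simp

lemma smooth_on_\<Gamma>_along:
  assumes "smooth_on U P" "smooth_on U Q"
  shows "smooth_on U (\<lambda>x. \<Gamma> (F x) (P x) (Q x))"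
proof -
  have e: "(\<Sum>i\<in>UNIV. \<Sum>j\<in>UNIV. (P x $ i * Q x $ j) *\<^sub>R \<Gamma> (F x) (axis i 1) (axis j 1)) = \<Gamma> (F x) (P x) (Q x)"
    if "x \<in> U" for x
  proof -
    note r = linear_sum[OF linear_\<Gamma>_right[OF F_in[OF that]]] linear_scale[OF linear_\<Gamma>_right[OF F_in[OF that]]]
    note l = linear_sum[OF linear_\<Gamma>_left[OF F_in[OF that]]] linear_scale[OF linear_\<Gamma>_left[OF F_in[OF that]]]
    have p: "y = (\<Sum>i\<in>UNIV. y $ i *\<^sub>R axis i 1)" for y :: "real^'n"
      by (simp add: basis_expansion[of y, unfolded scalar_mult_eq_scaleR])
    have "\<Gamma> (F x) (P x) (Q x) = \<Gamma> (F x) (\<Sum>i\<in>UNIV. P x $ i *\<^sub>R axis i 1) (\<Sum>j\<in>UNIV. Q x $ j *\<^sub>R axis j 1)"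
      using p by metis
    also have "\<dots> = (\<Sum>j\<in>UNIV. \<Sum>i\<in>UNIV. (P x $ i * Q x $ j) *\<^sub>R \<Gamma> (F x) (axis i 1) (axis j 1))"
      by (simp add: r l scaleR_sum_right mult.commute)
    also have "\<dots> = (\<Sum>i\<in>UNIV. \<Sum>j\<in>UNIV. (P x $ i * Q x $ j) *\<^sub>R \<Gamma> (F x) (axis i 1) (axis j 1))"
      by (rule sum.swap)
    finally show ?thesis by simp
  qed
  have "smooth_on U (\<lambda>x. \<Sum>i\<in>UNIV. \<Sum>j\<in>UNIV. (P x $ i * Q x $ j) *\<^sub>R \<Gamma> (F x) (axis i 1) (axis j 1))"
    by (intro smooth_on_sum smooth_on_scaleR smooth_on_mult smooth_on_nth smooth_on_F smooth_\<Gamma> open_U assms)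
  then show ?thesis by (rule smooth_on_cong[OF open_U, rotated]) (rule e)
qed

lemma smooth_on_cov: "smooth_on U V \<Longrightarrow> smooth_on U (\<lambda>x. D V x u)"
  unfolding cov_along_def
  by (intro smooth_on_add open_U smooth_on_ddir smooth_on_\<Gamma>_along smooth_F)

lemma smooth_on_dF_apply:
  assumes "smooth_on U W"
  shows "smooth_on U (\<lambda>x. ddir F x (W x))"
proof -
  have e: "(\<Sum>i\<in>UNIV. W x $ i *\<^sub>R ddir F x (axis i 1)) = ddir F x (W x)" if "x \<in> U" for x
  proof -
    have p: "W x = (\<Sum>i\<in>UNIV. W x $ i *\<^sub>R axis i 1)"
      by (simp add: basis_expansion[of "W x", unfolded scalar_mult_eq_scaleR])
    have "ddir F x (W x) = ddir F x (\<Sum>i\<in>UNIV. W x $ i *\<^sub>R axis i 1)" using p by metis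
    then show ?thesis by (simp add: linear_sum[OF linear_dF[OF that]] linear_scale[OF linear_dF[OF that]])
  qed
  have "smooth_on U (\<lambda>x. \<Sum>i\<in>UNIV. W x $ i *\<^sub>R ddir F x (axis i 1))"
    by (intro smooth_on_sum smooth_on_scaleR smooth_on_nth smooth_on_ddir smooth_F open_U assms)
  then show ?thesis by (rule smooth_on_cong[OF open_U, rotated]) (rule e)
qed

text \<open>\<open>\<Gamma>\<close> depends on the point and, linearly, on two vectors, and all three vary along \<open>F\<close>.\<close>
lemma ddir_\<Gamma>_along:
  assumes z: "z \<in> U" and P: "P differentiable (at z)" and Q: "Q differentiable (at z)"
  shows "ddir (\<lambda>x. \<Gamma> (F x) (P x) (Q x)) z u = ddir (\<lambda>y. \<Gamma> y (P z) (Q z)) (F z) (ddir F z u)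
     + \<Gamma> (F z) (ddir P z u) (Q z) + \<Gamma> (F z) (P z) (ddir Q z u)"
proof -
  have d: "(\<lambda>x. \<Gamma> (F x) a b) differentiable (at z)" for a b
    by (rule smooth_on_differentiable[OF smooth_on_F[OF smooth_\<Gamma>] z])
  note 1 = ddir_linear_apply[OF open_U z linear_\<Gamma>_left[OF F_in] d P, simplified]
  have "ddir (\<lambda>x. \<Gamma> (F x) (P x) (Q x)) z u = ddir (\<lambda>x. \<Gamma> (F x) (P x) (Q z)) z u + \<Gamma> (F z) (P z) (ddir Q z u)"
    by (rule ddir_linear_apply(1)[OF open_U z linear_\<Gamma>_right[OF F_in] 1(2) Q])
  also have "ddir (\<lambda>x. \<Gamma> (F x) (P x) (Q z)) z u
      = ddir (\<lambda>x. \<Gamma> (F x) (P z) (Q z)) z u + \<Gamma> (F z) (ddir P z u) (Q z)"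
    by (rule 1(1))
  also have "ddir (\<lambda>x. \<Gamma> (F x) (P z) (Q z)) z u = ddir (\<lambda>y. \<Gamma> y (P z) (Q z)) (F z) (ddir F z u)"
    by (rule ddir_F[OF smooth_on_differentiable[OF smooth_\<Gamma> F_in[OF z]] z])
  finally show ?thesis by simp
qed

text \<open>The second derivatives of \<open>V\<close> and of \<open>F\<close> cancel by symmetry, as do the terms that contain one
  derivative of \<open>V\<close>. What remains involves \<open>F\<close> only through its first derivatives.\<close>
lemma cov_commutator:
  assumes z: "z \<in> U" and V: "smooth_on U V"
  shows "D (\<lambda>x. D V x v) z u - D (\<lambda>x. D V x u) z v
     = curvature g (F z) (ddir F z u) (ddir F z v) (V z)"
proof -
  have *: "D (\<lambda>x. D V x v) z u = ddir (\<lambda>x. ddir V x v) z u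
     + ddir (\<lambda>y. \<Gamma> y (ddir F z v) (V z)) (F z) (ddir F z u)
     + \<Gamma> (F z) (ddir (\<lambda>x. ddir F x v) z u) (V z) + \<Gamma> (F z) (ddir F z v) (ddir V z u)
     + \<Gamma> (F z) (ddir F z u) (ddir V z v) + \<Gamma> (F z) (ddir F z u) (\<Gamma> (F z) (ddir F z v) (V z))" for u v
  proof -
    note dF = smooth_on_differentiable[OF smooth_on_ddir[OF smooth_F] z]
    note dV = smooth_on_differentiable[OF smooth_on_ddir[OF V] z]
    have "ddir (\<lambda>x. D V x v) z u = ddir (\<lambda>x. ddir V x v) z u + ddir (\<lambda>x. \<Gamma> (F x) (ddir F x v) (V x)) z u"
      unfolding cov_along_def
      by (rule ddir_add[OF dV smooth_on_differentiable[OF smooth_on_\<Gamma>_along[OF smooth_on_ddir[OF smooth_F] V] z]])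
    also note ddir_\<Gamma>_along[OF z dF smooth_on_differentiable[OF V z]]
    finally have 1: "ddir (\<lambda>x. D V x v) z u = ddir (\<lambda>x. ddir V x v) z u +
      (ddir (\<lambda>y. \<Gamma> y (ddir F z v) (V z)) (F z) (ddir F z u) +
       \<Gamma> (F z) (ddir (\<lambda>x. ddir F x v) z u) (V z) + \<Gamma> (F z) (ddir F z v) (ddir V z u))" .
    have "D (\<lambda>x. D V x v) z u = ddir (\<lambda>x. D V x v) z u + \<Gamma> (F z) (ddir F z u) (D V z v)"
      by (simp add: cov_along_def)
    then show ?thesis unfolding 1 by (simp add: cov_along_def \<Gamma>_linear[OF F_in[OF z]])
  qed
  have c: "cov g (\<lambda>y. cov g (\<lambda>_. w) y b) x a
     = ddir (\<lambda>y. \<Gamma> y b w) x a + \<Gamma> x a (\<Gamma> x b w)" for x a b w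
    by (simp add: cov_along_def)
  show ?thesis
    unfolding * curvature_def c
    using ddir_commute[OF open_U z smooth_F, of u v] ddir_commute[OF open_U z V, of u v] by simp
qed

end

section \<open>Constant sectional curvature\<close>

context metric_patch
begin

abbreviation R :: "real^'n \<Rightarrow> real^'n \<Rightarrow> real^'n \<Rightarrow> real^'n \<Rightarrow> real^'n" where
  "R \<equiv> curvature g"

lemma R_expand: "R z u v w = ddir (\<lambda>y. \<Gamma> y v w) z u + \<Gamma> z u (\<Gamma> z v w)
    - (ddir (\<lambda>y. \<Gamma> y u w) z v + \<Gamma> z v (\<Gamma> z u w))"
  by (simp add: curvature_def cov_along_def)

lemma ddir_\<Gamma>_linear:
  assumes z: "z \<in> S"
  shows "ddir (\<lambda>y. \<Gamma> y (a + b) w) z u = ddir (\<lambda>y. \<Gamma> y a w) z u + ddir (\<lambda>y. \<Gamma> y b w) z u"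
    and "ddir (\<lambda>y. \<Gamma> y w (a + b)) z u = ddir (\<lambda>y. \<Gamma> y w a) z u + ddir (\<lambda>y. \<Gamma> y w b) z u"
    and "ddir (\<lambda>y. \<Gamma> y w a) z (u + v) = ddir (\<lambda>y. \<Gamma> y w a) z u + ddir (\<lambda>y. \<Gamma> y w a) z v"
    and "ddir (\<lambda>y. \<Gamma> y (r *\<^sub>R a) w) z u = r *\<^sub>R ddir (\<lambda>y. \<Gamma> y a w) z u"
    and "ddir (\<lambda>y. \<Gamma> y w (r *\<^sub>R a)) z u = r *\<^sub>R ddir (\<lambda>y. \<Gamma> y w a) z u"
    and "ddir (\<lambda>y. \<Gamma> y w a) z (r *\<^sub>R u) = r *\<^sub>R ddir (\<lambda>y. \<Gamma> y w a) z u"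
proof -
  have d: "(\<lambda>y. \<Gamma> y a b) differentiable (at z)" for a b
    by (rule smooth_on_differentiable[OF smooth_\<Gamma> z])
  have add: "ddir (\<lambda>y. \<Gamma> y a b + \<Gamma> y c e) z u = ddir (\<lambda>y. \<Gamma> y a b) z u + ddir (\<lambda>y. \<Gamma> y c e) z u" for a b c e
    by (rule ddir_eqI) (auto intro!: derivative_intros simp: frechet_derivative_works[symmetric] d)
  have sc: "ddir (\<lambda>y. r *\<^sub>R \<Gamma> y a b) z u = r *\<^sub>R ddir (\<lambda>y. \<Gamma> y a b) z u" for a b
    by (rule ddir_bounded_linear[OF bounded_linear_scaleR_right d])
  show "ddir (\<lambda>y. \<Gamma> y (a + b) w) z u = ddir (\<lambda>y. \<Gamma> y a w) z u + ddir (\<lambda>y. \<Gamma> y b w) z u"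
    by (subst add[symmetric], rule ddir_cong[OF open_S z]) (simp add: \<Gamma>_linear)
  show "ddir (\<lambda>y. \<Gamma> y w (a + b)) z u = ddir (\<lambda>y. \<Gamma> y w a) z u + ddir (\<lambda>y. \<Gamma> y w b) z u"
    by (subst add[symmetric], rule ddir_cong[OF open_S z]) (simp add: \<Gamma>_linear)
  show "ddir (\<lambda>y. \<Gamma> y (r *\<^sub>R a) w) z u = r *\<^sub>R ddir (\<lambda>y. \<Gamma> y a w) z u"
    by (subst sc[symmetric], rule ddir_cong[OF open_S z]) (simp add: \<Gamma>_linear)
  show "ddir (\<lambda>y. \<Gamma> y w (r *\<^sub>R a)) z u = r *\<^sub>R ddir (\<lambda>y. \<Gamma> y w a) z u"
    by (subst sc[symmetric], rule ddir_cong[OF open_S z]) (simp add: \<Gamma>_linear)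
  show "ddir (\<lambda>y. \<Gamma> y w a) z (u + v) = ddir (\<lambda>y. \<Gamma> y w a) z u + ddir (\<lambda>y. \<Gamma> y w a) z v"
    by (rule linear_add[OF ddir_linear[OF d]])
  show "ddir (\<lambda>y. \<Gamma> y w a) z (r *\<^sub>R u) = r *\<^sub>R ddir (\<lambda>y. \<Gamma> y w a) z u"
    by (rule linear_scale[OF ddir_linear[OF d]])
qed

lemma R_linear:
  assumes z: "z \<in> S"
  shows "R z (a + b) v w = R z a v w + R z b v w" "R z v (a + b) w = R z v a w + R z v b w"
    "R z v w (a + b) = R z v w a + R z v w b"
    "R z (r *\<^sub>R a) v w = r *\<^sub>R R z a v w" "R z v (r *\<^sub>R a) w = r *\<^sub>R R z v a w"
    "R z v w (r *\<^sub>R a) = r *\<^sub>R R z v w a"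
  by (simp_all add: R_expand ddir_\<Gamma>_linear[OF z] \<Gamma>_linear[OF z] algebra_simps)

lemma R_antisym: "R z u v w = - R z v u w"
  by (simp add: R_expand)

lemma R_bianchi:
  assumes z: "z \<in> S" shows "R z u v w + R z v w u + R z w u v = 0"
proof -
  have "ddir (\<lambda>y. \<Gamma> y a b) z c = ddir (\<lambda>y. \<Gamma> y b a) z c" for a b c
    by (rule ddir_cong[OF open_S z]) (rule \<Gamma>_sym)
  from this[of u v] this[of v w] this[of w u] show ?thesis
    using \<Gamma>_sym[OF z, of u v] \<Gamma>_sym[OF z, of v w] \<Gamma>_sym[OF z, of w u] by (simp add: R_expand)
qed

text \<open>The second derivatives of \<open>\<langle>w,x\<rangle>\<close>, for fields \<open>w\<close> and \<open>x\<close> with constant coefficients,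
  commute.\<close>
lemma R_skew:
  assumes z: "z \<in> S" shows "form (g z) (R z u v w) x = - form (g z) w (R z u v x)"
proof -
  interpret id: metric_map S g S "\<lambda>z. z"
    by unfold_locales (auto intro: open_S smooth_on_linear bounded_linear_ident)
  have sm: "smooth_on S (\<lambda>z. w)" for w :: "real^'n" by (rule smooth_on_const)
  note sD = id.smooth_on_cov[OF sm]
  note dD = smooth_on_differentiable[OF sD]
  have 1: "ddir (\<lambda>y. form (g y) w x) y v = form (g y) (cov g (\<lambda>_. w) y v) x + form (g y) w (cov g (\<lambda>_. x) y v)"
    if "y \<in> S" for y v
    by (rule id.cov_metric[OF that]) auto
  have 2: "ddir (\<lambda>y. ddir (\<lambda>y. form (g y) w x) y v) z u
    = form (g z) (cov g (\<lambda>y. cov g (\<lambda>_. w) y v) z u) x + form (g z) (cov g (\<lambda>_. w) z v) (cov g (\<lambda>_. x) z u)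
     + (form (g z) (cov g (\<lambda>_. w) z u) (cov g (\<lambda>_. x) z v) + form (g z) w (cov g (\<lambda>y. cov g (\<lambda>_. x) y v) z u))"
    for u v
  proof -
    have d: "(\<lambda>y. form (g y) (V y) (W y)) differentiable (at z)" if "smooth_on S V" "smooth_on S W" for V W
      by (intro smooth_on_differentiable[OF _ z] smooth_on_form open_S smooth_g that)
    have "ddir (\<lambda>y. ddir (\<lambda>y. form (g y) w x) y v) z u
      = ddir (\<lambda>y. form (g y) (cov g (\<lambda>_. w) y v) x + form (g y) w (cov g (\<lambda>_. x) y v)) z u"
      by (rule ddir_cong[OF open_S z]) (rule 1)
    also have "\<dots> = ddir (\<lambda>y. form (g y) (cov g (\<lambda>_. w) y v) x) z u + ddir (\<lambda>y. form (g y) w (cov g (\<lambda>_. x) y v)) z u"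
      by (rule id.ddir_add) (intro d sD sm)+
    also have "ddir (\<lambda>y. form (g y) (cov g (\<lambda>_. w) y v) x) z u
      = form (g z) (cov g (\<lambda>y. cov g (\<lambda>_. w) y v) z u) x + form (g z) (cov g (\<lambda>_. w) z v) (cov g (\<lambda>_. x) z u)"
      by (rule id.cov_metric[OF z dD[OF z]]) simp
    also have "ddir (\<lambda>y. form (g y) w (cov g (\<lambda>_. x) y v)) z u
      = form (g z) (cov g (\<lambda>_. w) z u) (cov g (\<lambda>_. x) z v) + form (g z) w (cov g (\<lambda>y. cov g (\<lambda>_. x) y v) z u)"
      by (rule id.cov_metric[OF z _ dD[OF z]]) simp
    finally show ?thesis .
  qed
  have "smooth_on S (\<lambda>y. form (g y) w x)" by (intro smooth_on_form open_S smooth_g sm)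
  from ddir_commute[OF open_S z this, of v u] show ?thesis
    unfolding 2 curvature_def by (simp add: form_simps)
qed

text \<open>The pair symmetry is a consequence of the other three: combine the four Bianchi identities that
  have \<open>u\<close>, \<open>v\<close>, \<open>w\<close> and \<open>x\<close> in the last place.\<close>
lemma R_pair:
  assumes z: "z \<in> S" shows "form (g z) (R z u v w) x = form (g z) (R z w x u) v"
proof -
  define K where "K a b c d = form (g z) (R z a b c) d" for a b c d
  have a: "K a b c d = - K b a c d" for a b c d
    using R_antisym[of z a b c] by (simp add: K_def form_simps)
  have s: "K a b c d = - K a b d c" for a b c d
    using R_skew[OF z, of a b c d] form_g_sym[OF z] by (simp add: K_def)
  have b: "K a b c d + K b c a d + K c a b d = 0" for a b c d
    using R_bianchi[OF z, of a b c] by (simp add: K_def form_add_left[symmetric] form_zero_left)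
  have "K u v w x = K w x u v"
    using b[of u v w x] b[of v w x u] b[of w x u v] b[of x u v w]
      a[of u v w x] a[of u v x w] s[of u v w x] s[of v u w x]
      a[of v w u x] s[of v w u x] a[of w v u x] s[of w v x u] a[of v w x u]
      a[of w u v x] s[of w u v x] a[of u w v x] s[of u w v x] a[of w u x v] s[of u w x v]
      a[of w x u v] s[of w x u v] a[of x w u v] s[of x w u v] a[of x u v w] s[of x u v w] a[of u x v w] s[of u x v w] a[of x v w u] s[of x v w u]
       a[of v x w u] s[of v x w u]  by linarith
  then show ?thesis by (simp add: K_def)
qed

end

text \<open>A polynomial that vanishes off the zeros of a nonzero polynomial has infinitely many zeros.\<close>
lemma quadratic_vanishes:
  fixes a b c a' b' c' :: real
  assumes "c' \<noteq> 0" and z: "\<And>t. a' + b' * t + c' * t\<^sup>2 \<noteq> 0 \<Longrightarrow> a + b * t + c * t\<^sup>2 = 0"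
  shows "a = 0"
proof (rule ccontr)
  assume "a \<noteq> 0"
  have fin: "finite {t. p + q * t + r * t\<^sup>2 = 0}" if "p \<noteq> 0 \<or> r \<noteq> 0" for p q r :: real
  proof -
    have "(\<Sum>i\<le>2. [p, q, r] ! i * t ^ i) = p + q * t + r * t\<^sup>2" for t
      by (simp add: numeral_2_eq_2 power2_eq_square)
    moreover have "finite {t. (\<Sum>i\<le>2. [p, q, r] ! i * t ^ i) = 0}"
    proof (cases "p \<noteq> 0")
      case True
      then show ?thesis by (intro polyfun_finite_roots[THEN iffD2] exI[of _ 0]) simp
    next
      case False
      then show ?thesis using that by (intro polyfun_finite_roots[THEN iffD2] exI[of _ 2]) simp
    qed
    ultimately show ?thesis by simp
  qed
  have "finite ({t. a' + b' * t + c' * t\<^sup>2 = 0} \<union> {t. a + b * t + c * t\<^sup>2 = 0})"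
    using fin assms(1) \<open>a \<noteq> 0\<close> by blast
  moreover have "{t. a' + b' * t + c' * t\<^sup>2 = 0} \<union> {t. a + b * t + c * t\<^sup>2 = 0} = UNIV"
    using z by blast
  ultimately show False using infinite_UNIV_char_0 by metis
qed

context metric_patch
begin

lemma exists_nonnull:
  assumes z: "z \<in> S" shows "\<exists>v. form (g z) v v \<noteq> 0"
proof (rule ccontr)
  assume "\<not> ?thesis"
  then have n: "form (g z) v v = 0" for v by blast
  have "form (g z) u v = 0" for u v
    using n[of "u + v"] n[of u] n[of v] form_g_sym[OF z, of u v] by (simp add: form_simps)
  then have "axis undefined 1 = (0 :: real^'n)"
    by (intro g_nondegenerate[OF z]) simp
  then show False by (simp add: axis_eq_0_iff)
qed

lemma exists_nonnull_orthogonal: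
  assumes z: "z \<in> S" and d: "CARD('n) \<ge> 2" and v: "form (g z) v v \<noteq> 0"
  shows "\<exists>w. form (g z) v w = 0 \<and> form (g z) w w \<noteq> 0"
proof (rule ccontr)
  assume "\<not> ?thesis"
  then have n: "form (g z) w w = 0" if "form (g z) v w = 0" for w using that by blast
  obtain w where w: "w \<noteq> 0" "orthogonal (g z *v v) w"
    using orthogonal_to_vector_exists[of "g z *v v"] d by auto
  have vw: "form (g z) v w = 0"
    using w(2) form_g_sym[OF z, of v w] by (simp add: form_def orthogonal_def inner_commute)
  have "form (g z) w y = 0" for y
  proof -
    define y' where "y' = y - (form (g z) v y / form (g z) v v) *\<^sub>R v"
    have y': "form (g z) v y' = 0" using v by (simp add: y'_def form_simps)
    have "form (g z) w y' = 0"
      using n[of "w + y'"] n[OF vw] n[OF y'] vw y' form_g_sym[OF z, of w y'] by (simp add: form_simps)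
    then show ?thesis using vw form_g_sym[OF z, of v w] by (simp add: y'_def form_simps)
  qed
  then have "w = 0" by (intro g_nondegenerate[OF z]) (simp add: form_simps)
  then show False using w by simp
qed

text \<open>The defect of the curvature tensor from the one of constant curvature \<open>c\<close> is a biquadratic
  form on pairs of vectors which vanishes on nondegenerate planes. These are dense, so it vanishes
  on all planes, and the symmetries of the curvature tensor give the rest by polarization.\<close>
lemma constant_curvature:
  assumes z: "z \<in> S" and d: "CARD('n) \<ge> 2"
    and sec: "\<And>u v. area_form (g z) u v \<noteq> 0 \<Longrightarrow> sectional_curvature g z u v = c"
  shows "R z u v w = c *\<^sub>R (form (g z) v w *\<^sub>R u - form (g z) u w *\<^sub>R v)"
proof -
  define K where "K a b e h = form (g z) (R z a b e) h
      - c * (form (g z) b e * form (g z) a h - form (g z) a e * form (g z) b h)" for a b e h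
  note fs = form_g_sym[OF z]
  have lin: "K (a + a') b e h = K a b e h + K a' b e h" "K b (a + a') e h = K b a e h + K b a' e h"
    "K b e (a + a') h = K b e a h + K b e a' h" "K b e h (a + a') = K b e h a + K b e h a'"
    "K (r *\<^sub>R a) b e h = r * K a b e h" "K b (r *\<^sub>R a) e h = r * K b a e h"
    "K b e (r *\<^sub>R a) h = r * K b e a h" "K b e h (r *\<^sub>R a) = r * K b e h a" for a a' b e h r
    by (simp_all add: K_def R_linear[OF z] form_simps algebra_simps)
  have anti: "K a b e h = - K b a e h" for a b e h
    using R_antisym[of z a b e] by (simp add: K_def form_simps algebra_simps)
  have pair: "K a b e h = K e h a b" for a b e h
    using R_pair[OF z, of a b e h] fs[of b e] fs[of a h] fs[of a e] fs[of b h]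
    by (simp add: K_def algebra_simps)
  have bianchi: "K a b e h + K b e a h + K e a b h = 0" for a b e h
  proof -
    have "form (g z) (R z a b e) h + form (g z) (R z b e a) h + form (g z) (R z e a b) h = 0"
      using R_bianchi[OF z, of a b e] by (simp add: form_add_left[symmetric] form_zero_left)
    then show ?thesis using fs[of a b] fs[of a e] fs[of b e] by (simp add: K_def algebra_simps)
  qed
  have K0: "K a b b a = 0" if "area_form (g z) a b \<noteq> 0" for a b
    using sec[OF that] that fs[of a b]
    by (simp add: K_def sectional_curvature_def area_form_def field_simps power2_eq_square)
  have K1: "K a b b a = 0" if b: "form (g z) b b \<noteq> 0" for a b
  proof -
    obtain a' where a': "form (g z) b a' = 0" "form (g z) a' a' \<noteq> 0"
      using exists_nonnull_orthogonal[OF z d b] by blast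
    show ?thesis
    proof (rule quadratic_vanishes)
      show "form (g z) a' a' * form (g z) b b \<noteq> 0" using a' b by simp
      fix t
      assume t: "area_form (g z) a b + (2 * form (g z) a a' * form (g z) b b) * t
        + (form (g z) a' a' * form (g z) b b) * t\<^sup>2 \<noteq> 0"
      have "area_form (g z) (a + t *\<^sub>R a') b = area_form (g z) a b + (2 * form (g z) a a' * form (g z) b b) * t
        + (form (g z) a' a' * form (g z) b b) * t\<^sup>2"
        using a'(1) fs[of a' b] fs[of a' a] by (simp add: area_form_def form_simps power2_eq_square algebra_simps)
      then have "K (a + t *\<^sub>R a') b b (a + t *\<^sub>R a') = 0" using t K0 by simp
      then show "K a b b a + (K a b b a' + K a' b b a) * t + K a' b b a' * t\<^sup>2 = 0"
        by (simp add: lin power2_eq_square algebra_simps)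
    qed
  qed
  \<comment> \<open>First \<open>a\<close> is moved along a line to reach nondegenerate planes through a nonnull \<open>b\<close>; now \<open>b\<close>
    is moved to reach nonnull vectors.\<close>
  obtain b' where b': "form (g z) b' b' \<noteq> 0" using exists_nonnull[OF z] by blast
  have K2: "K a b b a = 0" for a b
  proof (rule quadratic_vanishes[OF b'])
    fix t
    assume t: "form (g z) b b + (2 * form (g z) b b') * t + form (g z) b' b' * t\<^sup>2 \<noteq> 0"
    have "form (g z) (b + t *\<^sub>R b') (b + t *\<^sub>R b') = form (g z) b b + (2 * form (g z) b b') * t + form (g z) b' b' * t\<^sup>2"
      using fs[of b' b] by (simp add: form_simps power2_eq_square algebra_simps)
    then have "K a (b + t *\<^sub>R b') (b + t *\<^sub>R b') a = 0" using t K1 by simp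
    then show "K a b b a + (K a b b' a + K a b' b a) * t + K a b' b' a * t\<^sup>2 = 0"
      by (simp add: lin power2_eq_square algebra_simps)
  qed
  have K3: "K a b b h = 0" for a b h
  proof -
    have "K a b b h + K h b b a = 0" using K2[of "a + h" b] K2[of a b] K2[of h b] by (simp add: lin)
    moreover have "K h b b a = K a b b h"
      using pair[of h b b a] anti[of b a h b] pair[of a b h b] anti[of h b a b] pair[of b h a b] by linarith
    ultimately show ?thesis by linarith
  qed
  have K4: "K a b e h = - K a e b h" for a b e h
    using K3[of a "b + e" h] K3[of a b h] K3[of a e h] by (simp add: lin)
  have "K a b e h = 0" for a b e h
    using bianchi[of a b e h] K4[of b e a h] anti[of b a e h] anti[of e a b h] K4[of a e b h] by linarith
  then have "form (g z) (R z u v w) h = form (g z) (c *\<^sub>R (form (g z) v w *\<^sub>R u - form (g z) u w *\<^sub>R v)) h" for h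
    by (simp add: K_def form_simps)
  then show ?thesis by (rule g_nondegenerate[OF z])
qed

end

section \<open>Covariant derivative of endomorphism fields\<close>

lemma mv_add: "(A + B) *v x = A *v x + B *v (x::real^'n)" "A *v (x + y) = A *v x + A *v (y::real^'n)"
  and mv_diff: "(A - B) *v x = A *v x - B *v (x::real^'n)" "A *v (x - y) = A *v x - A *v (y::real^'n)"
  and mv_scale: "(r *\<^sub>R A) *v x = r *\<^sub>R (A *v x)" "A *v (r *\<^sub>R x) = r *\<^sub>R (A *v (x::real^'n))"
  and mv_minus: "(- A) *v x = - (A *v x)" "A *v (- x) = - (A *v (x::real^'n))"
  and mv_mult: "(C ** B) *v x = C *v (B *v (x::real^'n))"
  for A B :: "real^'n^'m" and C :: "real^'m^'k"
  by (simp_all add: vec_eq_iff matrix_vector_mult_def matrix_matrix_mult_def sum.distrib sum_subtractf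
      algebra_simps sum_distrib_left sum_negf) (rule allI, rule sum.swap)

lemmas mv_simps = mv_add mv_diff mv_scale mv_minus mv_mult matrix_vector_mul_lid

lemma mv_eqI: "(\<And>x. A *v x = B *v x) \<Longrightarrow> A = (B :: real^'n^'m)"
  by (simp add: matrix_eq)

context metric_patch
begin

definition Gm :: "real^'n \<Rightarrow> real^'n \<Rightarrow> real^'n^'n" where
  "Gm z u = matrix (\<Gamma> z u)"

text \<open>The covariant derivative of an endomorphism field: in coordinates the connection acts on
  endomorphisms by the commutator with the Christoffel matrix.\<close>
definition nab :: "(real^'n \<Rightarrow> real^'n^'n) \<Rightarrow> real^'n \<Rightarrow> real^'n \<Rightarrow> real^'n^'n" where
  "nab M z u = ddir M z u + (Gm z u ** M z - M z ** Gm z u)"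

lemma Gm_works: "z \<in> S \<Longrightarrow> Gm z u *v v = \<Gamma> z u v"
  unfolding Gm_def by (simp add: matrix_works linear_\<Gamma>_right)

lemma smooth_Gm: "smooth_on S (\<lambda>z. Gm z u)"
  unfolding Gm_def matrix_def by (intro smooth_on_vec_lambda smooth_on_nth smooth_\<Gamma> open_S)

lemma nab_apply: "z \<in> S \<Longrightarrow> nab M z u *v w = ddir M z u *v w + \<Gamma> z u (M z *v w) - M z *v \<Gamma> z u w"
  by (simp add: nab_def mv_simps Gm_works)

lemma linear_nab: "z \<in> S \<Longrightarrow> M differentiable (at z) \<Longrightarrow> linear (nab M z)"
  by (intro linearI mv_eqI)
    (simp_all add: nab_apply mv_simps linear_add[OF ddir_linear] linear_scale[OF ddir_linear] \<Gamma>_linear algebra_simps)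

lemma smooth_nab: "smooth_on S M \<Longrightarrow> smooth_on S (\<lambda>z. nab M z u)"
  unfolding nab_def by (intro smooth_on_add smooth_on_diff smooth_on_mm smooth_on_ddir smooth_Gm open_S)

lemma nab_mult:
  assumes z: "z \<in> S" and "M differentiable (at z)" "N differentiable (at z)"
  shows "nab (\<lambda>x. M x ** N x) z u = nab M z u ** N z + M z ** nab N z u"
  by (rule mv_eqI)
    (simp add: nab_apply[OF z] ddir_bilinear[OF bounded_bilinear_mm assms(2,3)] mv_simps)

lemma nab_add:
  assumes z: "z \<in> S" and "M differentiable (at z)" "N differentiable (at z)"
  shows "nab (\<lambda>x. M x + N x) z u = nab M z u + nab N z u"
proof -
  have "ddir (\<lambda>x. M x + N x) z u = ddir M z u + ddir N z u"
    using assms(2,3)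
    by (intro ddir_eqI) (auto intro!: derivative_intros simp: frechet_derivative_works[symmetric])
  then show ?thesis by (intro mv_eqI) (simp add: nab_apply[OF z] mv_simps \<Gamma>_linear[OF z])
qed

lemma nab_scale:
  assumes z: "z \<in> S" and "M differentiable (at z)"
  shows "nab (\<lambda>x. r *\<^sub>R M x) z u = r *\<^sub>R nab M z u"
  using ddir_bounded_linear[OF bounded_linear_scaleR_right assms(2), of r u]
  by (intro mv_eqI) (simp add: nab_apply[OF z] mv_simps \<Gamma>_linear[OF z] algebra_simps)

lemma nab_mat: "z \<in> S \<Longrightarrow> nab (\<lambda>x. r *\<^sub>R mat 1) z u = 0"
  by (rule mv_eqI) (simp add: nab_apply mv_simps \<Gamma>_linear)

lemma nab_cong: "z \<in> S' \<Longrightarrow> open S' \<Longrightarrow> (\<And>x. x \<in> S' \<Longrightarrow> M x = N x) \<Longrightarrow> nab M z u = nab N z u"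
  unfolding nab_def using ddir_cong[of S' z M N] by simp

text \<open>The Ricci identity: second partial derivatives commute, and the commutator of the Christoffel
  matrices with their derivatives is the curvature operator, which acts on endomorphisms by the
  commutator as well.\<close>
lemma nab_commutator:
  assumes z: "z \<in> S" and M: "smooth_on S M"
  shows "(nab (\<lambda>x. nab M x v) z u - nab (\<lambda>x. nab M x u) z v) *v w
     = R z u v (M z *v w) - M z *v R z u v w"
proof -
  have dG: "(\<lambda>x. Gm x a) differentiable (at z)" for a
    by (rule smooth_on_differentiable[OF smooth_Gm z])
  have dM: "M differentiable (at z)" by (rule smooth_on_differentiable[OF M z])
  have ddM: "(\<lambda>x. ddir M x a) differentiable (at z)" for a
    by (rule smooth_on_differentiable[OF smooth_on_ddir[OF M] z])
  have "ddir (\<lambda>x. Gm x a *v y) z u = ddir (\<lambda>x. Gm x a) z u *v y" for a y u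
    using ddir_bilinear[OF bounded_bilinear_mv dG, of "\<lambda>_. y"] by simp
  moreover have "ddir (\<lambda>x. Gm x a *v y) z u = ddir (\<lambda>x. \<Gamma> x a y) z u" for a y u
    by (rule ddir_cong[OF open_S z]) (rule Gm_works)
  ultimately have dGm: "ddir (\<lambda>x. Gm x a) z u *v y = ddir (\<lambda>x. \<Gamma> x a y) z u" for a y u by simp
  have *: "ddir (\<lambda>x. nab M x v) z u = ddir (\<lambda>x. ddir M x v) z u
     + ((Gm z v ** ddir M z u + ddir (\<lambda>x. Gm x v) z u ** M z)
      - (M z ** ddir (\<lambda>x. Gm x v) z u + ddir M z u ** Gm z v))" for u v
  proof -
    have "((\<lambda>x. nab M x v) has_derivative (\<lambda>u. ddir (\<lambda>x. ddir M x v) z u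
     + ((Gm z v ** ddir M z u + ddir (\<lambda>x. Gm x v) z u ** M z)
      - (M z ** ddir (\<lambda>x. Gm x v) z u + ddir M z u ** Gm z v)))) (at z)"
      unfolding nab_def
      by (intro has_derivative_add has_derivative_diff bounded_bilinear.FDERIV[OF bounded_bilinear_mm]
          frechet_derivative_works[THEN iffD1] dG dM ddM)
    then show ?thesis by (rule ddir_eqI)
  qed
  show ?thesis
    using ddir_commute[OF open_S z M, of u v]
    by (simp add: mv_simps nab_apply[OF z] * R_expand dGm Gm_works[OF z] \<Gamma>_linear[OF z]
        linear_diff[OF linear_\<Gamma>_right[OF z]])
qed

end

section \<open>The equations of a hypersurface in a coordinate patch\<close>

locale hypersurface_patch = metric_map S g U F
  for S :: "(real^'n) set" and g and U :: "(real^'m) set" and F +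
  fixes \<xi> :: "real^'m \<Rightarrow> real^'n" and A :: "real^'m \<Rightarrow> real^'m^'m" and \<epsilon> c :: real
  assumes codim: "CARD('n) = Suc CARD('m)"
    and induced_inv: "z \<in> U \<Longrightarrow> invertible (induced_metric g F z)"
    and smooth_\<xi>: "smooth_on U \<xi>" and \<epsilon>: "\<epsilon> \<in> {1, -1}"
    and \<xi>_unit: "z \<in> U \<Longrightarrow> form (g (F z)) (\<xi> z) (\<xi> z) = \<epsilon>"
    and \<xi>_normal: "z \<in> U \<Longrightarrow> form (g (F z)) (\<xi> z) (ddir F z u) = 0"
    and weingarten: "z \<in> U \<Longrightarrow> D \<xi> z u = - ddir F z (A z *v u)"
    and const_curv: "y \<in> S \<Longrightarrow>
      curvature g y a b e = c *\<^sub>R (form (g y) b e *\<^sub>R a - form (g y) a e *\<^sub>R b)"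
begin

abbreviation "h \<equiv> induced_metric g F"

lemma \<epsilon>_sq: "\<epsilon> * \<epsilon> = 1" "\<epsilon> \<noteq> 0"
  using \<epsilon> by auto

lemma form_h:
  assumes z: "z \<in> U"
  shows "form (h z) u v = form (g (F z)) (ddir F z u) (ddir F z v)"
proof -
  have e: "ddir F z u = (\<Sum>i\<in>UNIV. u $ i *\<^sub>R ddir F z (axis i 1))" for u
  proof -
    have "u = (\<Sum>i\<in>UNIV. u $ i *\<^sub>R axis i 1)"
      by (simp add: basis_expansion[of u, unfolded scalar_mult_eq_scaleR])
    then have "ddir F z u = ddir F z (\<Sum>i\<in>UNIV. u $ i *\<^sub>R axis i 1)" by simp
    then show ?thesis by (simp add: linear_sum[OF linear_dF[OF z]] linear_scale[OF linear_dF[OF z]])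
  qed
  have s: "form B (sum f I) w = (\<Sum>i\<in>I. form B (f i) w)" "form B w (sum f I) = (\<Sum>i\<in>I. form B w (f i))"
    for B w and f :: "'m \<Rightarrow> real^'n" and I
    by (induction I rule: infinite_finite_induct) (auto simp: form_simps)
  show ?thesis
    unfolding e[of u] e[of v] s form_component[of "h z"]
    by (subst sum.swap) (simp add: form_simps induced_metric_def sum_distrib_left mult_ac)
qed

lemma smooth_h: "smooth_on U h"
  unfolding induced_metric_def
  by (intro smooth_on_vec_lambda smooth_on_form smooth_on_F smooth_g smooth_on_ddir smooth_F open_U)

sublocale ind: metric_patch U h
proof
  show "transpose (h z) = h z" if "z \<in> U" for z
    using form_g_sym[OF F_in[OF that]] by (simp add: transpose_def induced_metric_def vec_eq_iff)
qed (auto intro: open_U smooth_h induced_inv)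

sublocale ind: metric_map U h U "\<lambda>z. z"
  by unfold_locales (auto intro: open_U smooth_on_linear bounded_linear_ident)

lemma dF_inj: "z \<in> U \<Longrightarrow> ddir F z u = ddir F z v \<Longrightarrow> u = v"
  by (rule ind.g_nondegenerate[of z]) (simp_all add: form_h)

text \<open>The normal vector is not null, so it is not tangent. By the dimension count the tangent space and
  the normal line span the ambient space, and its metric is nondegenerate.\<close>
lemma tangent_normal_eqI:
  assumes z: "z \<in> U" and tan: "\<And>x. form (g (F z)) v (ddir F z x) = form (g (F z)) w (ddir F z x)"
    and nor: "form (g (F z)) v (\<xi> z) = form (g (F z)) w (\<xi> z)"
  shows "v = w"
proof -
  have lin: "linear (ddir F z)" by (rule linear_dF[OF z])
  have inj: "inj (ddir F z)" using dF_inj[OF z] by (auto intro: injI)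
  have sub: "subspace (range (ddir F z))" by (rule linear_subspace_image[OF lin subspace_UNIV])
  have "dim (range (ddir F z)) = CARD('m)"
    using dim_image_eq[OF lin, of UNIV] inj by (simp add: dim_UNIV)
  moreover have "\<xi> z \<notin> span (range (ddir F z))"
  proof
    assume "\<xi> z \<in> span (range (ddir F z))"
    then obtain u where "\<xi> z = ddir F z u" using sub by (metis imageE span_eq_iff)
    then have "form (g (F z)) (\<xi> z) (\<xi> z) = 0" using \<xi>_normal[OF z, of u] by simp
    then show False using \<xi>_unit[OF z] \<epsilon>_sq by simp
  qed
  ultimately have "dim (insert (\<xi> z) (range (ddir F z))) = DIM(real^'n)"
    by (simp add: dim_insert codim)
  then have full: "span (insert (\<xi> z) (range (ddir F z))) = UNIV" using dim_eq_full[of "insert (\<xi> z) (range (ddir F z))"] by (simp only:)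
  have "form (g (F z)) (v - w) y = 0" if "y \<in> span (insert (\<xi> z) (range (ddir F z)))" for y
    using that
  proof (induction rule: span_induct_alt)
    case (step r x y)
    have "form (g (F z)) (v - w) x = 0"
      using step.hyps tan nor by (auto simp: form_simps)
    then show ?case using step.IH by (simp add: form_simps)
  qed (simp add: form_simps)
  then have "form (g (F z)) v y = form (g (F z)) w y" for y
    unfolding full by (simp add: form_simps)
  then show ?thesis by (rule g_nondegenerate[OF F_in[OF z]])
qed

lemma normal_tangent: "z \<in> U \<Longrightarrow> form (g (F z)) (ddir F z u) (\<xi> z) = 0"
  using \<xi>_normal form_g_sym[OF F_in] by metis

lemma diff_dF: "z \<in> U \<Longrightarrow> (\<lambda>x. ddir F x w) differentiable (at z)"
  by (rule smooth_on_differentiable[OF smooth_on_ddir[OF smooth_F]])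

lemma diff_\<xi>: "z \<in> U \<Longrightarrow> \<xi> differentiable (at z)"
  by (rule smooth_on_differentiable[OF smooth_\<xi>])

text \<open>The left-hand side is symmetric in \<open>u\<close> and \<open>v\<close>, and the derivatives of the induced metric are
  sums of such terms. Solving for one of them gives the Koszul formula of the induced metric.\<close>
lemma gauss_tangential:
  assumes z: "z \<in> U"
  shows "form (g (F z)) (D (\<lambda>x. ddir F x v) z u) (ddir F z w) = form (h z) (ind.\<Gamma> z u v) w"
proof -
  define k where "k u v w = form (g (F z)) (D (\<lambda>x. ddir F x v) z u) (ddir F z w)" for u v w
  have ks: "k u v w = k v u w" for u v w unfolding k_def using cov_torsion_free[OF z] by metis
  have "form (ddir h z u) v w = k u v w + k u w v" for u v w
  proof -
    have "form (ddir h z u) v w = ddir (\<lambda>x. form (h x) v w) z u" using ind.ddir_g_const[OF z] by simp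
    also have "\<dots> = ddir (\<lambda>x. form (g (F x)) (ddir F x v) (ddir F x w)) z u"
      by (rule ddir_cong[OF open_U z]) (rule form_h)
    also have "\<dots> = k u v w + k u w v"
      unfolding cov_metric[OF z diff_dF[OF z] diff_dF[OF z]] k_def
      using form_g_sym[OF F_in[OF z], of "ddir F z v"] by simp
    finally show ?thesis .
  qed
  then have "form (h z) (ind.\<Gamma> z u v) w = k u v w"
    using ks[of v u w] ks[of w u v] ks[of w v u] by (simp add: ind.koszul[OF z])
  then show ?thesis by (simp add: k_def)
qed

text \<open>Differentiate \<open>\<langle>dF v, \<xi>\<rangle> = 0\<close> and use the Weingarten formula.\<close>
lemma gauss_normal:
  assumes z: "z \<in> U"
  shows "form (g (F z)) (D (\<lambda>x. ddir F x v) z u) (\<xi> z) = form (h z) (A z *v u) v"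
proof -
  have "ddir (\<lambda>x. form (g (F x)) (ddir F x v) (\<xi> x)) z u = ddir (\<lambda>x. 0) z u"
    by (rule ddir_cong[OF open_U z]) (rule normal_tangent)
  then have "form (g (F z)) (D (\<lambda>x. ddir F x v) z u) (\<xi> z) + form (g (F z)) (ddir F z v) (D \<xi> z u) = 0"
    using cov_metric[OF z diff_dF[OF z] diff_\<xi>[OF z], of v u] by simp
  then show ?thesis
    by (simp add: weingarten[OF z] form_simps form_h[OF z] form_g_sym[OF F_in[OF z], of "ddir F z v"])
qed

lemma A_selfadjoint: "z \<in> U \<Longrightarrow> form (h z) (A z *v u) v = form (h z) u (A z *v v)"
  using gauss_normal[of z v u] gauss_normal[of z u v] cov_torsion_free[of z u v]
    ind.form_g_sym[of z "A z *v v" u] by simp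

lemma gauss_formula_const:
  assumes z: "z \<in> U"
  shows "D (\<lambda>x. ddir F x v) z u = ddir F z (ind.\<Gamma> z u v) + (\<epsilon> * form (h z) (A z *v u) v) *\<^sub>R \<xi> z"
proof (rule tangent_normal_eqI[OF z])
  fix x
  show "form (g (F z)) (D (\<lambda>x. ddir F x v) z u) (ddir F z x) =
     form (g (F z)) (ddir F z (ind.\<Gamma> z u v) + (\<epsilon> * form (h z) (A z *v u) v) *\<^sub>R \<xi> z) (ddir F z x)"
    by (simp add: gauss_tangential[OF z] form_simps \<xi>_normal[OF z] form_h[OF z])
  show "form (g (F z)) (D (\<lambda>x. ddir F x v) z u) (\<xi> z) =
     form (g (F z)) (ddir F z (ind.\<Gamma> z u v) + (\<epsilon> * form (h z) (A z *v u) v) *\<^sub>R \<xi> z) (\<xi> z)"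
    using \<epsilon>_sq by (simp add: gauss_normal[OF z] form_simps normal_tangent[OF z] \<xi>_unit[OF z])
qed

lemma gauss_formula:
  assumes z: "z \<in> U" and W: "W differentiable (at z)"
  shows "D (\<lambda>x. ddir F x (W x)) z u
     = ddir F z (cov h W z u) + (\<epsilon> * form (h z) (A z *v u) (W z)) *\<^sub>R \<xi> z"
proof -
  have "ddir (\<lambda>x. ddir F x (W x)) z u = ddir (\<lambda>x. ddir F x (W z)) z u + ddir F z (ddir W z u)"
    by (rule ddir_linear_apply(1)[OF open_U z linear_dF diff_dF[OF z] W])
  then have "D (\<lambda>x. ddir F x (W x)) z u = D (\<lambda>x. ddir F x (W z)) z u + ddir F z (ddir W z u)"
    by (simp add: cov_along_def)
  also note gauss_formula_const[OF z]
  finally show ?thesis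
    by (simp add: cov_along_def linear_add[OF linear_dF[OF z]])
qed

text \<open>The Weingarten formula determines \<open>h ** A\<close> by smooth data, and \<open>h\<close> is invertible.\<close>
lemma smooth_A: "smooth_on U A"
proof -
  define B where "B z = (\<chi> i j. form (g (F z)) (ddir F z (axis i 1)) (- D \<xi> z (axis j 1)))" for z
  have "smooth_on U (\<lambda>z. matrix_inv (h z) ** B z)"
    unfolding B_def
    by (intro smooth_on_mm open_U smooth_on_matrix_inv smooth_h induced_inv smooth_on_vec_lambda smooth_on_form
        smooth_on_F smooth_g smooth_on_ddir smooth_F smooth_on_minus smooth_on_cov smooth_\<xi>)
  moreover have "matrix_inv (h z) ** B z = A z" if z: "z \<in> U" for z
  proof -
    have "B z $ i $ j = (h z ** A z) $ i $ j" for i j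
    proof -
      have "B z $ i $ j = form (h z) (axis i 1) (A z *v axis j 1)"
        by (simp add: B_def weingarten[OF z] form_h[OF z])
      also have "\<dots> = (h z ** A z) $ i $ j"
        by (simp add: form_def inner_axis' mv_mult[symmetric]) (simp add: matrix_vector_mul_component inner_axis)
      finally show ?thesis .
    qed
    then have "B z = h z ** A z" by (simp add: vec_eq_iff)
    then show ?thesis by (simp add: matrix_mul_assoc matrix_inv_left_mult[OF induced_inv[OF z]])
  qed
  ultimately show ?thesis by (rule smooth_on_cong[OF open_U, rotated])
qed

lemma smooth_Av: "smooth_on U (\<lambda>x. A x *v v)"
  by (intro smooth_on_mv smooth_A smooth_on_const open_U)

lemma diff_A: "z \<in> U \<Longrightarrow> A differentiable (at z)"
  by (rule smooth_on_differentiable[OF smooth_A])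

lemma cov_Av:
  assumes z: "z \<in> U" and W: "W differentiable (at z)"
  shows "cov h (\<lambda>x. A x *v W x) z u = ind.nab A z u *v W z + A z *v cov h W z u"
proof -
  show ?thesis
    using ddir_bilinear[OF bounded_bilinear_mv diff_A[OF z] W, of u]
    by (simp add: cov_along_def ind.nab_apply[OF z] mv_simps)
qed

text \<open>In a space of constant curvature the curvature operator of two tangent vectors annihilates the
  normal vector. The equation is the tangential part of this, with \<open>D \<xi>\<close> given by the Weingarten
  formula.\<close>
lemma codazzi:
  assumes z: "z \<in> U"
  shows "ind.nab A z u *v v = ind.nab A z v *v u"
proof -
  have dAv: "(\<lambda>x. A x *v v) differentiable (at z)" for v
    by (rule smooth_on_differentiable[OF smooth_Av z])
  have *: "form (g (F z)) (D (\<lambda>x. D \<xi> x v) z u) (ddir F z x) = - form (h z) (ind.nab A z u *v v + A z *v ind.\<Gamma> z u v) x"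
    for u v x
  proof -
    have "D (\<lambda>x. D \<xi> x v) z u = D (\<lambda>x. - ddir F x (A x *v v)) z u"
      by (rule cov_cong[OF z]) (rule weingarten)
    also have "\<dots> = - D (\<lambda>x. ddir F x (A x *v v)) z u"
      by (rule cov_minus[OF z smooth_on_differentiable[OF smooth_on_dF_apply[OF smooth_Av] z]])
    also have "D (\<lambda>x. ddir F x (A x *v v)) z u = ddir F z (ind.nab A z u *v v + A z *v ind.\<Gamma> z u v)
        + (\<epsilon> * form (h z) (A z *v u) (A z *v v)) *\<^sub>R \<xi> z"
      unfolding gauss_formula[OF z dAv] using cov_Av[OF z, of "\<lambda>_. v" u] by (simp add: cov_along_def)
    finally show ?thesis unfolding form_h[OF z] by (simp add: form_simps \<xi>_normal[OF z])
  qed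
  have "D (\<lambda>x. D \<xi> x v) z u - D (\<lambda>x. D \<xi> x u) z v = 0"
    using cov_commutator[OF z smooth_\<xi>, of v u] by (simp add: const_curv[OF F_in[OF z]] normal_tangent[OF z])
  then have "form (g (F z)) (D (\<lambda>x. D \<xi> x v) z u) (ddir F z x) = form (g (F z)) (D (\<lambda>x. D \<xi> x u) z v) (ddir F z x)" for x
    by simp
  then have "ind.nab A z u *v v + A z *v ind.\<Gamma> z u v = ind.nab A z v *v u + A z *v ind.\<Gamma> z v u"
    by (intro ind.g_nondegenerate[OF z]) (simp add: *)
  then show ?thesis using ind.\<Gamma>_sym[OF z, of u v] by simp
qed

text \<open>Tangential part of the ambient curvature applied to \<open>dF w\<close>; the quadratic term in \<open>A\<close> comes from
  differentiating the normal component of the first derivative.\<close>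
lemma gauss_equation:
  assumes z: "z \<in> U"
  shows "ind.R z u v w = c *\<^sub>R (form (h z) v w *\<^sub>R u - form (h z) u w *\<^sub>R v)
    + \<epsilon> *\<^sub>R (form (h z) (A z *v v) w *\<^sub>R (A z *v u) - form (h z) (A z *v u) w *\<^sub>R (A z *v v))"
proof -
  have *: "form (g (F z)) (D (\<lambda>x. D (\<lambda>x. ddir F x w) x v) z u) (ddir F z x)
    = form (h z) (cov h (\<lambda>x. cov h (\<lambda>_. w) x v) z u) x - \<epsilon> * form (h z) (A z *v v) w * form (h z) (A z *v u) x"
    for u v x
  proof -
    define \<phi> where "\<phi> x = \<epsilon> * form (h x) (A x *v v) w" for x
    have s\<phi>: "smooth_on U \<phi>" unfolding \<phi>_def
      by (intro smooth_on_mult smooth_on_const smooth_on_form smooth_h smooth_Av open_U)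
    have c: "cov h (\<lambda>_. w) x v = ind.\<Gamma> x v w" for x by (simp add: cov_along_def)
    have sG: "smooth_on U (\<lambda>x. ind.\<Gamma> x v w)" by (rule ind.smooth_\<Gamma>)
    have "D (\<lambda>x. D (\<lambda>x. ddir F x w) x v) z u = D (\<lambda>x. ddir F x (ind.\<Gamma> x v w) + \<phi> x *\<^sub>R \<xi> x) z u"
      unfolding \<phi>_def by (rule cov_cong[OF z]) (rule gauss_formula_const)
    also have "\<dots> = D (\<lambda>x. ddir F x (ind.\<Gamma> x v w)) z u + D (\<lambda>x. \<phi> x *\<^sub>R \<xi> x) z u"
      by (intro cov_add z smooth_on_differentiable[OF _ z] smooth_on_dF_apply sG smooth_on_scaleR s\<phi> smooth_\<xi> open_U)
    also have "D (\<lambda>x. \<phi> x *\<^sub>R \<xi> x) z u = \<phi> z *\<^sub>R D \<xi> z u + ddir \<phi> z u *\<^sub>R \<xi> z"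
      by (rule cov_scale[OF z diff_\<xi>[OF z] smooth_on_differentiable[OF s\<phi> z]])
    also have "D (\<lambda>x. ddir F x (ind.\<Gamma> x v w)) z u = ddir F z (cov h (\<lambda>x. ind.\<Gamma> x v w) z u)
      + (\<epsilon> * form (h z) (A z *v u) (ind.\<Gamma> z v w)) *\<^sub>R \<xi> z"
      by (rule gauss_formula[OF z smooth_on_differentiable[OF sG z]])
    finally show ?thesis
      by (simp add: form_simps \<xi>_normal[OF z] form_h[OF z] weingarten[OF z] c \<phi>_def)
  qed
  show ?thesis
  proof (rule ind.g_nondegenerate[OF z])
    fix x
    have "form (g (F z)) (D (\<lambda>x. D (\<lambda>x. ddir F x w) x v) z u) (ddir F z x)
        - form (g (F z)) (D (\<lambda>x. D (\<lambda>x. ddir F x w) x u) z v) (ddir F z x)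
        = form (g (F z)) (curvature g (F z) (ddir F z u) (ddir F z v) (ddir F z w)) (ddir F z x)"
      using cov_commutator[OF z smooth_on_ddir[OF smooth_F], of w v u] by (simp add: form_simps[symmetric])
    also have "\<dots> = c * (form (h z) v w * form (h z) u x - form (h z) u w * form (h z) v x)"
      by (simp add: const_curv[OF F_in[OF z]] form_simps form_h[OF z])
    finally show "form (h z) (ind.R z u v w) x = form (h z) (c *\<^sub>R (form (h z) v w *\<^sub>R u - form (h z) u w *\<^sub>R v)
        + \<epsilon> *\<^sub>R (form (h z) (A z *v v) w *\<^sub>R (A z *v u) - form (h z) (A z *v u) w *\<^sub>R (A z *v v))) x"
      unfolding * curvature_def by (simp add: form_simps algebra_simps)
  qed
qed

end

section \<open>The Laplacian of the mean curvature vector field\<close>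

text \<open>With the frame as columns of a matrix \<open>E\<close>, orthonormality exhibits a left inverse of \<open>E\<close>,
  which is then also a right inverse.\<close>
lemma orthonormal_basis_expansion:
  fixes B :: "real^'n^'n" and e :: "'n \<Rightarrow> real^'n"
  assumes sym: "transpose B = B" and unit: "\<And>i. form B (e i) (e i) \<in> {1, -1}"
    and orth: "\<And>i j. i \<noteq> j \<Longrightarrow> form B (e i) (e j) = 0"
  shows "(\<Sum>i\<in>UNIV. (form B (e i) (e i) * form B (e i) x) *\<^sub>R e i) = x"
    and "trace M = (\<Sum>i\<in>UNIV. form B (e i) (e i) * form B (M *v e i) (e i))"
proof -
  define s where "s i = form B (e i) (e i)" for i
  define E where "E = (\<chi> r i. e i $ r)"
  define K where "K = (\<chi> i r. s i * (B *v e i) $ r)"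
  have Kx: "(K *v x) $ i = s i * form B (e i) x" for x i
    using form_sym[OF sym, of "e i" x]
    by (simp add: K_def matrix_vector_mult_def form_def inner_vec_def sum_distrib_left mult_ac)
  have Ecol: "E *v axis i 1 = e i" for i
    by (simp add: E_def vec_eq_iff matrix_vector_mul_component inner_axis)
  have Ex: "E *v y = (\<Sum>i\<in>UNIV. y $ i *\<^sub>R e i)" for y
    by (simp add: E_def vec_eq_iff matrix_vector_mult_def mult.commute)
  have ss: "s i * s i = 1" for i using unit[of i] by (auto simp: s_def)
  have "(K ** E) *v axis j 1 = mat 1 *v axis j 1" for j
    using orth ss by (simp add: vec_eq_iff mv_mult Ecol Kx) (auto simp: axis_def s_def)
  then have "K ** E = mat 1"
    by (metis (no_types, lifting) matrix_vector_mult_basis vec_eq_iff column_def vec_lambda_beta)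
  then have EK: "E ** K = mat 1" by (simp add: matrix_left_right_inverse)
  have "x = E *v (K *v x)" by (simp add: mv_mult[symmetric] EK)
  also have "\<dots> = (\<Sum>i\<in>UNIV. (s i * form B (e i) x) *\<^sub>R e i)" by (simp add: Ex Kx)
  finally show "(\<Sum>i\<in>UNIV. (form B (e i) (e i) * form B (e i) x) *\<^sub>R e i) = x" by (simp add: s_def)
  have "trace M = trace (K ** (M ** E))"
    using trace_mul_sym[of K "M ** E"] by (simp add: matrix_mul_assoc[symmetric] EK)
  also have "\<dots> = (\<Sum>i\<in>UNIV. s i * form B (M *v e i) (e i))"
  proof -
    have "(K ** (M ** E)) $ i $ i = s i * form B (e i) (M *v e i)" for i
    proof -
      have "(K ** (M ** E)) $ i $ i = ((K ** (M ** E)) *v axis i 1) $ i"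
        by (simp add: matrix_vector_mul_component inner_axis)
      then show ?thesis by (simp add: mv_mult Ecol Kx)
    qed
    then show ?thesis by (simp add: trace_def form_sym[OF sym])
  qed
  finally show "trace M = (\<Sum>i\<in>UNIV. form B (e i) (e i) * form B (M *v e i) (e i))" by (simp add: s_def)
qed

lemma bounded_linear_trace: "bounded_linear (trace :: real^'n^'n \<Rightarrow> real)"
  unfolding linear_conv_bounded_linear[symmetric]
  by (rule linearI) (simp_all add: trace_def sum.distrib sum_distrib_left)

context metric_map
begin

lemma cov_cong_open: "open W \<Longrightarrow> z \<in> W \<Longrightarrow> (\<And>x. x \<in> W \<Longrightarrow> V x = V' x) \<Longrightarrow> D V z u = D V' z u"
  unfolding cov_along_def using ddir_cong[of W z V V'] by simp

end

context hypersurface_patch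
begin

lemma nab_A_selfadjoint:
  assumes z: "z \<in> U"
  shows "form (h z) (ind.nab A z u *v v) w = form (h z) v (ind.nab A z u *v w)"
proof -
  have dA: "(\<lambda>x. A x *v v) differentiable (at z)" for v
    by (rule smooth_on_differentiable[OF smooth_Av z])
  have c: "cov h (\<lambda>_. w) z u = ind.\<Gamma> z u w" for w by (simp add: cov_along_def)
  have cA: "cov h (\<lambda>x. A x *v v) z u = ind.nab A z u *v v + A z *v ind.\<Gamma> z u v" for v
    using cov_Av[OF z, of "\<lambda>_. v" u] by (simp add: c)
  have "ddir (\<lambda>x. form (h x) (A x *v v) w) z u = ddir (\<lambda>x. form (h x) v (A x *v w)) z u"
    by (rule ddir_cong[OF open_U z]) (rule A_selfadjoint)
  then show ?thesis
    using ind.cov_metric[OF z dA differentiable_const, of v w u] ind.cov_metric[OF z differentiable_const dA, of v w u]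
    by (simp add: cA c form_simps A_selfadjoint[OF z])
qed

lemma trace_nab_A: "z \<in> U \<Longrightarrow> trace (ind.nab A z u) = ddir (\<lambda>x. trace (A x)) z u"
  using ddir_bounded_linear[OF bounded_linear_trace diff_A, of z u] trace_mul_sym[of "ind.Gm z u" "A z"]
  by (simp add: ind.nab_def linear_add[OF bounded_linear.linear[OF bounded_linear_trace]]
      linear_diff[OF bounded_linear.linear[OF bounded_linear_trace]])

text \<open>One term of the Laplacian. The coefficient \<open>a\<close> collects the second derivatives of \<open>\<phi>\<close>, which
  only occur in the normal direction and are not computed.\<close>
lemma second_cov_normal_field:
  assumes z: "z \<in> U" and W: "open W" "z \<in> W" "W \<subseteq> U" and e: "smooth_on W e" and \<phi>: "smooth_on U \<phi>"
  shows "\<exists>a. D (\<lambda>y. D (\<lambda>x. \<phi> x *\<^sub>R \<xi> x) y (e y)) z (e z) - D (\<lambda>x. \<phi> x *\<^sub>R \<xi> x) z (cov h e z (e z))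
    = - ddir F z ((2 * ddir \<phi> z (e z)) *\<^sub>R (A z *v e z) + \<phi> z *\<^sub>R (ind.nab A z (e z) *v e z))
      + (a - \<epsilon> * \<phi> z * form (h z) (A z *v e z) (A z *v e z)) *\<^sub>R \<xi> z
    \<and> ((\<forall>y\<in>U. \<forall>u. ddir \<phi> y u = 0) \<longrightarrow> a = 0)"
proof -
  have d\<phi>: "\<phi> differentiable (at y)" if "y \<in> U" for y by (rule smooth_on_differentiable[OF \<phi> that])
  have de: "e differentiable (at z)" by (rule smooth_on_differentiable[OF e W(2)])
  define \<alpha> where "\<alpha> y = ddir \<phi> y (e y)" for y
  define \<beta> where "\<beta> y = ddir F y (A y *v e y)" for y
  have DV: "D (\<lambda>x. \<phi> x *\<^sub>R \<xi> x) y u = ddir \<phi> y u *\<^sub>R \<xi> y + (- \<phi> y) *\<^sub>R ddir F y (A y *v u)" if "y \<in> U" for y u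
    by (simp add: cov_scale[OF that diff_\<xi>[OF that] d\<phi>[OF that]] weingarten[OF that])
  have d\<alpha>: "\<alpha> differentiable (at z)"
    unfolding \<alpha>_def
    by (rule ddir_linear_apply(2)[OF open_U z ddir_linear[OF d\<phi>] _ de])
      (auto intro: smooth_on_differentiable[OF smooth_on_ddir[OF \<phi>] z])
  have dAe: "(\<lambda>x. A x *v e x) differentiable (at z)"
    by (rule smooth_on_differentiable[OF smooth_on_mv[OF W(1) smooth_on_subset[OF smooth_A W(3)] e] W(2)])
  have d\<beta>: "\<beta> differentiable (at z)"
    unfolding \<beta>_def by (rule ddir_linear_apply(2)[OF open_U z linear_dF diff_dF[OF z] dAe])
  have dm: "(\<lambda>y. - \<phi> y) differentiable (at z)" using d\<phi>[OF z] by (rule differentiable_minus)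
  have ddm: "ddir (\<lambda>y. - \<phi> y) z u = - ddir \<phi> z u" for u
    by (rule ddir_bounded_linear[OF _ d\<phi>[OF z]]) (rule bounded_linear_minus[OF bounded_linear_ident])
  have dsc: "(\<lambda>y. f y *\<^sub>R V y) differentiable (at z)" if "f differentiable (at z)" "V differentiable (at z)"
    for f :: "real^'m \<Rightarrow> real" and V :: "real^'m \<Rightarrow> real^'n"
    using that bounded_bilinear.FDERIV[OF bounded_bilinear_scaleR] unfolding differentiable_def by blast
  have "D (\<lambda>y. D (\<lambda>x. \<phi> x *\<^sub>R \<xi> x) y (e y)) z (e z) = D (\<lambda>y. \<alpha> y *\<^sub>R \<xi> y + (- \<phi> y) *\<^sub>R \<beta> y) z (e z)"
    unfolding \<alpha>_def \<beta>_def by (rule cov_cong_open[OF W(1,2)], rule DV, rule subsetD[OF W(3)])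
  also have "\<dots> = D (\<lambda>y. \<alpha> y *\<^sub>R \<xi> y) z (e z) + D (\<lambda>y. (- \<phi> y) *\<^sub>R \<beta> y) z (e z)"
    by (rule cov_add[OF z dsc[OF d\<alpha> diff_\<xi>[OF z]] dsc[OF dm d\<beta>]])
  also have "D (\<lambda>y. \<alpha> y *\<^sub>R \<xi> y) z (e z) = \<alpha> z *\<^sub>R D \<xi> z (e z) + ddir \<alpha> z (e z) *\<^sub>R \<xi> z"
    by (rule cov_scale[OF z diff_\<xi>[OF z] d\<alpha>])
  also have "D (\<lambda>y. (- \<phi> y) *\<^sub>R \<beta> y) z (e z) = (- \<phi> z) *\<^sub>R D \<beta> z (e z) + ddir (\<lambda>y. - \<phi> y) z (e z) *\<^sub>R \<beta> z"
    by (rule cov_scale[OF z d\<beta> dm])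
  also have "D \<beta> z (e z) = ddir F z (ind.nab A z (e z) *v e z + A z *v cov h e z (e z))
      + (\<epsilon> * form (h z) (A z *v e z) (A z *v e z)) *\<^sub>R \<xi> z"
    unfolding \<beta>_def gauss_formula[OF z dAe] cov_Av[OF z de] ..
  finally have D2: "D (\<lambda>y. D (\<lambda>x. \<phi> x *\<^sub>R \<xi> x) y (e y)) z (e z) = \<alpha> z *\<^sub>R D \<xi> z (e z) + ddir \<alpha> z (e z) *\<^sub>R \<xi> z
      + ((- \<phi> z) *\<^sub>R (ddir F z (ind.nab A z (e z) *v e z + A z *v cov h e z (e z))
      + (\<epsilon> * form (h z) (A z *v e z) (A z *v e z)) *\<^sub>R \<xi> z) + ddir (\<lambda>y. - \<phi> y) z (e z) *\<^sub>R \<beta> z)" .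
  have collect: "p *\<^sub>R - X + q *\<^sub>R N + ((- f) *\<^sub>R (Y + Z + (\<epsilon> * t) *\<^sub>R N) + (- p) *\<^sub>R X) - (r *\<^sub>R N + (- f) *\<^sub>R Z)
    = - ((2 * p) *\<^sub>R X + f *\<^sub>R Y) + ((q - r) - \<epsilon> * f * t) *\<^sub>R N" for p q r f t and X Y Z N :: "real^'n"
    by (simp add: vec_eq_iff algebra_simps)
  have *: "D (\<lambda>y. D (\<lambda>x. \<phi> x *\<^sub>R \<xi> x) y (e y)) z (e z) - D (\<lambda>x. \<phi> x *\<^sub>R \<xi> x) z (cov h e z (e z))
    = - ddir F z ((2 * ddir \<phi> z (e z)) *\<^sub>R (A z *v e z) + \<phi> z *\<^sub>R (ind.nab A z (e z) *v e z))
      + ((ddir \<alpha> z (e z) - ddir \<phi> z (cov h e z (e z))) - \<epsilon> * \<phi> z * form (h z) (A z *v e z) (A z *v e z)) *\<^sub>R \<xi> z"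
    unfolding D2 DV[OF z] weingarten[OF z] ddm \<alpha>_def[of z] \<beta>_def linear_add[OF linear_dF[OF z]]
      linear_scale[OF linear_dF[OF z]] by (rule collect)
  have a0: "ddir \<alpha> z (e z) - ddir \<phi> z (cov h e z (e z)) = 0" if "\<forall>y\<in>U. \<forall>u. ddir \<phi> y u = 0"
  proof -
    have "ddir \<alpha> z (e z) = ddir (\<lambda>_. 0) z (e z)"
      by (rule ddir_cong[OF open_U z]) (simp add: \<alpha>_def that)
    then show ?thesis using that z by simp
  qed
  show ?thesis
    by (rule exI, rule conjI, rule *, rule impI, rule a0)
qed

text \<open>Tangential and normal components of the Laplacian of \<open>\<phi> \<xi>\<close>. In the tangential one the
  divergence of \<open>A\<close> appears, which the Codazzi equation turns into the gradient of the trace.\<close>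
lemma laplacian_normal_field:
  assumes z: "z \<in> U" and \<phi>: "smooth_on U \<phi>" and lap: "has_laplacian g F (\<lambda>x. \<phi> x *\<^sub>R \<xi> x) z w"
  shows "form (g (F z)) w (ddir F z x) = 2 * ddir \<phi> z (A z *v x) + \<phi> z * ddir (\<lambda>x. trace (A x)) z x"
    and "(\<And>y u. y \<in> U \<Longrightarrow> ddir \<phi> y u = 0) \<Longrightarrow> form (g (F z)) w (\<xi> z) = \<phi> z * trace (A z ** A z)"
proof -
  obtain W0 e where W0: "open W0" "z \<in> W0" and fr0: "orthonormal_frame_on h W0 e"
    and w: "w = - (\<Sum>i\<in>UNIV. form (h z) (e i z) (e i z) *\<^sub>R
               (D (\<lambda>y. D (\<lambda>x. \<phi> x *\<^sub>R \<xi> x) y (e i y)) z (e i z)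
                - D (\<lambda>x. \<phi> x *\<^sub>R \<xi> x) z (cov h (e i) z (e i z))))"
    using lap unfolding has_laplacian_def by blast
  define W where "W = W0 \<inter> U"
  have W: "open W" "z \<in> W" "W \<subseteq> U" using W0 z open_U by (auto simp: W_def)
  have se: "smooth_on W (e i)" for i
    using fr0 smooth_on_subset[of W0 "e i" W] by (auto simp: orthonormal_frame_on_def W_def)
  have unit: "form (h z) (e i z) (e i z) \<in> {1, -1}" and orth: "i \<noteq> j \<Longrightarrow> form (h z) (e i z) (e j z) = 0" for i j
    using fr0 W0(2) by (auto simp: orthonormal_frame_on_def)
  have basis: "(\<Sum>i\<in>UNIV. (form (h z) (e i z) (e i z) * form (h z) (e i z) x) *\<^sub>R e i z) = x"
    "trace M = (\<Sum>i\<in>UNIV. form (h z) (e i z) (e i z) * form (h z) (M *v e i z) (e i z))" for x M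
    using orthonormal_basis_expansion[OF ind.g_sym[OF z], of "\<lambda>i. e i z"] unit orth by simp_all
  define s where "s i = form (h z) (e i z) (e i z)" for i
  define L where "L i = D (\<lambda>y. D (\<lambda>x. \<phi> x *\<^sub>R \<xi> x) y (e i y)) z (e i z)
    - D (\<lambda>x. \<phi> x *\<^sub>R \<xi> x) z (cov h (e i) z (e i z))" for i
  define T where "T i = - ddir F z ((2 * ddir \<phi> z (e i z)) *\<^sub>R (A z *v e i z) + \<phi> z *\<^sub>R (ind.nab A z (e i z) *v e i z))" for i
  have "\<forall>i. \<exists>a. L i = T i + (a - \<epsilon> * \<phi> z * form (h z) (A z *v e i z) (A z *v e i z)) *\<^sub>R \<xi> z
      \<and> ((\<forall>y\<in>U. \<forall>u. ddir \<phi> y u = 0) \<longrightarrow> a = 0)"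
    unfolding L_def T_def by (rule allI, rule second_cov_normal_field[OF z W se \<phi>])
  from choice[OF this] obtain a where
    "\<forall>i. L i = T i + (a i - \<epsilon> * \<phi> z * form (h z) (A z *v e i z) (A z *v e i z)) *\<^sub>R \<xi> z
      \<and> ((\<forall>y\<in>U. \<forall>u. ddir \<phi> y u = 0) \<longrightarrow> a i = 0)" ..
  note a = this[THEN spec, THEN conjunct1, unfolded L_def T_def] this[THEN spec, THEN conjunct2]
  have fsum: "form B (sum f I) y = (\<Sum>i\<in>I. form B (f i) y)" for B y and f :: "'m \<Rightarrow> real^'n" and I
    by (induction I rule: infinite_finite_induct) (auto simp: form_simps)
  have lin\<phi>: "linear (ddir \<phi> z)" by (rule ddir_linear[OF smooth_on_differentiable[OF \<phi> z]])
  have "form (g (F z)) w (ddir F z x) = (\<Sum>i\<in>UNIV. s i * (2 * ddir \<phi> z (e i z) * form (h z) (A z *v e i z) x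
      + \<phi> z * form (h z) (ind.nab A z (e i z) *v e i z) x))"
    unfolding w fsum a(1) form_scale_left form_add_left form_minus_left \<xi>_normal[OF z] form_h[OF z, symmetric]
    by (simp add: s_def sum_negf[symmetric] algebra_simps)
  also have "\<dots> = 2 * (\<Sum>i\<in>UNIV. s i * form (h z) (e i z) (A z *v x) * ddir \<phi> z (e i z))
      + \<phi> z * (\<Sum>i\<in>UNIV. s i * form (h z) (ind.nab A z x *v e i z) (e i z))"
  proof -
    have "form (h z) (ind.nab A z (e i z) *v e i z) x = form (h z) (ind.nab A z x *v e i z) (e i z)" for i
    proof -
      have "form (h z) (ind.nab A z (e i z) *v e i z) x = form (h z) (e i z) (ind.nab A z (e i z) *v x)"
        by (rule nab_A_selfadjoint[OF z])
      then show ?thesis using codazzi[OF z, of "e i z" x] ind.form_g_sym[OF z] by simp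
    qed
    then show ?thesis
      by (simp add: A_selfadjoint[OF z] sum.distrib sum_distrib_left algebra_simps)
  qed
  also have "(\<Sum>i\<in>UNIV. s i * form (h z) (e i z) (A z *v x) * ddir \<phi> z (e i z)) = ddir \<phi> z (A z *v x)"
    unfolding s_def using arg_cong[OF basis(1)[where x="A z *v x"], of "ddir \<phi> z"]
    by (simp add: linear_sum[OF lin\<phi>] linear_scale[OF lin\<phi>])
  also have "(\<Sum>i\<in>UNIV. s i * form (h z) (ind.nab A z x *v e i z) (e i z)) = ddir (\<lambda>x. trace (A x)) z x"
    unfolding s_def basis(2)[symmetric] by (rule trace_nab_A[OF z])
  finally show "form (g (F z)) w (ddir F z x) = 2 * ddir \<phi> z (A z *v x) + \<phi> z * ddir (\<lambda>x. trace (A x)) z x" .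
  assume "\<And>y u. y \<in> U \<Longrightarrow> ddir \<phi> y u = 0"
  then have a0: "a i = 0" for i using a(2) by blast
  have "form (g (F z)) w (\<xi> z) = (\<epsilon> * \<epsilon>) * (\<phi> z * (\<Sum>i\<in>UNIV. s i * form (h z) (A z *v e i z) (A z *v e i z)))"
    unfolding w fsum a(1) form_scale_left form_add_left form_minus_left normal_tangent[OF z] \<xi>_unit[OF z] a0
    by (simp add: s_def sum_distrib_left sum_negf[symmetric] mult_ac)
  also have "(\<Sum>i\<in>UNIV. s i * form (h z) (A z *v e i z) (A z *v e i z))
      = (\<Sum>i\<in>UNIV. s i * form (h z) ((A z ** A z) *v e i z) (e i z))"
    by (simp add: mv_mult A_selfadjoint[OF z])
  also have "\<dots> = trace (A z ** A z)"
    unfolding s_def basis(2)[symmetric] ..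
  finally show "form (g (F z)) w (\<xi> z) = \<phi> z * trace (A z ** A z)" by (simp add: \<epsilon>_sq)
qed

end

section \<open>Codazzi fields that are complex structures up to a nilpotent part\<close>

text \<open>An endomorphism \<open>b\<close> of a four-dimensional space with eigenvalues \<open>\<plusminus> i\<close>, both of algebraic
  multiplicity two, and a symmetric trilinear form \<open>\<tau>\<close> that plays the role of a covariant
  derivative of \<open>b\<close>. The map \<open>q = b\<^sup>2 + 1\<close> is the obstruction to \<open>b\<close> being a complex
  structure.\<close>
locale nilpotent_complex_structure =
  fixes b q :: "real^4 \<Rightarrow> real^4" and \<tau> :: "real^4 \<Rightarrow> real^4 \<Rightarrow> real^4 \<Rightarrow> real"
  assumes lin_b: "linear b" and q_def: "q x = b (b x) + x" and qq: "q (q x) = 0"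
    and lin_\<tau>: "linear (\<lambda>x. \<tau> x y z)" "linear (\<lambda>y. \<tau> x y z)" "linear (\<lambda>z. \<tau> x y z)"
    and sym: "\<tau> x y z = \<tau> y x z" "\<tau> x y z = \<tau> x z y"
begin

lemmas b_simps = linear_add[OF lin_b] linear_scale[OF lin_b] linear_diff[OF lin_b] linear_neg[OF lin_b]
  linear_0[OF lin_b]

lemma lin_q: "linear q"
  by (rule linearI) (simp_all add: q_def b_simps algebra_simps)

lemmas q_simps = linear_add[OF lin_q] linear_scale[OF lin_q] linear_diff[OF lin_q] linear_neg[OF lin_q]
  linear_0[OF lin_q]

lemma \<tau>_simps: "\<tau> (x + x') y z = \<tau> x y z + \<tau> x' y z" "\<tau> x (y + y') z = \<tau> x y z + \<tau> x y' z"
  "\<tau> x y (z + z') = \<tau> x y z + \<tau> x y z'"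
  "\<tau> (x - x') y z = \<tau> x y z - \<tau> x' y z" "\<tau> x (y - y') z = \<tau> x y z - \<tau> x y' z"
  "\<tau> x y (z - z') = \<tau> x y z - \<tau> x y z'"
  "\<tau> (- x) y z = - \<tau> x y z" "\<tau> x (- y) z = - \<tau> x y z" "\<tau> x y (- z) = - \<tau> x y z"
  "\<tau> (r *\<^sub>R x) y z = r * \<tau> x y z" "\<tau> x (r *\<^sub>R y) z = r * \<tau> x y z" "\<tau> x y (r *\<^sub>R z) = r * \<tau> x y z"
  "\<tau> 0 y z = 0" "\<tau> x 0 z = 0" "\<tau> x y 0 = 0"
  using linear_add[OF lin_\<tau>(1)] linear_add[OF lin_\<tau>(2)] linear_add[OF lin_\<tau>(3)]
    linear_diff[OF lin_\<tau>(1)] linear_diff[OF lin_\<tau>(2)] linear_diff[OF lin_\<tau>(3)]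
    linear_neg[OF lin_\<tau>(1)] linear_neg[OF lin_\<tau>(2)] linear_neg[OF lin_\<tau>(3)]
    linear_scale[OF lin_\<tau>(1)] linear_scale[OF lin_\<tau>(2)] linear_scale[OF lin_\<tau>(3)]
    linear_0[OF lin_\<tau>(1)] linear_0[OF lin_\<tau>(2)] linear_0[OF lin_\<tau>(3)] by simp_all

lemma bq: "b (q x) = q (b x)"
  by (simp add: q_def b_simps)

lemma bbq: "b (b (q x)) = - q x"
  using qq[of x] q_def[of "q x"] by (simp add: eq_neg_iff_add_eq_0)

lemma qbq: "q (b (q x)) = 0"
  using qq[of "b x"] by (simp add: bq)

text \<open>If \<open>b\<close> is a complex structure, moving it from one argument of \<open>\<tau>\<close> to another changes the
  sign; going round three arguments gives \<open>\<tau> = - \<tau>\<close>.\<close>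
lemma form_vanishes_of_complex_structure:
  assumes b0: "\<And>x. q x = 0" and anti: "\<And>x y z. \<tau> x (b y) z = - \<tau> x y (b z)"
  shows "\<tau> x y z = 0"
proof -
  have "\<tau> (b x) y z = 0" for x
    using anti[of z x y] anti[of x y z] anti[of y x z] sym(1)[of "b x" y z] sym(2)[of y "b x" z]
      sym(1)[of y x "b z"] sym(1)[of x "b y" z]
      sym(1)[of z x "b y"] sym(2)[of x z "b y"] sym(1)[of z "b x" y] sym(2)[of "b x" z y] by linarith
  moreover have "x = b (- b x)" using b0[of x] q_def[of x] by (simp add: b_simps eq_neg_iff_add_eq_0 add.commute)
  ultimately show ?thesis by metis
qed

end

locale nondiagonal_complex_structure = nilpotent_complex_structure +
  fixes w :: "real^4"
  assumes w: "q w \<noteq> 0"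
begin

text \<open>On the image of \<open>q\<close> the map \<open>b\<close> is a complex structure.\<close>
lemma q_independent:
  assumes "r *\<^sub>R q w + s *\<^sub>R b (q w) = 0" shows "r = 0 \<and> s = 0"
proof -
  have 2: "r *\<^sub>R b (q w) - s *\<^sub>R q w = 0"
    using arg_cong[OF assms, of b] by (simp add: b_simps bbq)
  have "(r * r + s * s) *\<^sub>R q w = r *\<^sub>R (r *\<^sub>R q w + s *\<^sub>R b (q w)) - s *\<^sub>R (r *\<^sub>R b (q w) - s *\<^sub>R q w)"
    by (simp add: algebra_simps)
  then have "(r * r + s * s) *\<^sub>R q w = 0" unfolding assms 2 by simp
  then show ?thesis using w by (simp add: sum_squares_eq_zero_iff)
qed

text \<open>The vectors \<open>w\<close>, \<open>b w\<close>, \<open>q w\<close> and \<open>b (q w)\<close> form a basis: applying \<open>q\<close> to a linear relation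
  leaves one between \<open>q w\<close> and \<open>b (q w)\<close>.\<close>
lemma cyclic_expansion: "\<exists>p r s t. x = p *\<^sub>R w + r *\<^sub>R b w + s *\<^sub>R q w + t *\<^sub>R b (q w)"
proof -
  define \<phi> where "\<phi> p = p $ 1 *\<^sub>R w + p $ 2 *\<^sub>R b w + p $ 3 *\<^sub>R q w + p $ 4 *\<^sub>R b (q w)" for p :: "real^4"
  have lin: "linear \<phi>" by (rule linearI) (simp_all add: \<phi>_def algebra_simps)
  have "p = 0" if "\<phi> p = 0" for p
  proof -
    have "q (\<phi> p) = p $ 1 *\<^sub>R q w + p $ 2 *\<^sub>R b (q w)"
      by (simp add: \<phi>_def q_simps b_simps qq qbq bq[symmetric])
    then have "p $ 1 = 0 \<and> p $ 2 = 0" using q_independent that by (simp add: q_simps)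
    moreover from this have "p $ 3 = 0 \<and> p $ 4 = 0" using q_independent that by (simp add: \<phi>_def)
    ultimately show ?thesis by (simp add: vec_eq_iff forall_4)
  qed
  then have "inj \<phi>" using linear_injective_0[OF lin] by blast
  then have "surj \<phi>" by (rule linear_inj_imp_surj[OF lin])
  then obtain p where "x = \<phi> p" by blast
  then show ?thesis unfolding \<phi>_def by blast
qed

lemma range_q: "\<exists>s t. q x = s *\<^sub>R q w + t *\<^sub>R b (q w)"
proof -
  obtain p r s t where x: "x = p *\<^sub>R w + r *\<^sub>R b w + s *\<^sub>R q w + t *\<^sub>R b (q w)"
    using cyclic_expansion by blast
  have "q x = p *\<^sub>R q w + r *\<^sub>R b (q w)" unfolding x by (simp add: q_simps b_simps qq qbq bq[symmetric])
  then show ?thesis by blast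
qed

lemma kernel_q: assumes "q x = 0" shows "\<exists>y. x = q y"
proof -
  obtain p r s t where x: "x = p *\<^sub>R w + r *\<^sub>R b w + s *\<^sub>R q w + t *\<^sub>R b (q w)"
    using cyclic_expansion by blast
  have "q x = p *\<^sub>R q w + r *\<^sub>R b (q w)" unfolding x by (simp add: q_simps b_simps qq qbq bq[symmetric])
  then have "p = 0 \<and> r = 0" using q_independent assms by simp
  then have "x = q (s *\<^sub>R w + t *\<^sub>R b w)" by (simp add: x q_simps bq)
  then show ?thesis by blast
qed

text \<open>The constraint \<open>C\<close> is the derivative of \<open>q\<^sup>2 = 0\<close> when \<open>\<tau>\<close> is the derivative of \<open>b\<close>.\<close>
context
  assumes C: "\<And>x y z. \<tau> x (b (q y)) z + \<tau> x (q y) (b z) + \<tau> x (b y) (q z) + \<tau> x y (b (q z)) = 0"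
begin

abbreviation "u \<equiv> q w"
abbreviation "v \<equiv> b (q w)"

text \<open>The content of \<open>C\<close> for the last two arguments in the basis \<open>w\<close>, \<open>b w\<close>, \<open>u\<close>, \<open>v\<close>.\<close>
lemma C_basis:
  shows "\<tau> x u v = 0" "\<tau> x v v = \<tau> x u u" "\<tau> x v w = - \<tau> x u (b w)"
    "2 * \<tau> x v (b w) - 2 * \<tau> x u w + \<tau> x u u = 0"
proof -
  have bbw: "b (b w) = u - w" by (simp add: q_def)
  show "\<tau> x u v = 0"
    using C[of x w u] sym(2)[of x v u] by (simp add: qq \<tau>_simps b_simps)
  show "\<tau> x v v = \<tau> x u u"
    using C[of x w v] by (simp add: qbq \<tau>_simps b_simps bbq)
  show "\<tau> x v w = - \<tau> x u (b w)"
    using C[of x w w] sym(2)[of x "b w" u] sym(2)[of x w v] by simp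
  show "2 * \<tau> x v (b w) - 2 * \<tau> x u w + \<tau> x u u = 0"
    using C[of x w "b w"] sym(2)[of x "b w" v] sym(2)[of x w u]
    by (simp add: bq[symmetric] bbq bbw \<tau>_simps)
qed

text \<open>The relations of \<open>C_basis\<close> hold with any vector in the first argument. Taking \<open>u\<close> or \<open>v\<close> there
  and permuting the arguments gives the value on each basis vector.\<close>
lemma \<tau>_uu: "\<tau> x u u = 0"
proof -
  have u: "\<tau> u u u = 0" using C_basis(2)[of u] C_basis(1)[of v] sym(1)[of u v v] by simp
  have v: "\<tau> v u u = 0" using C_basis(1)[of u] sym(1)[of v u u] sym(2)[of u u v] by simp
  have e: "\<tau> w u u = 0"
    using C_basis(4)[of u] C_basis(1)[of "b w"] u sym(1)[of w u u] sym(2)[of u u w]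
      sym(1)[of "b w" u v] sym(2)[of u "b w" v] by simp
  have f: "\<tau> (b w) u u = 0"
    using C_basis(3)[of u] C_basis(1)[of w] sym(1)[of "b w" u u] sym(2)[of u u "b w"]
      sym(1)[of w u v] sym(2)[of u w v] by simp
  obtain p r s t where x: "x = p *\<^sub>R w + r *\<^sub>R b w + s *\<^sub>R q w + t *\<^sub>R b (q w)"
    using cyclic_expansion by blast
  show ?thesis unfolding x by (simp add: \<tau>_simps u v e f)
qed

lemma form_vanishes_on_range_q: "\<tau> (q x) (q y) z = 0"
proof -
  have *: "\<tau> u u z = 0" "\<tau> u v z = 0" "\<tau> v u z = 0" "\<tau> v v z = 0"
    using \<tau>_uu[of z] C_basis(1)[of z] C_basis(2)[of z]
      sym(1)[of z u u] sym(2)[of u z u] sym(1)[of z u v] sym(2)[of u z v] sym(1)[of v u z] sym(1)[of z v v]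
      sym(2)[of v z v] by simp_all
  obtain s t where x: "q x = s *\<^sub>R u + t *\<^sub>R v" using range_q by blast
  obtain s' t' where y: "q y = s' *\<^sub>R u + t' *\<^sub>R v" using range_q by blast
  show ?thesis unfolding x y by (simp add: \<tau>_simps *)
qed

text \<open>For a vector in the image of \<open>q\<close> only the values of \<open>\<tau>\<close> on \<open>w\<close> and \<open>b w\<close> matter, and these
  are related by \<open>C\<close>. The identity says that the derivative of \<open>b\<close> in such a direction does not mix
  the two generalized eigenspaces of \<open>b\<close>.\<close>
lemma form_anti_on_range_q: "\<tau> (q x) y z + \<tau> (q x) (b y) (b z) = 0"
proof -
  have bbw: "b (b w) = u - w" by (simp add: q_def)
  have r: "\<tau> (q x) (q y) z = 0" "\<tau> (q x) (b (q y)) z = 0" "\<tau> (q x) z (q y) = 0" "\<tau> (q x) z (b (q y)) = 0" for x y z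
    using form_vanishes_on_range_q[of x y z] form_vanishes_on_range_q[of x "b y" z]
      sym(2)[of "q x" z "q y"] sym(2)[of "q x" z "b (q y)"] by (simp_all add: bq)
  have k1: "\<tau> v w w = - \<tau> u w (b w)"
    using C_basis(3)[of w] sym(1)[of w v w] sym(1)[of w u "b w"] by simp
  have k2: "\<tau> v w (b w) = \<tau> u w w"
    using C_basis(4)[of w] \<tau>_uu[of w] sym(1)[of w v "b w"] sym(1)[of w u w] by simp
  have k3: "\<tau> v w (b w) = - \<tau> u (b w) (b w)"
    using C_basis(3)[of "b w"] sym(1)[of "b w" v w] sym(2)[of v "b w" w] sym(1)[of "b w" u "b w"] by simp
  have k4: "\<tau> v (b w) (b w) = \<tau> u w (b w)"
    using C_basis(4)[of "b w"] \<tau>_uu[of "b w"] sym(1)[of "b w" v "b w"] sym(1)[of "b w" u w] sym(2)[of u "b w" w] by simp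
  have vals: "\<tau> u (b w) (b w) = - \<tau> u w w" "\<tau> u (b w) w = \<tau> u w (b w)" "\<tau> v (b w) w = \<tau> u w w"
    using k2 k3 sym(2)[of u "b w" w] sym(2)[of v "b w" w] by simp_all
  have *: "\<tau> a y z + \<tau> a (b y) (b z) = 0" if "a = u \<or> a = v" for a
  proof -
    have zero: "\<tau> a (q y) z = 0" "\<tau> a (b (q y)) z = 0" "\<tau> a z (q y) = 0" "\<tau> a z (b (q y)) = 0" for y z
      using that r[where x=w and y=y and z=z] r[where x="b w" and y=y and z=z] by (auto simp: bq)
    obtain p r s t where y: "y = p *\<^sub>R w + r *\<^sub>R b w + s *\<^sub>R q w + t *\<^sub>R b (q w)" using cyclic_expansion by blast
    obtain p' r' s' t' where z: "z = p' *\<^sub>R w + r' *\<^sub>R b w + s' *\<^sub>R q w + t' *\<^sub>R b (q w)" using cyclic_expansion by blast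
    have "\<tau> a y z + \<tau> a (b y) (b z) = (p * p' + r * r') * (\<tau> a w w + \<tau> a (b w) (b w))
        + (p * r' - r * p') * (\<tau> a w (b w) - \<tau> a (b w) w)"
      unfolding y z by (simp add: b_simps bbq bbw \<tau>_simps zero algebra_simps)
    also have "\<dots> = 0" using that k1 k2 k4 vals by auto
    finally show ?thesis .
  qed
  obtain s t where x: "q x = s *\<^sub>R u + t *\<^sub>R v" using range_q by blast
  have "\<tau> (q x) y z + \<tau> (q x) (b y) (b z) = s * (\<tau> u y z + \<tau> u (b y) (b z)) + t * (\<tau> v y z + \<tau> v (b y) (b z))"
    unfolding x by (simp add: \<tau>_simps algebra_simps)
  then show ?thesis using *[of u] *[of v] by simp
qed

end

end

section \<open>Curvature of a Codazzi field with two conjugate constant eigenvalues\<close>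

locale codazzi_patch = metric_patch S g for S :: "(real^4) set" and g +
  fixes B :: "real^4 \<Rightarrow> real^4^4"
  assumes smooth_B: "smooth_on S B"
    and B_selfadjoint: "z \<in> S \<Longrightarrow> form (g z) (B z *v x) y = form (g z) x (B z *v y)"
    and nab_B_selfadjoint: "z \<in> S \<Longrightarrow> form (g z) (nab B z u *v x) y = form (g z) x (nab B z u *v y)"
    and codazzi_B: "z \<in> S \<Longrightarrow> nab B z u *v v = nab B z v *v u"
    and B_square: "z \<in> S \<Longrightarrow> (B z ** B z + mat 1) ** (B z ** B z + mat 1) = 0"
begin

definition "Q z = B z ** B z + mat 1"

text \<open>The semisimple part of \<open>B\<close>: this is \<open>B (1 + Q/2)\<close>, whose square is
  \<open>(Q - 1)(1 + Q/2)\<^sup>2 = - 1\<close> because \<open>Q\<^sup>2 = 0\<close>.\<close>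
definition "J z = (3/2) *\<^sub>R B z + (1/2) *\<^sub>R (B z ** (B z ** B z))"

definition "\<tau> z x y w = form (g z) (nab B z x *v y) w"

lemma diff_B: "z \<in> S \<Longrightarrow> B differentiable (at z)"
  by (rule smooth_on_differentiable[OF smooth_B])

lemma smooth_Q: "smooth_on S Q"
  unfolding Q_def by (intro smooth_on_add smooth_on_mm smooth_B smooth_on_const open_S)

lemma smooth_J: "smooth_on S J"
  unfolding J_def by (intro smooth_on_add smooth_on_cmult smooth_on_mm smooth_B open_S)

lemma nab_Q:
  assumes z: "z \<in> S" shows "nab Q z u = nab B z u ** B z + B z ** nab B z u"
proof -
  have BB: "(\<lambda>x. B x ** B x) differentiable (at z)"
    by (intro smooth_on_differentiable[OF _ z] smooth_on_mm smooth_B open_S)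
  show ?thesis
    unfolding Q_def
    using nab_add[OF z BB differentiable_const, of "mat 1" u] nab_mat[OF z, of 1 u] nab_mult[OF z diff_B[OF z] diff_B[OF z]]
    by simp
qed

lemma nab_QQ:
  assumes z: "z \<in> S" shows "nab Q z u ** Q z + Q z ** nab Q z u = 0"
proof -
  have Qd: "Q differentiable (at z)" by (rule smooth_on_differentiable[OF smooth_Q z])
  have "nab (\<lambda>x. Q x ** Q x) z u = nab (\<lambda>x. 0 *\<^sub>R mat 1) z u"
    by (rule nab_cong[OF z open_S]) (simp add: Q_def B_square)
  then show ?thesis using nab_mult[OF z Qd Qd, of u] nab_mat[OF z, of 0 u] by simp
qed

lemma nab_J:
  assumes z: "z \<in> S"
  shows "nab J z u = (3/2) *\<^sub>R nab B z u
    + (1/2) *\<^sub>R (nab B z u ** (B z ** B z) + B z ** (nab B z u ** B z + B z ** nab B z u))"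
proof -
  have d: "(\<lambda>x. B x ** B x) differentiable (at z)" "(\<lambda>x. B x ** (B x ** B x)) differentiable (at z)"
    "(\<lambda>x. (3/2) *\<^sub>R B x) differentiable (at z)" "(\<lambda>x. (1/2) *\<^sub>R (B x ** (B x ** B x))) differentiable (at z)"
    by (intro smooth_on_differentiable[OF _ z] smooth_on_mm smooth_on_cmult smooth_B open_S)+
  show ?thesis
    unfolding J_def
    by (simp add: nab_add[OF z d(3,4)] nab_scale[OF z diff_B[OF z]] nab_scale[OF z d(2)]
        nab_mult[OF z diff_B[OF z] d(1)] nab_mult[OF z diff_B[OF z] diff_B[OF z]])
qed

lemma algebra_at:
  assumes z: "z \<in> S"
  shows "nilpotent_complex_structure ((*v) (B z)) ((*v) (Q z)) (\<tau> z)"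
  unfolding nilpotent_complex_structure_def
proof (intro conjI allI)
  show "linear ((*v) (B z))" by (rule matrix_vector_mul_linear)
  show "Q z *v x = B z *v (B z *v x) + x" for x by (simp add: Q_def mv_simps)
  show "Q z *v (Q z *v x) = 0" for x using B_square[OF z] by (simp add: Q_def mv_mult[symmetric])
  note l = linear_add[OF linear_nab[OF z diff_B[OF z]]] linear_scale[OF linear_nab[OF z diff_B[OF z]]]
  show "linear (\<lambda>x. \<tau> z x y w)" for y w
    by (auto intro!: linearI simp: \<tau>_def l mv_simps form_simps)
  show "linear (\<lambda>y. \<tau> z x y w)" for x w
    by (auto intro!: linearI simp: \<tau>_def mv_simps form_simps)
  show "linear (\<lambda>w. \<tau> z x y w)" for x y
    by (auto intro!: linearI simp: \<tau>_def form_simps)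
  show "\<tau> z x y w = \<tau> z y x w" "\<tau> z x y w = \<tau> z x w y" for x y w
    using codazzi_B[OF z, of x y] nab_B_selfadjoint[OF z, of x y w] form_g_sym[OF z]
    by (simp_all add: \<tau>_def)
qed

lemma \<tau>_constraint:
  assumes z: "z \<in> S"
  shows "\<tau> z x (B z *v (Q z *v y)) w + \<tau> z x (Q z *v y) (B z *v w)
    + \<tau> z x (B z *v y) (Q z *v w) + \<tau> z x y (B z *v (Q z *v w)) = 0"
proof -
  interpret alg: nilpotent_complex_structure "(*v) (B z)" "(*v) (Q z)" "\<tau> z" by (rule algebra_at[OF z])
  have Qs: "form (g z) (Q z *v a) b = form (g z) a (Q z *v b)" for a b
    by (simp add: Q_def mv_simps form_simps B_selfadjoint[OF z])
  have "form (g z) ((nab Q z x ** Q z + Q z ** nab Q z x) *v y) w = 0"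
    by (simp add: nab_QQ[OF z] form_simps)
  then show ?thesis
    by (simp add: nab_Q[OF z] mv_simps form_simps Qs B_selfadjoint[OF z] \<tau>_def alg.bq)
qed

lemma form_nab_J:
  assumes z: "z \<in> S"
  shows "form (g z) (nab J z u *v y) w = (3 * \<tau> z u y w + \<tau> z u (B z *v (B z *v y)) w
    + \<tau> z u (B z *v y) (B z *v w) + \<tau> z u y (B z *v (B z *v w))) / 2"
  by (simp add: nab_J[OF z] mv_simps form_simps B_selfadjoint[OF z] \<tau>_def field_simps)

text \<open>In the directions of the image of \<open>Q\<close> the semisimple part is parallel. The second statement
  will make this distribution involutive, and the third holds since the kernel of \<open>Q\<close> is its
  image.\<close>
lemma nab_J_range_Q:
  assumes z: "z \<in> S" and Q: "Q z \<noteq> 0"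
  shows "nab J z (Q z *v x) = 0"
    and "nab B z (Q z *v x) *v (Q z *v y) = 0"
    and "Q z *v d = 0 \<Longrightarrow> nab J z d = 0"
proof -
  obtain w where "Q z *v w \<noteq> 0" using Q by (metis mv_eqI matrix_vector_mult_0)
  then interpret alg: nondiagonal_complex_structure "(*v) (B z)" "(*v) (Q z)" "\<tau> z" w
    using algebra_at[OF z] by (simp add: nondiagonal_complex_structure_def nondiagonal_complex_structure_axioms_def)
  note C = \<tau>_constraint[OF z]
  have bb: "B z *v (B z *v y) = Q z *v y - y" for y by (simp add: Q_def mv_simps)
  have J0: "nab J z (Q z *v x) = 0" for x
  proof (rule mv_eqI, rule g_nondegenerate[OF z])
    fix y v
    have "\<tau> z (Q z *v x) y (Q z *v v) = 0"
      using alg.form_vanishes_on_range_q[OF C, of x v y] alg.sym(2) by metis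
    then have "form (g z) (nab J z (Q z *v x) *v y) v = 0"
      using alg.form_vanishes_on_range_q[OF C, of x y v] alg.form_anti_on_range_q[OF C, of x y v]
      unfolding form_nab_J[OF z] bb by (simp add: alg.\<tau>_simps)
    then show "form (g z) (nab J z (Q z *v x) *v y) v = form (g z) (0 *v y) v"
      by (simp add: form_simps)
  qed
  show "nab J z (Q z *v x) = 0" by (rule J0)
  show "nab B z (Q z *v x) *v (Q z *v y) = 0"
    by (rule g_nondegenerate[OF z])
      (use alg.form_vanishes_on_range_q[OF C] in \<open>simp add: \<tau>_def form_simps\<close>)
  show "nab J z d = 0" if "Q z *v d = 0" using alg.kernel_q[OF that] J0 by auto
qed

lemma nab_J_zero:
  assumes Q: "\<And>z. z \<in> S \<Longrightarrow> Q z = 0" and z: "z \<in> S"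
  shows "nab J z x = 0"
proof -
  interpret alg: nilpotent_complex_structure "(*v) (B z)" "(*v) (Q z)" "\<tau> z" by (rule algebra_at[OF z])
  have "nab Q z u = nab (\<lambda>x. 0 *\<^sub>R mat 1) z u" for u
    by (rule nab_cong[OF z open_S]) (simp add: Q)
  then have "nab B z u ** B z + B z ** nab B z u = 0" for u
    using nab_Q[OF z] nab_mat[OF z, of 0] by simp
  then have "form (g z) ((nab B z u ** B z + B z ** nab B z u) *v y) w = 0" for u y w
    by (simp add: form_simps)
  then have "\<tau> z u (B z *v y) w = - \<tau> z u y (B z *v w)" for u y w
    by (simp add: \<tau>_def mv_simps form_simps B_selfadjoint[OF z] eq_neg_iff_add_eq_0)
  then have "\<tau> z x y w = 0" for x y w
    by (intro alg.form_vanishes_of_complex_structure) (simp_all add: Q[OF z])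
  then have "form (g z) (nab J z x *v y) w = form (g z) (0 *v y) w" for y w
    by (simp add: form_nab_J[OF z] form_simps)
  then show ?thesis by (intro mv_eqI g_nondegenerate[OF z])
qed

lemma R_J_of_zero:
  assumes Q: "\<And>z. z \<in> S \<Longrightarrow> Q z = 0" and z: "z \<in> S"
  shows "R z u v (J z *v w) = J z *v R z u v w"
proof -
  have "nab (\<lambda>x. nab J x v) z u = nab (\<lambda>x. 0 *\<^sub>R mat 1) z u" for u v
    by (rule nab_cong[OF z open_S]) (simp add: nab_J_zero[OF Q])
  then have "nab (\<lambda>x. nab J x v) z u = 0" for u v using nab_mat[OF z, of 0] by simp
  then show ?thesis using nab_commutator[OF z smooth_J, of v u w] by simp
qed

text \<open>The fields \<open>nab J (Q x)\<close> vanish near \<open>z\<close>. Differentiating them along the image of \<open>Q\<close>, the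
  Ricci identity leaves \<open>nab J d\<close>, where \<open>d\<close> is up to sign the Lie bracket of the fields \<open>Q x\<close> and
  \<open>Q x'\<close>. It is annihilated by \<open>Q\<close>, so this term vanishes too.\<close>
lemma R_J_of_nonzero:
  assumes z: "z \<in> S" and Q: "Q z \<noteq> 0"
  shows "R z (Q z *v x) (Q z *v x') (J z *v w) = J z *v R z (Q z *v x) (Q z *v x') w"
proof -
  define S' where "S' = {y \<in> S. Q y \<noteq> 0}"
  have "open (Q -` (- {0}) \<inter> S)"
    using smooth_on_continuous[OF smooth_Q] open_Compl[of "{0 :: real^4^4}"]
    unfolding continuous_on_open_vimage[OF open_S] by simp
  moreover have "S' = Q -` (- {0}) \<inter> S" by (auto simp: S'_def)
  ultimately have S': "open S'" "z \<in> S'" "S' \<subseteq> S" using z Q by (auto simp: S'_def)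
  have dJ: "J differentiable (at y)" if "y \<in> S" for y by (rule smooth_on_differentiable[OF smooth_J that])
  have dQ: "Q differentiable (at z)" by (rule smooth_on_differentiable[OF smooth_Q z])
  have dQx: "(\<lambda>y. Q y *v x) differentiable (at z)" for x
    by (intro smooth_on_differentiable[OF _ z] smooth_on_mv smooth_Q smooth_on_const open_S)
  have ddQ: "ddir (\<lambda>y. Q y *v x) z u = ddir Q z u *v x" for x u
    using ddir_bilinear[OF bounded_bilinear_mv dQ, of "\<lambda>_. x"] by simp
  have second: "nab (\<lambda>y. nab J y (Q z *v x)) z u = - nab J z (ddir Q z u *v x)" for x u
  proof -
    have dn: "(\<lambda>y. nab J y a) differentiable (at z)" for a
      by (rule smooth_on_differentiable[OF smooth_nab[OF smooth_J] z])
    have "ddir (\<lambda>y. nab J y (Q y *v x)) z u = ddir (\<lambda>y. nab J y (Q z *v x)) z u + nab J z (ddir (\<lambda>y. Q y *v x) z u)"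
      by (rule ddir_linear_apply(1)[OF open_S z linear_nab dn dQx]) (use dJ in auto)
    moreover have "ddir (\<lambda>y. nab J y (Q y *v x)) z u = ddir (\<lambda>y. 0) z u"
      by (rule ddir_cong[OF S'(1,2)]) (use nab_J_range_Q(1) in \<open>auto simp: S'_def\<close>)
    ultimately have "ddir (\<lambda>y. nab J y (Q z *v x)) z u = - nab J z (ddir Q z u *v x)"
      by (simp add: ddQ eq_neg_iff_add_eq_0)
    then show ?thesis
      by (subst nab_def) (simp add: nab_J_range_Q(1)[OF z Q])
  qed
  define y y' where "y = Q z *v x" and "y' = Q z *v x'"
  define d where "d = ddir Q z y' *v x - ddir Q z y *v x'"
  have dd: "ddir Q z u *v a = nab Q z u *v a - \<Gamma> z u (Q z *v a) + Q z *v \<Gamma> z u a" for u a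
    by (simp add: nab_apply[OF z])
  interpret alg: nilpotent_complex_structure "(*v) (B z)" "(*v) (Q z)" "\<tau> z" by (rule algebra_at[OF z])
  have QnQ: "Q z *v (nab Q z u *v a) = - (nab Q z u *v (Q z *v a))" for u a
  proof -
    have "(nab Q z u ** Q z + Q z ** nab Q z u) *v a = 0" by (simp add: nab_QQ[OF z])
    then show ?thesis by (simp add: mv_simps eq_neg_iff_add_eq_0 add.commute)
  qed
  have nQ: "nab Q z (Q z *v a) *v (Q z *v b) = 0" for a b
    using nab_J_range_Q(2)[OF z Q, of a b] nab_J_range_Q(2)[OF z Q, of a "B z *v b"]
    by (simp add: nab_Q[OF z] mv_simps alg.bq)
  have "Q z *v d = 0"
    using nQ[of x x'] nQ[of x' x] \<Gamma>_sym[OF z, of y y']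
    by (simp add: d_def dd mv_simps QnQ alg.qq y_def y'_def)
  then have d: "nab J z d = 0" by (rule nab_J_range_Q(3)[OF z Q])
  have "nab (\<lambda>s. nab J s y') z y - nab (\<lambda>s. nab J s y) z y' = nab J z d"
    unfolding d_def second[of x', folded y'_def] second[of x, folded y_def]
    by (simp add: linear_diff[OF linear_nab[OF z dJ[OF z]]])
  then show ?thesis
    using nab_commutator[OF z smooth_J, of y' y w] d by (simp add: y_def y'_def)
qed

text \<open>If \<open>Q\<close> vanishes identically, then \<open>J = B\<close> is parallel and every \<open>y\<close> will do. Otherwise \<open>y\<close> is
  taken in the image of \<open>Q\<close> at a point where \<open>Q\<close> does not vanish.\<close>
lemma curvature_commutes_on_plane:
  assumes "S \<noteq> {}"
  shows "\<exists>z\<in>S. \<exists>y. y \<noteq> 0 \<and> B z *v (B z *v y) = - y \<and> J z *v y = B z *v y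
    \<and> (\<forall>w. R z y (B z *v y) (J z *v w) = J z *v R z y (B z *v y) w)"
proof (cases "\<exists>z\<in>S. Q z \<noteq> 0")
  case True
  then obtain z where z: "z \<in> S" "Q z \<noteq> 0" by blast
  interpret alg: nilpotent_complex_structure "(*v) (B z)" "(*v) (Q z)" "\<tau> z" by (rule algebra_at[OF z(1)])
  obtain x where x: "Q z *v x \<noteq> 0" using z(2) by (metis mv_eqI matrix_vector_mult_0)
  define y where "y = Q z *v x"
  have By: "B z *v y = Q z *v (B z *v x)" by (simp add: y_def alg.bq)
  have BBy: "B z *v (B z *v y) = - y" by (simp add: y_def alg.bbq)
  then have "J z *v y = B z *v y"
    by (simp add: J_def mv_simps BBy scaleR_left_distrib[symmetric] scaleR_diff_left[symmetric])
  then show ?thesis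
    using R_J_of_nonzero[OF z, of x "B z *v x"] x z(1) BBy unfolding By[symmetric] y_def[symmetric] by blast
next
  case False
  then have Q: "\<And>z. z \<in> S \<Longrightarrow> Q z = 0" by blast
  obtain z where z: "z \<in> S" using assms by blast
  have BB: "B z *v (B z *v y) = - y" for y
  proof -
    have "Q z *v y = 0" using Q[OF z] by simp
    then show ?thesis by (simp add: Q_def mv_simps eq_neg_iff_add_eq_0)
  qed
  have "J z *v y = B z *v y" for y
    by (simp add: J_def mv_simps BB scaleR_left_distrib[symmetric] scaleR_diff_left[symmetric])
  moreover have "axis 1 1 \<noteq> (0::real^4)" by (simp add: axis_eq_0_iff)
  ultimately show ?thesis
    using R_J_of_zero[OF Q z] BB z by blast
qed

lemma J_square: "z \<in> S \<Longrightarrow> J z *v (B z *v y) = - y" if "B z *v (B z *v y) = - y"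
  using that by (simp add: J_def mv_simps scaleR_left_distrib[symmetric] scaleR_diff_left[symmetric])

lemma J_selfadjoint: "z \<in> S \<Longrightarrow> form (g z) (J z *v x) y = form (g z) x (J z *v y)"
  by (simp add: J_def mv_simps form_simps B_selfadjoint)

end

section \<open>Real matrices with two non-real eigenvalues\<close>

abbreviation complex_matrix :: "real^'n^'m \<Rightarrow> complex^'n^'m" where
  "complex_matrix \<equiv> map_matrix complex_of_real"

definition complex_spectrum :: "real^'n^'n \<Rightarrow> complex set" where
  "complex_spectrum M = {\<kappa>. \<exists>v. v \<noteq> 0 \<and> complex_matrix M *v v = \<kappa> *s v}"

lemma complex_matrix_mult: "complex_matrix (M ** N) = complex_matrix M ** complex_matrix N"
  by (simp add: vec_eq_iff matrix_matrix_mult_def map_matrix_def)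

lemma complex_matrix_mat1: "complex_matrix (mat 1) = mat 1"
  by (simp add: vec_eq_iff map_matrix_def mat_def)

lemma complex_spectrum_similar_subset:
  fixes M N P P' :: "real^'n^'n"
  assumes P: "P' ** P = mat 1" and MP: "M ** P = P ** N"
  shows "complex_spectrum N \<subseteq> complex_spectrum M"
proof
  fix \<kappa> assume "\<kappa> \<in> complex_spectrum N"
  then obtain v where v: "v \<noteq> 0" "complex_matrix N *v v = \<kappa> *s v" by (auto simp: complex_spectrum_def)
  define w where "w = complex_matrix P *v v"
  have "complex_matrix P' *v w = v"
    by (simp add: w_def matrix_vector_mul_assoc complex_matrix_mult[symmetric] P complex_matrix_mat1)
  then have "w \<noteq> 0" using v by auto
  moreover have "complex_matrix M *v w = \<kappa> *s w"
    unfolding w_def matrix_vector_mul_assoc complex_matrix_mult[symmetric] MP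
    by (simp add: complex_matrix_mult matrix_vector_mul_assoc[symmetric] v vector_scalar_commute)
  ultimately show "\<kappa> \<in> complex_spectrum M" by (auto simp: complex_spectrum_def)
qed

lemma complex_eigenvector_parts:
  fixes M :: "real^'n^'n"
  shows "complex_matrix M *v (\<chi> i. Complex (x $ i) (y $ i)) = Complex a b *s (\<chi> i. Complex (x $ i) (y $ i))
    \<longleftrightarrow> M *v x = a *\<^sub>R x - b *\<^sub>R y \<and> M *v y = b *\<^sub>R x + a *\<^sub>R y"
proof -
  have "(complex_matrix M *v (\<chi> i. Complex (x $ i) (y $ i))) $ i = Complex ((M *v x) $ i) ((M *v y) $ i)" for i
    by (simp add: matrix_vector_mult_def map_matrix_def complex_eq_iff)
  then show ?thesis
    by (auto simp: vec_eq_iff complex_eq_iff)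
qed

lemma real_eigenvalue_in_spectrum:
  fixes M :: "real^'n^'n"
  assumes "M *v x = a *\<^sub>R x" "x \<noteq> 0" shows "Complex a 0 \<in> complex_spectrum M"
proof -
  have "(\<chi> i. Complex (x $ i) 0) \<noteq> 0" using assms(2) by (auto simp: vec_eq_iff complex_eq_iff)
  then show ?thesis
    using complex_eigenvector_parts[of M x 0 a 0] assms(1) unfolding complex_spectrum_def by auto
qed

lemma complex_eigenvalue_plane:
  fixes M :: "real^'n^'n"
  assumes "\<kappa> \<in> complex_spectrum M"
  obtains x y where "x \<noteq> 0 \<or> y \<noteq> 0" "M *v x = Re \<kappa> *\<^sub>R x - Im \<kappa> *\<^sub>R y" "M *v y = Im \<kappa> *\<^sub>R x + Re \<kappa> *\<^sub>R y"
proof -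
  obtain v where v: "v \<noteq> 0" "complex_matrix M *v v = \<kappa> *s v" using assms by (auto simp: complex_spectrum_def)
  define x y where "x = (\<chi> i. Re (v $ i))" and "y = (\<chi> i. Im (v $ i))"
  have "v = (\<chi> i. Complex (x $ i) (y $ i))" by (simp add: x_def y_def vec_eq_iff)
  moreover from this have "x \<noteq> 0 \<or> y \<noteq> 0" using v(1) by (auto simp: vec_eq_iff complex_eq_iff)
  ultimately show ?thesis
    using that[of x y] v(2) complex_eigenvector_parts[of M x y "Re \<kappa>" "Im \<kappa>"] by simp
qed

lemma cnj_in_complex_spectrum:
  fixes M :: "real^'n^'n"
  assumes "\<kappa> \<in> complex_spectrum M" shows "cnj \<kappa> \<in> complex_spectrum M"
proof -
  obtain x y where xy: "x \<noteq> 0 \<or> y \<noteq> 0" "M *v x = Re \<kappa> *\<^sub>R x - Im \<kappa> *\<^sub>R y" "M *v y = Im \<kappa> *\<^sub>R x + Re \<kappa> *\<^sub>R y"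
    using complex_eigenvalue_plane[OF assms] .
  have "(\<chi> i. Complex (y $ i) (x $ i)) \<noteq> 0" using xy(1) by (auto simp: vec_eq_iff complex_eq_iff)
  moreover have "cnj \<kappa> = Complex (Re \<kappa>) (- Im \<kappa>)" by (simp add: complex_eq_iff)
  ultimately show ?thesis
    using complex_eigenvector_parts[of M y x "Re \<kappa>" "- Im \<kappa>"] xy unfolding complex_spectrum_def
    by (auto simp: add.commute)
qed

text \<open>The matrix of an endomorphism in a basis \<open>x\<close>, \<open>y\<close>, \<open>w\<close>, \<open>u\<close>, where \<open>x + iy\<close> is an eigenvector
  for \<open>a + ib\<close> and \<open>w\<close> is mapped to \<open>u\<close>. The lower right block is the companion matrix of
  \<open>t\<^sup>2 - l t + m\<close>.\<close>
definition block_companion :: "real \<Rightarrow> real \<Rightarrow> real \<Rightarrow> real \<Rightarrow> real \<Rightarrow> real \<Rightarrow> real^4^4" where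
  "block_companion a b p q m l = (\<chi> i j.
     if i = 1 then (if j = 1 then a else if j = 2 then b else if j = 3 then 0 else p)
     else if i = 2 then (if j = 1 then - b else if j = 2 then a else if j = 3 then 0 else q)
     else if i = 3 then (if j = 4 then - m else 0)
     else (if j = 3 then 1 else if j = 4 then l else 0))"

lemma block_companion_mult:
  fixes x :: "real^4"
  shows "(block_companion a b p q m l *v x) $ 1 = a * x $ 1 + b * x $ 2 + p * x $ 4"
    "(block_companion a b p q m l *v x) $ 2 = - b * x $ 1 + a * x $ 2 + q * x $ 4"
    "(block_companion a b p q m l *v x) $ 3 = - m * x $ 4"
    "(block_companion a b p q m l *v x) $ 4 = x $ 3 + l * x $ 4"
  by (simp_all add: block_companion_def matrix_vector_mult_def sum_4)

lemma complex_block_companion_mult: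
  fixes x :: "complex^4"
  shows "(complex_matrix (block_companion a b p q m l) *v x) $ 1 = a * x $ 1 + b * x $ 2 + p * x $ 4"
    "(complex_matrix (block_companion a b p q m l) *v x) $ 2 = - b * x $ 1 + a * x $ 2 + q * x $ 4"
    "(complex_matrix (block_companion a b p q m l) *v x) $ 3 = - m * x $ 4"
    "(complex_matrix (block_companion a b p q m l) *v x) $ 4 = x $ 3 + l * x $ 4"
  by (simp_all add: block_companion_def matrix_vector_mult_def map_matrix_def sum_4)

lemma trace_block_companion:
  "trace (block_companion a b p q m l) = 2 * a + l"
  "trace (block_companion a b p q m l ** block_companion a b p q m l) = 2 * (a\<^sup>2 - b\<^sup>2) + l\<^sup>2 - 2 * m"
  by (simp_all add: trace_def matrix_matrix_mult_def block_companion_def sum_4 power2_eq_square algebra_simps)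

text \<open>If \<open>t\<close> is not an eigenvalue of the upper left block, an eigenvector of the lower right block can
  be completed to one of the whole matrix.\<close>
lemma block_companion_root:
  fixes t :: complex
  assumes t: "t\<^sup>2 - l * t + m = 0"
  shows "t = Complex a b \<or> t = Complex a (- b) \<or> t \<in> complex_spectrum (block_companion a b p q m l)"
proof (cases "(a - t)\<^sup>2 + b\<^sup>2 = 0")
  case True
  have "(a - t)\<^sup>2 + b\<^sup>2 = (t - Complex a b) * (t - Complex a (- b))"
    by (simp add: complex_eq_iff power2_eq_square algebra_simps)
  then show ?thesis using True by auto
next
  case False
  define d where "d = (a - t)\<^sup>2 + b\<^sup>2"
  \<comment> \<open>the first two entries solve a linear system with determinant \<open>d\<close>, by Cramer's rule\<close>
  define v :: "complex^4" where "v = (\<chi> i. if i = 1 then ((t - a) * p + b * q) / d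
    else if i = 2 then (- b * p + (t - a) * q) / d else if i = 3 then t - l else 1)"
  have d: "d \<noteq> 0" using False by (simp add: d_def)
  have v: "v $ 1 = ((t - a) * p + b * q) / d" "v $ 2 = (- b * p + (t - a) * q) / d" "v $ 3 = t - l" "v $ 4 = 1"
    by (simp_all add: v_def)
  have "v \<noteq> 0" using v(4) by (metis zero_index zero_neq_one)
  have quot: "x * (y / d) + x' * (y' / d) + r = (x * y + x' * y' + r * d) / d" "x * (y / d) = (x * y) / d" for x y x' y' r
    using d by (simp_all add: add_divide_distrib)
  have 1: "a * (((t - a) * p + b * q) / d) + b * ((- b * p + (t - a) * q) / d) + p = t * (((t - a) * p + b * q) / d)"
  proof -
    have "a * ((t - a) * p + b * q) + b * (- b * p + (t - a) * q) + p * d = t * ((t - a) * p + b * q)"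
      by (simp add: d_def power2_eq_square algebra_simps)
    then show ?thesis using quot by metis
  qed
  have 2: "- b * (((t - a) * p + b * q) / d) + a * ((- b * p + (t - a) * q) / d) + q = t * ((- b * p + (t - a) * q) / d)"
  proof -
    have "- b * ((t - a) * p + b * q) + a * (- b * p + (t - a) * q) + q * d = t * (- b * p + (t - a) * q)"
      by (simp add: d_def power2_eq_square algebra_simps)
    then show ?thesis using quot by metis
  qed
  have 3: "- m = t * (t - l)" using t by (simp add: power2_eq_square algebra_simps eq_neg_iff_add_eq_0 add_eq_0_iff)
  have "complex_matrix (block_companion a b p q m l) *v v = t *s v"
    unfolding vec_eq_iff forall_4 using 1 2 3
    by (simp add: complex_block_companion_mult v)
  then show ?thesis using \<open>v \<noteq> 0\<close> by (auto simp: complex_spectrum_def)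
qed

text \<open>The real and imaginary parts \<open>x\<close>, \<open>y\<close> of an eigenvector span an invariant plane. For \<open>w\<close> outside
  this plane, \<open>u = M w\<close> is not in the span of \<open>x\<close>, \<open>y\<close>, \<open>w\<close>, because otherwise \<open>M\<close> would have a
  real eigenvalue. In the resulting basis \<open>M\<close> is a block companion matrix, and since there are no
  further eigenvalues both diagonal blocks have the characteristic polynomial \<open>(t - a)\<^sup>2 + b\<^sup>2\<close>.\<close>
theorem conjugate_eigenvalues_structure:
  fixes M :: "real^4^4"
  assumes card: "card (complex_spectrum M) = 2" and im: "\<And>\<kappa>. \<kappa> \<in> complex_spectrum M \<Longrightarrow> Im \<kappa> \<noteq> 0"
  obtains a b where "b > 0" "trace M = 4 * a" "trace (M ** M) = 4 * (a\<^sup>2 - b\<^sup>2)"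
    "((M - a *\<^sub>R mat 1) ** (M - a *\<^sub>R mat 1) + b\<^sup>2 *\<^sub>R mat 1) **
     ((M - a *\<^sub>R mat 1) ** (M - a *\<^sub>R mat 1) + b\<^sup>2 *\<^sub>R mat 1) = 0"
proof -
  have "complex_spectrum M \<noteq> {}" using card by auto
  then obtain \<kappa>0 where "\<kappa>0 \<in> complex_spectrum M" by blast
  define \<kappa> where "\<kappa> = (if Im \<kappa>0 > 0 then \<kappa>0 else cnj \<kappa>0)"
  have \<kappa>: "\<kappa> \<in> complex_spectrum M" "Im \<kappa> > 0"
    using \<open>\<kappa>0 \<in> complex_spectrum M\<close> cnj_in_complex_spectrum[of \<kappa>0 M] im[of \<kappa>0] by (auto simp: \<kappa>_def)
  define a b where "a = Re \<kappa>" and "b = Im \<kappa>"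
  have b: "b > 0" using \<kappa> by (simp add: b_def)
  have "\<kappa> \<noteq> cnj \<kappa>" using \<kappa>(2) by (simp add: complex_eq_iff)
  have spec: "complex_spectrum M = {\<kappa>, cnj \<kappa>}"
  proof (rule card_seteq[symmetric])
    show "finite (complex_spectrum M)" using card by (metis card.infinite zero_neq_numeral)
  qed (use \<kappa>(1) cnj_in_complex_spectrum \<open>\<kappa> \<noteq> cnj \<kappa>\<close> card in auto)
  have no_real: "x = 0" if "M *v x = \<mu> *\<^sub>R x" for x \<mu>
    using real_eigenvalue_in_spectrum[OF that] im[of "Complex \<mu> 0"] by auto
  obtain x y where xy: "x \<noteq> 0 \<or> y \<noteq> 0" "M *v x = a *\<^sub>R x - b *\<^sub>R y" "M *v y = b *\<^sub>R x + a *\<^sub>R y"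
    using complex_eigenvalue_plane[OF \<kappa>(1)] unfolding a_def b_def .
  have ind2: "p = 0 \<and> q = 0" if pq: "p *\<^sub>R x + q *\<^sub>R y = 0" for p q
  proof -
    have "b *\<^sub>R (q *\<^sub>R x - p *\<^sub>R y) = M *v (p *\<^sub>R x + q *\<^sub>R y) - a *\<^sub>R (p *\<^sub>R x + q *\<^sub>R y)"
      by (simp add: mv_simps xy algebra_simps)
    then have "b *\<^sub>R (q *\<^sub>R x - p *\<^sub>R y) = 0" unfolding pq by (simp add: mv_simps)
    then have qp: "q *\<^sub>R x - p *\<^sub>R y = 0" using b by simp
    have "(p * p + q * q) *\<^sub>R x = p *\<^sub>R (p *\<^sub>R x + q *\<^sub>R y) + q *\<^sub>R (q *\<^sub>R x - p *\<^sub>R y)"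
      "(p * p + q * q) *\<^sub>R y = q *\<^sub>R (p *\<^sub>R x + q *\<^sub>R y) - p *\<^sub>R (q *\<^sub>R x - p *\<^sub>R y)"
      by (simp_all add: algebra_simps)
    then have "(p * p + q * q) *\<^sub>R x = 0" "(p * p + q * q) *\<^sub>R y = 0" unfolding pq qp by simp_all
    then show ?thesis using xy(1) by (auto simp: sum_squares_eq_zero_iff)
  qed
  have "dim {x, y} \<le> card {x, y}" by (rule dim_le_card') simp
  also have "\<dots> \<le> 2" by (simp add: card_insert_if)
  finally have "span {x, y} \<noteq> UNIV" using dim_eq_full[of "{x, y}"] by auto
  then obtain w where w: "w \<notin> span {x, y}" by auto
  have w': "w \<noteq> p *\<^sub>R x + q *\<^sub>R y" for p q
    using w by (metis insertI1 insertI2 span_add span_base span_scale)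
  define u where "u = M *v w"
  define P :: "real^4^4" where "P = (\<chi> i j. if j = 1 then x $ i else if j = 2 then y $ i else if j = 3 then w $ i else u $ i)"
  have P: "P *v c = c $ 1 *\<^sub>R x + c $ 2 *\<^sub>R y + c $ 3 *\<^sub>R w + c $ 4 *\<^sub>R u" for c :: "real^4"
    by (simp add: P_def vec_eq_iff matrix_vector_mult_def sum_4 mult.commute)
  have "c = 0" if c: "P *v c = 0" for c
  proof -
    have c4: "c $ 4 = 0"
    proof (rule ccontr)
      assume n: "c $ 4 \<noteq> 0"
      define \<alpha> where "\<alpha> = - c $ 3 / c $ 4"
      define \<beta>1 where "\<beta>1 = - c $ 1 / c $ 4"
      define \<beta>2 where "\<beta>2 = - c $ 2 / c $ 4"
      have "u = (1 / c $ 4) *\<^sub>R (P *v c) + \<alpha> *\<^sub>R w + \<beta>1 *\<^sub>R x + \<beta>2 *\<^sub>R y"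
        unfolding P using n by (simp add: \<alpha>_def \<beta>1_def \<beta>2_def algebra_simps)
      then have Mw: "M *v w = \<alpha> *\<^sub>R w + \<beta>1 *\<^sub>R x + \<beta>2 *\<^sub>R y" unfolding c by (simp add: u_def)
      \<comment> \<open>a real eigenvector, found by solving a linear system whose determinant is \<open>d\<close>\<close>
      define d where "d = (a - \<alpha>)\<^sup>2 + b\<^sup>2"
      have d: "d \<noteq> 0" using b by (simp add: d_def add_nonneg_eq_0_iff)
      define s where "s = (- (a - \<alpha>) * \<beta>1 + b * \<beta>2) / d"
      define t where "t = (- b * \<beta>1 - (a - \<alpha>) * \<beta>2) / d"
      have sd: "s * d = - (a - \<alpha>) * \<beta>1 + b * \<beta>2" "t * d = - b * \<beta>1 - (a - \<alpha>) * \<beta>2"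
        using d by (simp_all add: s_def t_def)
      have "((a - \<alpha>) * s + b * t + \<beta>1) * d = (a - \<alpha>) * (s * d) + b * (t * d) + \<beta>1 * d"
        "((a - \<alpha>) * t - b * s + \<beta>2) * d = (a - \<alpha>) * (t * d) - b * (s * d) + \<beta>2 * d"
        by (simp_all add: algebra_simps)
      then have "((a - \<alpha>) * s + b * t + \<beta>1) * d = 0" "((a - \<alpha>) * t - b * s + \<beta>2) * d = 0"
        unfolding sd by (simp_all add: d_def power2_eq_square algebra_simps)
      then have st: "\<beta>1 + s * a + t * b = \<alpha> * s" "\<beta>2 - s * b + t * a = \<alpha> * t"
        using d unfolding mult_eq_0_iff by (simp_all add: algebra_simps)
      have "M *v (w + s *\<^sub>R x + t *\<^sub>R y) = \<alpha> *\<^sub>R w + (\<beta>1 + s * a + t * b) *\<^sub>R x + (\<beta>2 - s * b + t * a) *\<^sub>R y"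
        by (simp add: mv_simps Mw xy algebra_simps)
      then have "M *v (w + s *\<^sub>R x + t *\<^sub>R y) = \<alpha> *\<^sub>R (w + s *\<^sub>R x + t *\<^sub>R y)"
        unfolding st by (simp add: algebra_simps)
      then have "w + s *\<^sub>R x + t *\<^sub>R y = 0" by (rule no_real)
      moreover have "w = (w + s *\<^sub>R x + t *\<^sub>R y) + ((- s) *\<^sub>R x + (- t) *\<^sub>R y)" by simp
      ultimately have "w = (- s) *\<^sub>R x + (- t) *\<^sub>R y" by simp
      then show False using w' by blast
    qed
    have c3: "c $ 3 = 0"
    proof (rule ccontr)
      assume n: "c $ 3 \<noteq> 0"
      have "w = (1 / c $ 3) *\<^sub>R (P *v c) + (- c $ 1 / c $ 3) *\<^sub>R x + (- c $ 2 / c $ 3) *\<^sub>R y"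
        unfolding P using n c4 by (simp add: algebra_simps)
      then show False using w'[of "- c $ 1 / c $ 3" "- c $ 2 / c $ 3"] unfolding c by simp
    qed
    show ?thesis using ind2[of "c $ 1" "c $ 2"] c c3 c4 by (simp add: P vec_eq_iff forall_4)
  qed
  then obtain P' where P': "P' ** P = mat 1"
    using matrix_left_invertible_ker[of P] by blast
  then have PP': "P ** P' = mat 1" by (simp add: matrix_left_right_inverse)
  have expand: "\<exists>c::real^4. v = c $ 1 *\<^sub>R x + c $ 2 *\<^sub>R y + c $ 3 *\<^sub>R w + c $ 4 *\<^sub>R u" for v
  proof -
    have "v = P *v (P' *v v)" by (simp add: mv_mult[symmetric] PP')
    then show ?thesis unfolding P by blast
  qed
  obtain c :: "real^4" where c: "M *v u = c $ 1 *\<^sub>R x + c $ 2 *\<^sub>R y + c $ 3 *\<^sub>R w + c $ 4 *\<^sub>R u" using expand by blast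
  define p q m l where "p = c $ 1" and "q = c $ 2" and "m = - c $ 3" and "l = c $ 4"
  have Mu: "M *v u = p *\<^sub>R x + q *\<^sub>R y - m *\<^sub>R w + l *\<^sub>R u" using c by (simp add: p_def q_def m_def l_def)
  define N where "N = block_companion a b p q m l"
  have MP: "M ** P = P ** N"
    by (rule mv_eqI)
      (simp add: mv_simps P N_def block_companion_mult xy u_def[symmetric] Mu algebra_simps)
  obtain t :: complex where t: "t\<^sup>2 - l * t + m = 0"
  proof -
    define D where "D = csqrt (complex_of_real l ^ 2 - 4 * m)"
    have "D * D = complex_of_real l ^ 2 - 4 * m" unfolding D_def by (metis power2_csqrt power2_eq_square)
    moreover have "((l + D) / 2)\<^sup>2 - l * ((l + D) / 2) + m = (D * D - (complex_of_real l ^ 2 - 4 * m)) / 4"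
      by (simp add: power2_eq_square field_simps)
    ultimately have "((l + D) / 2)\<^sup>2 - l * ((l + D) / 2) + m = 0" by simp
    then show ?thesis using that by blast
  qed
  have cab: "\<kappa> = Complex a b" "cnj \<kappa> = Complex a (- b)" by (simp_all add: a_def b_def complex_eq_iff)
  have "t = Complex a b \<or> t = Complex a (- b)"
    using block_companion_root[OF t, of a b p q] complex_spectrum_similar_subset[OF P' MP] spec cab
    unfolding N_def by auto
  then have "l = 2 * a \<and> m = a\<^sup>2 + b\<^sup>2"
  proof
    assume "t = Complex a b"
    then have "a * a - b * b - l * a + m = 0" "2 * a * b - l * b = 0"
      using t by (auto simp: complex_eq_iff power2_eq_square)
    moreover from this(2) have "l = 2 * a" using b by simp
    ultimately show ?thesis by (simp add: power2_eq_square algebra_simps)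
  next
    assume "t = Complex a (- b)"
    then have "a * a - b * b - l * a + m = 0" "2 * a * b - l * b = 0"
      using t by (auto simp: complex_eq_iff power2_eq_square)
    moreover from this(2) have "l = 2 * a" using b by simp
    ultimately show ?thesis by (simp add: power2_eq_square algebra_simps)
  qed
  then have l: "l = 2 * a" and m: "m = a\<^sup>2 + b\<^sup>2" by auto
  have sim: "trace (P ** X ** P') = trace X" for X
    using trace_mul_sym[of "P ** X" P'] by (simp add: matrix_mul_assoc P')
  have M: "M = P ** N ** P'"
    using MP by (metis PP' matrix_mul_assoc matrix_mul_rid)
  have MM: "M ** M = P ** (N ** N) ** P'"
    by (metis M MP matrix_mul_assoc)
  show ?thesis
  proof (rule that[OF b])
    show "trace M = 4 * a"
      unfolding M sim N_def trace_block_companion l by simp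
    show "trace (M ** M) = 4 * (a\<^sup>2 - b\<^sup>2)"
      unfolding MM sim N_def trace_block_companion l m by (simp add: power2_eq_square)
    define X where "X = (M - a *\<^sub>R mat 1) ** (M - a *\<^sub>R mat 1) + b\<^sup>2 *\<^sub>R mat 1"
    have tw: "(2 * a) *\<^sub>R y = a *\<^sub>R y + a *\<^sub>R y" for y :: "real^4"
      by (simp add: scaleR_left_distrib[symmetric])
    have X: "X *v v = M *v (M *v v) - (2 * a) *\<^sub>R (M *v v) + m *\<^sub>R v" for v
      unfolding tw by (simp add: X_def mv_simps m power2_eq_square algebra_simps)
    \<comment> \<open>\<open>X\<close> annihilates the invariant plane and maps the whole space into it\<close>
    have Xx: "X *v x = 0" "X *v y = 0"
      unfolding X tw by (simp_all add: mv_simps xy m power2_eq_square algebra_simps)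
    have Xw: "X *v w = p *\<^sub>R x + q *\<^sub>R y"
      by (simp add: X u_def[symmetric] Mu l)
    have "X *v u = M *v (X *v w)"
      by (simp add: X mv_simps u_def)
    then have Xu: "X *v u = (p * a + q * b) *\<^sub>R x + (q * a - p * b) *\<^sub>R y"
      unfolding Xw by (simp add: mv_simps xy algebra_simps)
    show "((M - a *\<^sub>R mat 1) ** (M - a *\<^sub>R mat 1) + b\<^sup>2 *\<^sub>R mat 1) **
     ((M - a *\<^sub>R mat 1) ** (M - a *\<^sub>R mat 1) + b\<^sup>2 *\<^sub>R mat 1) = 0"
      unfolding X_def[symmetric]
    proof (rule mv_eqI)
      fix v
      obtain c :: "real^4" where v: "v = c $ 1 *\<^sub>R x + c $ 2 *\<^sub>R y + c $ 3 *\<^sub>R w + c $ 4 *\<^sub>R u" using expand by blast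
      show "(X ** X) *v v = 0 *v v"
        unfolding v by (simp add: mv_simps Xx Xw Xu)
    qed
  qed
qed

section \<open>Mean curvature on a coordinate patch\<close>

locale proper_hypersurface_patch = hypersurface_patch S g U F \<xi> A \<epsilon> c
  for S :: "(real^5) set" and g and U :: "(real^4) set" and F \<xi> A \<epsilon> c +
  fixes \<phi> :: "real^4 \<Rightarrow> real" and lam :: real
  assumes \<phi>_trace: "z \<in> U \<Longrightarrow> \<phi> z = (1 / 4) * \<epsilon> * trace (A z)"
    and laplacian: "z \<in> U \<Longrightarrow> has_laplacian g F (\<lambda>x. \<phi> x *\<^sub>R \<xi> x) z (lam *\<^sub>R (\<phi> z *\<^sub>R \<xi> z))"
    and two_curvatures: "z \<in> U \<Longrightarrow> card (complex_spectrum (A z)) = 2"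
    and imaginary_curvatures: "z \<in> U \<Longrightarrow> \<kappa> \<in> complex_spectrum (A z) \<Longrightarrow> Im \<kappa> \<noteq> 0"
begin

lemma smooth_\<phi>: "smooth_on U \<phi>"
proof -
  have "smooth_on U (\<lambda>z. (1 / 4) * \<epsilon> * trace (A z))"
    by (intro smooth_on_mult smooth_on_const smooth_on_bounded_linear[OF bounded_linear_trace] smooth_A open_U)
  then show ?thesis by (rule smooth_on_cong[OF open_U, rotated]) (simp add: \<phi>_trace)
qed

lemma trace_A: "z \<in> U \<Longrightarrow> trace (A z) = 4 * \<epsilon> * \<phi> z"
  using \<epsilon> by (auto simp: \<phi>_trace)

text \<open>By the tangential part of the Laplacian, a nonzero gradient of the mean curvature would be an
  eigenvector of \<open>A\<close> with the real eigenvalue \<open>- 2 \<epsilon> \<phi>\<close>.\<close>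
lemma ddir_\<phi>_zero:
  assumes z: "z \<in> U" shows "ddir \<phi> z u = 0"
proof -
  have d\<phi>: "\<phi> differentiable (at z)" by (rule smooth_on_differentiable[OF smooth_\<phi> z])
  have lin: "linear (ddir \<phi> z)" by (rule ddir_linear[OF d\<phi>])
  have dtr: "ddir (\<lambda>x. trace (A x)) z x = 4 * \<epsilon> * ddir \<phi> z x" for x
  proof -
    have "ddir (\<lambda>x. trace (A x)) z x = ddir (\<lambda>x. 4 * \<epsilon> * \<phi> x) z x"
      by (rule ddir_cong[OF open_U z]) (rule trace_A)
    also have "\<dots> = 4 * \<epsilon> * ddir \<phi> z x"
      by (rule ddir_bounded_linear[OF bounded_linear_mult_right d\<phi>])
    finally show ?thesis .
  qed
  have eig: "ddir \<phi> z (A z *v x) = (- 2 * \<epsilon> * \<phi> z) * ddir \<phi> z x" for x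
    using laplacian_normal_field(1)[OF z smooth_\<phi> laplacian[OF z], of x]
    by (simp add: form_simps \<xi>_normal[OF z] dtr algebra_simps)
  define p where "p = (\<chi> i. ddir \<phi> z (axis i 1))"
  define y where "y = matrix_inv (h z) *v p"
  have p: "ddir \<phi> z x = p \<bullet> x" for x
  proof -
    have "ddir \<phi> z x = ddir \<phi> z (\<Sum>i\<in>UNIV. x $ i *\<^sub>R axis i 1)"
      by (simp add: basis_expansion[of x, unfolded scalar_mult_eq_scaleR])
    then show ?thesis
      by (simp add: linear_sum[OF lin] linear_scale[OF lin] p_def inner_vec_def mult.commute)
  qed
  have "h z *v y = p"
    by (simp add: y_def mv_mult[symmetric] matrix_inv_right_mult[OF induced_inv[OF z]])
  then have y: "ddir \<phi> z x = form (h z) y x" for x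
    using ind.form_g_sym[OF z, of y x] by (simp add: p form_def inner_commute)
  have "A z *v y = (- 2 * \<epsilon> * \<phi> z) *\<^sub>R y"
  proof (rule ind.g_nondegenerate[OF z])
    fix x
    show "form (h z) (A z *v y) x = form (h z) ((- 2 * \<epsilon> * \<phi> z) *\<^sub>R y) x"
      using eig[of x] by (simp only: y A_selfadjoint[OF z] form_scale_left)
  qed
  then have "y = 0"
    using real_eigenvalue_in_spectrum imaginary_curvatures[OF z] by fastforce
  then show ?thesis by (simp add: y form_simps)
qed

lemma \<phi>_locally_constant:
  assumes "ball z r \<subseteq> U" "y \<in> ball z r" shows "\<phi> y = \<phi> z"
proof (rule has_derivative_zero_unique[of "ball z r" \<phi>])
  fix x assume x: "x \<in> ball z r"
  have "(\<phi> has_derivative ddir \<phi> x) (at x)"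
    using smooth_on_has_derivative[OF smooth_\<phi>] x assms(1) by blast
  moreover have "ddir \<phi> x = (\<lambda>h. 0)" using ddir_\<phi>_zero x assms(1) by (intro ext) blast
  ultimately show "(\<phi> has_derivative (\<lambda>h. 0)) (at x within ball z r)"
    by (simp add: has_derivative_at_withinI)
qed (use assms in \<open>auto dest: le_less_trans[OF zero_le_dist]\<close>)

text \<open>Where the mean curvature does not vanish, the two principal curvatures \<open>a \<plusminus> i b\<close> are locally
  constant, so \<open>(A - a)/b\<close> is a Codazzi field to which \<open>curvature_commutes_on_plane\<close> applies. With
  \<open>j = J y\<close>, the Gauss equation gives \<open>R(y,j)w = k (\<langle>j,w\<rangle> y - \<langle>y,w\<rangle> j)\<close> for
  \<open>k = c + \<epsilon> (a\<^sup>2 + b\<^sup>2)\<close>. This anticommutes with \<open>J\<close>, so \<open>k = 0\<close>.\<close>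
theorem principal_curvature_identities:
  assumes z: "z \<in> U" and \<phi>z: "\<phi> z \<noteq> 0"
  obtains a b where "b > 0" "\<phi> z = \<epsilon> * a" "4 * (a\<^sup>2 - b\<^sup>2) = \<epsilon> * lam" "a\<^sup>2 + b\<^sup>2 = - c * \<epsilon>"
proof -
  obtain r where r: "r > 0" "ball z r \<subseteq> U" using open_U z openE by blast
  define N where "N = ball z r"
  have N: "open N" "z \<in> N" "N \<subseteq> U" using r by (auto simp: N_def)
  have \<phi>N: "\<phi> y = \<phi> z" if "y \<in> N" for y
    using \<phi>_locally_constant[OF r(2)] that by (simp add: N_def)
  define a where "a = \<epsilon> * \<phi> z"
  \<comment> \<open>the value forced by \<open>tr A\<^sup>2 = 4 (a\<^sup>2 - b\<^sup>2)\<close> and \<open>tr A\<^sup>2 = \<epsilon> lam\<close>\<close>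
  define b where "b = sqrt (a\<^sup>2 - \<epsilon> * lam / 4)"
  define X where "X y = (A y - a *\<^sub>R mat 1) ** (A y - a *\<^sub>R mat 1) + b\<^sup>2 *\<^sub>R mat 1" for y
  have XX: "b > 0 \<and> 4 * (a\<^sup>2 - b\<^sup>2) = \<epsilon> * lam \<and> X y ** X y = 0" if y: "y \<in> N" for y
  proof -
    have yU: "y \<in> U" using y N by blast
    obtain a' b' where ab: "b' > 0" "trace (A y) = 4 * a'" "trace (A y ** A y) = 4 * (a'\<^sup>2 - b'\<^sup>2)"
      "((A y - a' *\<^sub>R mat 1) ** (A y - a' *\<^sub>R mat 1) + b'\<^sup>2 *\<^sub>R mat 1) **
       ((A y - a' *\<^sub>R mat 1) ** (A y - a' *\<^sub>R mat 1) + b'\<^sup>2 *\<^sub>R mat 1) = 0"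
      using conjugate_eigenvalues_structure[OF two_curvatures[OF yU] imaginary_curvatures[OF yU]] by metis
    have a': "a' = a" using ab(2) trace_A[OF yU] \<phi>N[OF y] by (simp add: a_def)
    have "lam * (\<phi> y * \<epsilon>) = \<phi> y * trace (A y ** A y)"
      using laplacian_normal_field(2)[OF yU smooth_\<phi> laplacian[OF yU] ddir_\<phi>_zero]
      by (simp add: form_simps \<xi>_unit[OF yU])
    then have tr: "trace (A y ** A y) = \<epsilon> * lam" using \<phi>N[OF y] \<phi>z by (simp add: mult_ac)
    have "a\<^sup>2 - \<epsilon> * lam / 4 = b'\<^sup>2" using ab(3) tr unfolding a' by (simp add: field_simps)
    then have b': "b' = b" using ab(1) by (simp add: b_def)
    show ?thesis using ab tr unfolding a' b' X_def by simp
  qed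
  have b: "b > 0" and b2: "4 * (a\<^sup>2 - b\<^sup>2) = \<epsilon> * lam" using XX[OF N(2)] by auto
  define B where "B y = (1 / b) *\<^sub>R (A y + (- a) *\<^sub>R mat 1)" for y
  have BA: "A y = a *\<^sub>R mat 1 + b *\<^sub>R B y" for y using b by (simp add: B_def)
  have nabB: "ind.nab B y u = (1 / b) *\<^sub>R ind.nab A y u" if y: "y \<in> U" for y u
  proof -
    have d: "(\<lambda>y. A y + (- a) *\<^sub>R mat 1) differentiable (at y)"
      by (intro smooth_on_differentiable[OF _ y] smooth_on_add smooth_A smooth_on_const open_U)
    show ?thesis
      unfolding B_def ind.nab_scale[OF y d] ind.nab_add[OF y diff_A[OF y] differentiable_const] ind.nab_mat[OF y]
      by simp
  qed
  interpret P: codazzi_patch N h B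
  proof
    show "open N" by (rule N)
    show "smooth_on N h" using smooth_on_subset[OF smooth_h] N by blast
    show "smooth_on N B" unfolding B_def
      by (rule smooth_on_subset[OF _ N(3)]) (intro smooth_on_cmult smooth_on_add smooth_A smooth_on_const open_U)
    fix y assume y: "y \<in> N"
    then have yU: "y \<in> U" using N by blast
    show "transpose (h y) = h y" by (rule ind.g_sym[OF yU])
    show "invertible (h y)" by (rule induced_inv[OF yU])
    show "form (h y) (B y *v u) v = form (h y) u (B y *v v)" for u v
      by (simp add: B_def mv_simps form_simps A_selfadjoint[OF yU])
    show "form (h y) (ind.nab B y w *v u) v = form (h y) u (ind.nab B y w *v v)" for u v w
      by (simp add: nabB[OF yU] mv_simps form_simps nab_A_selfadjoint[OF yU])
    show "ind.nab B y u *v v = ind.nab B y v *v u" for u v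
      by (simp add: nabB[OF yU] mv_simps codazzi[OF yU, of u v])
    have "B y ** B y + mat 1 = (1 / b\<^sup>2) *\<^sub>R X y"
      by (rule mv_eqI) (use b in \<open>simp add: B_def X_def mv_simps algebra_simps power2_eq_square\<close>)
    moreover have "((1 / b\<^sup>2) *\<^sub>R X y) ** ((1 / b\<^sup>2) *\<^sub>R X y) = 0"
    proof (rule mv_eqI)
      fix v
      have "(X y ** X y) *v v = 0" using XX[OF y] by simp
      then show "((1 / b\<^sup>2) *\<^sub>R X y ** (1 / b\<^sup>2) *\<^sub>R X y) *v v = 0 *v v" by (simp add: mv_simps)
    qed
    ultimately show "(B y ** B y + mat 1) ** (B y ** B y + mat 1) = 0" by simp
  qed
  obtain x y where x: "x \<in> N" and y: "y \<noteq> 0" "B x *v (B x *v y) = - y" "P.J x *v y = B x *v y"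
    and comm: "\<And>w. ind.R x y (B x *v y) (P.J x *v w) = P.J x *v ind.R x y (B x *v y) w"
    using P.curvature_commutes_on_plane N(2) by blast
  have xU: "x \<in> U" using x N by blast
  define j where "j = B x *v y"
  define k where "k = c + \<epsilon> * (a\<^sup>2 + b\<^sup>2)"
  have Jj: "P.J x *v j = - y" using P.J_square[OF y(2) x] by (simp add: j_def)
  have Ay: "A x *v y = a *\<^sub>R y + b *\<^sub>R j" "A x *v j = a *\<^sub>R j - b *\<^sub>R y"
    by (simp_all add: BA mv_simps j_def y(2))
  have R: "ind.R x y j w = k *\<^sub>R (form (h x) j w *\<^sub>R y - form (h x) y w *\<^sub>R j)" for w
    unfolding gauss_equation[OF xU] Ay
    by (simp add: form_simps k_def vec_eq_iff algebra_simps power2_eq_square)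
  have "\<exists>w. form (h x) y w \<noteq> 0"
    using ind.g_nondegenerate[OF xU, of y 0] y(1) by (auto simp: form_simps)
  then obtain w where w: "form (h x) y w \<noteq> 0" by blast
  define n where "n = form (h x) y w *\<^sub>R y + form (h x) j w *\<^sub>R j"
  have jJ: "form (h x) j (P.J x *v w) = - form (h x) y w"
    using P.J_selfadjoint[OF x, of j w] by (simp add: Jj form_simps)
  have yJ: "form (h x) y (P.J x *v w) = form (h x) j w"
    using P.J_selfadjoint[OF x, of y w] by (simp add: y(3) j_def)
  have "ind.R x y j (P.J x *v w) = - k *\<^sub>R n" "P.J x *v ind.R x y j w = k *\<^sub>R n"
    unfolding R jJ yJ by (simp_all add: n_def mv_simps y(3) j_def[symmetric] Jj algebra_simps)
  then have "k *\<^sub>R n = - (k *\<^sub>R n)" using comm[of w] by (simp add: j_def)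
  then have "form (h x) (k *\<^sub>R n) w = form (h x) (- (k *\<^sub>R n)) w" by (rule arg_cong)
  then have "k * form (h x) n w = 0" by (simp add: form_simps)
  moreover have "form (h x) n w > 0"
  proof -
    have "form (h x) n w = form (h x) y w * form (h x) y w + form (h x) j w * form (h x) j w"
      by (simp add: n_def form_simps)
    then show ?thesis using w by (simp add: sum_squares_gt_zero_iff)
  qed
  ultimately have "k = 0" by simp
  then have "\<epsilon> * (c + \<epsilon> * (a\<^sup>2 + b\<^sup>2)) = 0" by (simp add: k_def)
  then have "a\<^sup>2 + b\<^sup>2 = - c * \<epsilon>" using \<epsilon>_sq(1) by (simp add: algebra_simps flip: mult.assoc)
  moreover have "\<phi> z = \<epsilon> * a" using \<epsilon>_sq(1) by (simp add: a_def flip: mult.assoc)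
  ultimately show ?thesis using that b b2 by blast
qed

end

section \<open>Charts\<close>

lemma chart_inv_left: "is_chart x \<Longrightarrow> p \<in> chart_dom x \<Longrightarrow> chart_inv x (chart_map x p) = p"
  unfolding is_chart_def by (metis homeomorphism_apply1)

lemma chart_inv_right:
  "is_chart x \<Longrightarrow> z \<in> chart_map x ` chart_dom x \<Longrightarrow> chart_inv x z \<in> chart_dom x \<and> chart_map x (chart_inv x z) = z"
  using chart_inv_left by fastforce

lemma chart_open_image:
  assumes x: "is_chart x" and V: "open V" "V \<subseteq> chart_dom x"
  shows "open (chart_map x ` V)"
proof -
  have "openin (top_of_set (chart_dom x)) V" using V by (simp add: open_subset)
  then have "openin (top_of_set (chart_map x ` chart_dom x)) (chart_map x ` V)"
    using x homeomorphism_imp_open_map unfolding is_chart_def by blast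
  then show ?thesis using x unfolding is_chart_def by (meson openin_open_trans)
qed

lemma chart_open_vimage:
  assumes x: "is_chart x" and B: "open B"
  shows "open (chart_dom x \<inter> chart_map x -` B)"
proof -
  have "continuous_on (chart_dom x) (chart_map x)" "open (chart_dom x)"
    using x unfolding is_chart_def homeomorphism_def by auto
  then show ?thesis using B continuous_on_open_vimage[of "chart_dom x" "chart_map x"] by (simp add: Int_commute)
qed

text \<open>The two changes of coordinates are inverse to each other near the point, so this is the chain
  rule.\<close>
lemma jacobian_inverse:
  assumes M: "smooth_manifold \<A>" and x: "x \<in> \<A>" and x': "x' \<in> \<A>"
    and p: "p \<in> chart_dom x" "p \<in> chart_dom x'"
  shows "jacobian x' x p ** jacobian x x' p = mat 1"
proof -
  have chart: "is_chart x" "is_chart x'" using M x x' by (auto simp: smooth_manifold_def)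
  define V where "V = chart_map x ` (chart_dom x \<inter> chart_dom x')"
  define V' where "V' = chart_map x' ` (chart_dom x' \<inter> chart_dom x)"
  define t where "t = chart_map x' \<circ> chart_inv x"
  define t' where "t' = chart_map x \<circ> chart_inv x'"
  have "open (chart_dom x \<inter> chart_dom x')" using chart by (auto simp: is_chart_def)
  then have V: "open V" "chart_map x p \<in> V"
    unfolding V_def using chart_open_image[OF chart(1), of "chart_dom x \<inter> chart_dom x'"] p by auto
  have t: "smooth_on V t" and t': "smooth_on V' t'"
    using M x x' by (auto simp: smooth_manifold_def V_def V'_def t_def t'_def)
  have tp: "t (chart_map x p) = chart_map x' p" "chart_map x' p \<in> V'"
    using p chart_inv_left[OF chart(1)] by (auto simp: t_def V'_def)
  have dt: "t differentiable (at (chart_map x p))" by (rule smooth_on_differentiable[OF t V(2)])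
  have dt': "t' differentiable (at (t (chart_map x p)))"
    using smooth_on_differentiable[OF t'] tp by simp
  have "ddir (t' \<circ> t) (chart_map x p) u = u" for u
  proof -
    have "(t' \<circ> t) z = z" if "z \<in> V" for z
      using that chart_inv_left[OF chart(1)] chart_inv_left[OF chart(2)] by (auto simp: V_def t_def t'_def)
    then have "ddir (t' \<circ> t) (chart_map x p) u = ddir (\<lambda>z. z) (chart_map x p) u"
      by (intro ddir_cong[OF V])
    then show ?thesis by simp
  qed
  moreover have "ddir (t' \<circ> t) (chart_map x p) u = ddir t' (t (chart_map x p)) (ddir t (chart_map x p) u)" for u
    using frechet_derivative_compose[OF dt dt'] by simp
  ultimately have "ddir t' (chart_map x' p) (ddir t (chart_map x p) u) = u" for u by (simp add: tp)
  moreover have "jacobian x' x p *v w = ddir t' (chart_map x' p) w" "jacobian x x' p *v w = ddir t (chart_map x p) w" for w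
    unfolding jacobian_def t_def[symmetric] t'_def[symmetric]
    using matrix_works[OF linear_frechet_derivative[OF dt, folded linear_matrix_vector_mul_eq]]
      matrix_works[OF linear_frechet_derivative[OF dt', folded linear_matrix_vector_mul_eq]]
    by (simp_all add: tp)
  ultimately show ?thesis by (intro mv_eqI) (simp add: mv_simps)
qed

lemma chart_at:
  assumes "smooth_manifold \<A>" shows "chart_at \<A> p \<in> \<A>" "p \<in> chart_dom (chart_at \<A> p)"
proof -
  have "p \<in> (\<Union>x\<in>\<A>. chart_dom x)" using assms by (simp add: smooth_manifold_def)
  then have "\<exists>x. x \<in> \<A> \<and> p \<in> chart_dom x" by blast
  from someI_ex[OF this] show "chart_at \<A> p \<in> \<A>" "p \<in> chart_dom (chart_at \<A> p)"
    by (auto simp: chart_at_def)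
qed

text \<open>Mean curvature and principal curvatures are read off in one chosen chart around each point. The
  transformation law of \<open>A\<close> is a similarity by the Jacobian, so any chart can be used.\<close>
lemma trace_and_spectrum_chart_independent:
  fixes \<A> :: "('a::{t2_space,second_countable_topology}, 'm::finite) chart set"
  assumes M: "smooth_manifold \<A>" and A: "shape_operator \<A> \<B> G f \<xi> A"
    and x: "x \<in> \<A>" "p \<in> chart_dom x"
  shows "trace (A (chart_at \<A> p) p) = trace (A x p)"
    and "complex_spectrum (A (chart_at \<A> p) p) = complex_spectrum (A x p)"
proof -
  define x' where "x' = chart_at \<A> p"
  have x': "x' \<in> \<A>" "p \<in> chart_dom x'" using chart_at[OF M] by (auto simp: x'_def)
  have J: "jacobian x' x p ** jacobian x x' p = mat 1" "jacobian x x' p ** jacobian x' x p = mat 1"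
    using jacobian_inverse[OF M] x x' by auto
  have c: "jacobian x x' p ** A x p = A x' p ** jacobian x x' p"
    "jacobian x' x p ** A x' p = A x p ** jacobian x' x p"
    using A x x' by (auto simp: shape_operator_def)
  have "trace (A x' p) = trace (A x' p ** (jacobian x x' p ** jacobian x' x p))" by (simp add: J)
  also have "\<dots> = trace ((jacobian x x' p ** A x p) ** jacobian x' x p)" by (simp add: c matrix_mul_assoc)
  also have "\<dots> = trace (jacobian x' x p ** (jacobian x x' p ** A x p))" by (rule trace_mul_sym)
  also have "\<dots> = trace (A x p)" by (simp add: matrix_mul_assoc J)
  finally show "trace (A (chart_at \<A> p) p) = trace (A x p)" by (simp add: x'_def)
  show "complex_spectrum (A (chart_at \<A> p) p) = complex_spectrum (A x p)"
    using complex_spectrum_similar_subset[OF J(1) c(1)[symmetric]] complex_spectrum_similar_subset[OF J(2) c(2)[symmetric]]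
    by (auto simp: x'_def)
qed

section \<open>The mean curvature of a hypersurface\<close>

context
  fixes \<A> :: "('a::{t2_space,second_countable_topology}, 4) chart set"
    and \<B> :: "('b::{t2_space,second_countable_topology}, 5) chart set"
    and G :: "('b, 5) chart \<Rightarrow> 'b \<Rightarrow> real^5^5"
    and f :: "'a \<Rightarrow> 'b"
    and \<xi> :: "('b, 5) chart \<Rightarrow> 'a \<Rightarrow> real^5"
    and A :: "('a, 4) chart \<Rightarrow> 'a \<Rightarrow> real^4^4"
    and r s :: nat
    and c \<epsilon> lam :: real
  assumes sf: "space_form \<B> G s c"
    and imm: "nondegenerate_immersion \<A> \<B> G f r"
    and normal: "unit_normal_field \<A> \<B> G f \<xi> \<epsilon>"
    and shape: "shape_operator \<A> \<B> G f \<xi> A"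
    and proper: "proper_mean_curvature_vector \<A> \<B> G f \<xi> \<epsilon> A lam"
    and curvatures: "\<forall>p. card (principal_curvatures \<A> A p) = 2 \<and> (\<forall>\<kappa>\<in>principal_curvatures \<A> A p. Im \<kappa> \<noteq> 0)"
begin

lemma open_overlap: "x \<in> \<A> \<Longrightarrow> y \<in> \<B> \<Longrightarrow> open (overlap f x y)"
proof -
  assume "x \<in> \<A>" "y \<in> \<B>"
  then have "open (chart_dom x)" "open (chart_dom y)" "continuous_on UNIV f"
    using imm sf by (auto simp: nondegenerate_immersion_def space_form_def smooth_manifold_def is_chart_def smooth_map_def)
  then show ?thesis unfolding overlap_def by (intro open_Int open_vimage)
qed

lemma proper_hypersurface_patch_of_charts:
  assumes x: "x \<in> \<A>" and y: "y \<in> \<B>"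
  shows "proper_hypersurface_patch (chart_map y ` chart_dom y) (metric_rep G y) (chart_map x ` overlap f x y)
    (map_rep f x y) (field_rep \<xi> x y) (\<lambda>z. A x (chart_inv x z)) \<epsilon> c
    (\<lambda>z. mean_curvature \<A> \<epsilon> A (chart_inv x z)) lam"
proof -
  let ?S = "chart_map y ` chart_dom y" and ?U = "chart_map x ` overlap f x y"
  let ?g = "metric_rep G y" and ?F = "map_rep f x y"
  have MA: "smooth_manifold \<A>" and MB: "smooth_manifold \<B>" and metric: "pseudo_riemannian_metric \<B> G s"
    using imm sf by (auto simp: nondegenerate_immersion_def space_form_def)
  have cx: "is_chart x" and cy: "is_chart y" using MA MB x y by (auto simp: smooth_manifold_def)
  have S: "chart_inv y z \<in> chart_dom y \<and> chart_map y (chart_inv y z) = z" if "z \<in> ?S" for z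
    by (rule chart_inv_right[OF cy that])
  have sub: "overlap f x y \<subseteq> chart_dom x" by (auto simp: overlap_def)
  have U: "chart_inv x z \<in> overlap f x y \<and> chart_map x (chart_inv x z) = z" if "z \<in> ?U" for z
    using that chart_inv_left[OF cx] sub by force
  have gF: "?g (?F z) = G y (f (chart_inv x z))" if "z \<in> ?U" for z
    using U[OF that] chart_inv_left[OF cy] by (simp add: metric_rep_def map_rep_def overlap_def)
  have mp: "metric_patch ?S ?g"
  proof
    show "open ?S" using cy by (simp add: is_chart_def)
    show "smooth_on ?S ?g" using metric y by (simp add: pseudo_riemannian_metric_def)
    show "transpose (?g z) = ?g z" "invertible (?g z)" if "z \<in> ?S" for z
      using metric y S[OF that] by (auto simp: pseudo_riemannian_metric_def metric_rep_def)
  qed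
  have curv: "curvature ?g z u v w = c *\<^sub>R (form (?g z) v w *\<^sub>R u - form (?g z) u w *\<^sub>R v)" if z: "z \<in> ?S" for z u v w
  proof (rule metric_patch.constant_curvature[OF mp z])
    show "sectional_curvature ?g z u v = c" if "area_form (?g z) u v \<noteq> 0" for u v
      using sf y S[OF z] that unfolding space_form_def metric_rep_def o_def by metis
  qed simp
  have mm: "metric_map ?S ?g ?U ?F"
  proof (rule metric_map.intro[OF mp metric_map_axioms.intro])
    show "open ?U" by (rule chart_open_image[OF cx open_overlap[OF x y] sub])
    show "smooth_on ?U ?F" using imm x y by (simp add: nondegenerate_immersion_def smooth_map_def)
    show "?F z \<in> ?S" if "z \<in> ?U" for z using U[OF that] by (auto simp: map_rep_def overlap_def)
  qed
  have hp: "hypersurface_patch ?S ?g ?U ?F (field_rep \<xi> x y) (\<lambda>z. A x (chart_inv x z)) \<epsilon> c"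
  proof (rule hypersurface_patch.intro[OF mm hypersurface_patch_axioms.intro])
    show "CARD(5) = Suc CARD(4)" by simp
    show "smooth_on ?U (field_rep \<xi> x y)"
      using normal x y by (simp add: unit_normal_field_def smooth_field_along_def)
    show "\<epsilon> \<in> {1, -1}" using normal by (simp add: unit_normal_field_def)
    show "curvature ?g z u v w = c *\<^sub>R (form (?g z) v w *\<^sub>R u - form (?g z) u w *\<^sub>R v)" if "z \<in> ?S" for z u v w
      by (rule curv[OF that])
  next
    fix z assume z: "z \<in> ?U"
    define p where "p = chart_inv x z"
    have p: "p \<in> overlap f x y" "chart_map x p = z" using U[OF z] by (auto simp: p_def)
    have \<xi>p: "field_rep \<xi> x y z = \<xi> y p" by (simp add: field_rep_def p_def)
    have "invertible (induced_metric ?g ?F (chart_map x p))"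
      using imm x y p(1) unfolding nondegenerate_immersion_def by blast
    then show "invertible (induced_metric ?g ?F z)" by (simp add: p(2))
    have n: "form (G y (f p)) (\<xi> y p) (\<xi> y p) = \<epsilon> \<and>
        (\<forall>u. form (G y (f p)) (\<xi> y p) (ddir ?F (chart_map x p) u) = 0)"
      using normal x y p(1) unfolding unit_normal_field_def by blast
    then show "form (?g (?F z)) (field_rep \<xi> x y z) (field_rep \<xi> x y z) = \<epsilon>"
      "form (?g (?F z)) (field_rep \<xi> x y z) (ddir ?F z u) = 0" for u
      by (simp_all add: gF[OF z] \<xi>p p_def[symmetric] p(2))
    have "cov_along ?g ?F (field_rep \<xi> x y) (chart_map x p) u = - ddir ?F (chart_map x p) (A x p *v u)" for u
      using shape x y p(1) unfolding shape_operator_def by blast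
    then show "cov_along ?g ?F (field_rep \<xi> x y) z u = - ddir ?F z (A x (chart_inv x z) *v u)" for u
      by (simp add: p(2) p_def[symmetric])
  qed
  show ?thesis
  proof (rule proper_hypersurface_patch.intro[OF hp proper_hypersurface_patch_axioms.intro])
    fix z assume z: "z \<in> ?U"
    define p where "p = chart_inv x z"
    have p: "p \<in> overlap f x y" "chart_map x p = z" using U[OF z] by (auto simp: p_def)
    have px: "p \<in> chart_dom x" using p(1) by (auto simp: overlap_def)
    note indep = trace_and_spectrum_chart_independent[OF MA shape x px]
    show "mean_curvature \<A> \<epsilon> A (chart_inv x z) = 1 / 4 * \<epsilon> * trace (A x (chart_inv x z))"
      by (simp add: mean_curvature_def p_def[symmetric] indep(1))
    have pc: "principal_curvatures \<A> A p = complex_spectrum (A x p)"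
      unfolding indep(2)[symmetric] by (simp add: principal_curvatures_def complex_spectrum_def)
    show "card (complex_spectrum (A x (chart_inv x z))) = 2"
      "\<kappa> \<in> complex_spectrum (A x (chart_inv x z)) \<Longrightarrow> Im \<kappa> \<noteq> 0" for \<kappa>
      using curvatures by (auto simp: p_def[symmetric] pc[symmetric])
    have "has_laplacian ?g ?F (field_rep (mean_curvature_vector \<A> \<xi> \<epsilon> A) x y) (chart_map x p)
          (lam *\<^sub>R mean_curvature_vector \<A> \<xi> \<epsilon> A y p)"
      using proper x y p(1) unfolding proper_mean_curvature_vector_def by blast
    moreover have "field_rep (mean_curvature_vector \<A> \<xi> \<epsilon> A) x y
        = (\<lambda>z. mean_curvature \<A> \<epsilon> A (chart_inv x z) *\<^sub>R field_rep \<xi> x y z)"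
      by (simp add: fun_eq_iff field_rep_def mean_curvature_vector_def)
    ultimately show "has_laplacian ?g ?F (\<lambda>z. mean_curvature \<A> \<epsilon> A (chart_inv x z) *\<^sub>R field_rep \<xi> x y z) z
        (lam *\<^sub>R (mean_curvature \<A> \<epsilon> A (chart_inv x z) *\<^sub>R field_rep \<xi> x y z))"
      by (simp add: p(2) p_def[symmetric] field_rep_def mean_curvature_vector_def)
  qed
qed

text \<open>Both facts about the patch are carried over to the manifold; a ball on which the mean curvature is
  constant becomes the open set \<open>N\<close>.\<close>
lemma mean_curvature_local:
  shows "\<exists>N. open N \<and> p \<in> N \<and> (\<forall>q\<in>N. mean_curvature \<A> \<epsilon> A q = mean_curvature \<A> \<epsilon> A p)"
    and "mean_curvature \<A> \<epsilon> A p \<noteq> 0 \<Longrightarrow> \<exists>a b. b > 0 \<and> mean_curvature \<A> \<epsilon> A p = \<epsilon> * a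
      \<and> 4 * (a\<^sup>2 - b\<^sup>2) = \<epsilon> * lam \<and> a\<^sup>2 + b\<^sup>2 = - c * \<epsilon>"
proof -
  have MA: "smooth_manifold \<A>" and MB: "smooth_manifold \<B>"
    using imm sf by (auto simp: nondegenerate_immersion_def space_form_def)
  define x where "x = chart_at \<A> p"
  define y where "y = chart_at \<B> (f p)"
  have x: "x \<in> \<A>" "p \<in> chart_dom x" and y: "y \<in> \<B>" "f p \<in> chart_dom y"
    using chart_at[OF MA] chart_at[OF MB] by (auto simp: x_def y_def)
  have cx: "is_chart x" using MA x by (auto simp: smooth_manifold_def)
  have p: "p \<in> overlap f x y" using x y by (simp add: overlap_def)
  interpret P: proper_hypersurface_patch "chart_map y ` chart_dom y" "metric_rep G y" "chart_map x ` overlap f x y"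
    "map_rep f x y" "field_rep \<xi> x y" "\<lambda>z. A x (chart_inv x z)" \<epsilon> c "\<lambda>z. mean_curvature \<A> \<epsilon> A (chart_inv x z)" lam
    by (rule proper_hypersurface_patch_of_charts[OF x(1) y(1)])
  have pU: "chart_map x p \<in> chart_map x ` overlap f x y" using p by blast
  obtain r where r: "r > 0" "ball (chart_map x p) r \<subseteq> chart_map x ` overlap f x y"
    using P.open_U pU openE by blast
  define N where "N = chart_dom x \<inter> chart_map x -` ball (chart_map x p) r"
  have "open N" unfolding N_def by (rule chart_open_vimage[OF cx open_ball])
  moreover have "p \<in> N" using x r by (simp add: N_def)
  moreover have "mean_curvature \<A> \<epsilon> A q = mean_curvature \<A> \<epsilon> A p" if q: "q \<in> N" for q
    using P.\<phi>_locally_constant[OF r(2), of "chart_map x q"] q chart_inv_left[OF cx] x by (simp add: N_def)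
  ultimately show "\<exists>N. open N \<and> p \<in> N \<and> (\<forall>q\<in>N. mean_curvature \<A> \<epsilon> A q = mean_curvature \<A> \<epsilon> A p)"
    by blast
  assume "mean_curvature \<A> \<epsilon> A p \<noteq> 0"
  then have "mean_curvature \<A> \<epsilon> A (chart_inv x (chart_map x p)) \<noteq> 0" by (simp add: chart_inv_left[OF cx x(2)])
  from P.principal_curvature_identities[OF pU this] obtain a b where "b > 0"
    "mean_curvature \<A> \<epsilon> A (chart_inv x (chart_map x p)) = \<epsilon> * a" "4 * (a\<^sup>2 - b\<^sup>2) = \<epsilon> * lam" "a\<^sup>2 + b\<^sup>2 = - c * \<epsilon>" .
  then show "\<exists>a b. b > 0 \<and> mean_curvature \<A> \<epsilon> A p = \<epsilon> * a
      \<and> 4 * (a\<^sup>2 - b\<^sup>2) = \<epsilon> * lam \<and> a\<^sup>2 + b\<^sup>2 = - c * \<epsilon>"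
    unfolding chart_inv_left[OF cx x(2)] by blast
qed

end

theorem theorem4p8:
  fixes \<A> :: "('a::{t2_space,second_countable_topology}, 4) chart set"
    and \<B> :: "('b::{t2_space,second_countable_topology}, 5) chart set"
    and G :: "('b, 5) chart \<Rightarrow> 'b \<Rightarrow> real^5^5"
    and f :: "'a \<Rightarrow> 'b"
    and \<xi> :: "('b, 5) chart \<Rightarrow> 'a \<Rightarrow> real^5"
    and A :: "('a, 4) chart \<Rightarrow> 'a \<Rightarrow> real^4^4"
    and r s :: nat
    and c \<epsilon> lam :: real
    and H :: "'a \<Rightarrow> real"
  defines "H \<equiv> mean_curvature \<A> \<epsilon> A"
  assumes "space_form \<B> G s c"
    and "nondegenerate_immersion \<A> \<B> G f r"
    and "unit_normal_field \<A> \<B> G f \<xi> \<epsilon>"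
    and "shape_operator \<A> \<B> G f \<xi> A"
    and "proper_mean_curvature_vector \<A> \<B> G f \<xi> \<epsilon> A lam"
    and "\<forall>p. card (principal_curvatures \<A> A p) = 2 \<and> (\<forall>\<kappa>\<in>principal_curvatures \<A> A p. Im \<kappa> \<noteq> 0)"
  shows "(c * \<epsilon> \<ge> 0 \<longrightarrow> (\<forall>p. H p = 0))
    \<and> (c * \<epsilon> < 0 \<and> \<bar>\<epsilon> * lam\<bar> \<ge> - 4 * c * \<epsilon> \<longrightarrow> (\<forall>p. H p = 0))
    \<and> (c * \<epsilon> < 0 \<and> \<bar>\<epsilon> * lam\<bar> < - 4 * c * \<epsilon> \<longrightarrow>
        (\<forall>C\<in>components UNIV. (\<forall>p\<in>C. H p = 0) \<or> (\<forall>p\<in>C. (H p)\<^sup>2 = (\<epsilon> * lam - 4 * c * \<epsilon>) / 8)))"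
proof -
  note local = mean_curvature_local[OF assms(2-7), folded H_def]
  have key: "(H p)\<^sup>2 = (\<epsilon> * lam - 4 * c * \<epsilon>) / 8 \<and> c * \<epsilon> < 0 \<and> \<bar>\<epsilon> * lam\<bar> < - 4 * c * \<epsilon>" if Hp: "H p \<noteq> 0" for p
  proof -
    obtain a b where ab: "b > 0" "H p = \<epsilon> * a" "4 * (a\<^sup>2 - b\<^sup>2) = \<epsilon> * lam" "a\<^sup>2 + b\<^sup>2 = - c * \<epsilon>"
      using local(2)[OF Hp] by blast
    have "\<epsilon> = 1 \<or> \<epsilon> = -1" using assms(4) by (auto simp: unit_normal_field_def)
    then have H2: "(H p)\<^sup>2 = a\<^sup>2" using ab(2) by auto
    have pos: "a\<^sup>2 > 0" "b\<^sup>2 > 0" using Hp ab(1,2) by auto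
    have sum: "a\<^sup>2 + b\<^sup>2 = - (c * \<epsilon>)" and diff: "4 * a\<^sup>2 - 4 * b\<^sup>2 = \<epsilon> * lam" using ab(3,4) by simp_all
    have "x = (l - 4 * k) / 8 \<and> k < 0 \<and> \<bar>l\<bar> < - 4 * k"
      if "x > 0" "y > 0" "x + y = - k" "4 * x - 4 * y = l" for x y k l :: real
      using that by (simp add: abs_less_iff)
    from this[OF pos sum diff]
    have "(H p)\<^sup>2 = (\<epsilon> * lam - 4 * (c * \<epsilon>)) / 8 \<and> c * \<epsilon> < 0 \<and> \<bar>\<epsilon> * lam\<bar> < - 4 * (c * \<epsilon>)"
      unfolding H2 .
    then show ?thesis by (simp add: mult.assoc)
  qed
  have const: "H p = H q" if "C \<in> components UNIV" "p \<in> C" "q \<in> C" for C p q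
  proof -
    have "H constant_on C"
    proof (rule locally_constant_imp_constant[OF in_components_connected[OF that(1)]])
      fix a assume a: "a \<in> C"
      obtain N where N: "open N" "a \<in> N" "\<forall>q\<in>N. H q = H a" using local(1)[of a] by blast
      have "openin (top_of_set C) (C \<inter> N)" by (rule openin_open_Int[OF N(1)])
      then show "\<exists>T. openin (top_of_set C) T \<and> a \<in> T \<and> (\<forall>x\<in>T. H x = H a)"
        using a N(2,3) by blast
    qed
    then show ?thesis using that(2,3) by (auto simp: constant_on_def)
  qed
  have "(\<forall>p\<in>C. H p = 0) \<or> (\<forall>p\<in>C. (H p)\<^sup>2 = (\<epsilon> * lam - 4 * c * \<epsilon>) / 8)" if "C \<in> components UNIV" for C
  proof (cases "\<exists>p\<in>C. H p \<noteq> 0")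
    case True
    then obtain p where p: "p \<in> C" "H p \<noteq> 0" by blast
    have "(H q)\<^sup>2 = (\<epsilon> * lam - 4 * c * \<epsilon>) / 8" if "q \<in> C" for q
      using key[OF p(2)] const[OF \<open>C \<in> components UNIV\<close> p(1) that] by simp
    then show ?thesis by blast
  qed blast
  then show ?thesis using key by (meson not_less)
qed

end
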